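(* Let $\mu>0$, $\widetilde n_\mu(\mathbf k)=\frac{1}{|\mathbf k|^2+\mu}$ for $\mathbf k\in\mathbb R^3$, and let $\widetilde g\in L^2(\mathbb R^3)$. Put $\Phi(\mathbf k):=\widetilde g(\mathbf k)/\widetilde n_\mu(\mathbf k)$. The following three conditions are equivalent: (a) $\widetilde g\in\operatorname{Ker}(\widetilde L_\mu)$; (b) $\Phi$ is a collisional invariant, namely $\Phi(\mathbf k_1)+\Phi(\mathbf k_2)=\Phi(\mathbf k)+\Phi(\mathbf k_3)$ for almost every quadruple $(\mathbf k,\mathbf k_1,\mathbf k_2,\mathbf k_3)$ satisfying $\mathbf k_1+\mathbf k_2=\mathbf k+\mathbf k_3$ and $|\mathbf k_1|^2+|\mathbf k_2|^2=|\mathbf k|^2+|\mathbf k_3|^2$; (c) there exist $\alpha,\gamma\in\mathbb R$ and $\beta\in\mathbb R^3$ such that $\widetilde g(\mathbf k)=\widetilde n_\mu(\mathbf k)\,(\alpha+\beta\cdot\mathbf k+\gamma|\mathbf k|^2)$ for almost every $\mathbf k\in\mathbb R^3$, with the right-hand side belonging to $L^2(\mathbb R^3)$. Among the functions in (c) only (the multiples of) $\widetilde n_\mu$ belong to $L^2(\mathbb R^3)$, so that $\operatorname{Ker}_{L^2(\mathbb R^3)}(\widetilde L_\mu)=\operatorname{Span}\{\widetilde n_\mu\}$. Consequently, in radial energy variables: $g\in L^2((0,\infty);\sqrt\omega\,d\omega)$ belongs to $\operatorname{Ker}(L_\mu)$ if and only if $g(\omega)=a\,n_\mu(\omega)$ for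 some $a\in\mathbb R$, where $n_\mu(\omega)=\frac1{\omega+\mu}$.
   Context: All functions are real-valued. Operator in the variable $\mathbf k$: $\widetilde L_\mu$ is the linearised collision operator $$\widetilde L_\mu\widetilde g(\mathbf k)=\iiint \widetilde n_1\widetilde n_2\widetilde n_3\Big[-\frac{\widetilde g}{\widetilde n}-\frac{\widetilde g_3}{\widetilde n_3}+\frac{\widetilde g_1}{\widetilde n_1}+\frac{\widetilde g_2}{\widetilde n_2}\Big]\delta(\mathbf k_1+\mathbf k_2-\mathbf k-\mathbf k_3)\,\delta(|\mathbf k_1|^2+|\mathbf k_2|^2-|\mathbf k|^2-|\mathbf k_3|^2)\,d\mathbf k_1d\mathbf k_2d\mathbf k_3,$$ with $\widetilde n_i=\widetilde n_\mu(\mathbf k_i)$, $\widetilde g_i=\widetilde g(\mathbf k_i)$, understood as the bounded self-adjoint operator on $L^2(\mathbb R^3)$ whose quadratic form is $$-\langle\widetilde L_\mu\widetilde g,\widetilde g\rangle_{L^2(\mathbb R^3)}=\frac14\int \widetilde n\,\widetilde n_1\widetilde n_2\widetilde n_3\Big[\frac{\widetilde g_1}{\widetilde n_1}+\frac{\widetilde g_2}{\widetilde n_2}-\frac{\widetilde g}{\widetilde n}-\frac{\widetilde g_3}{\widetilde n_3}\Big]^2 d\sigma .$$ Here $d\sigma$ is the measure $\delta(\mathbf k_1+\mathbf k_2-\mathbf k-\mathbf k_3)\delta(|\mathbf k_1|^2+|\mathbf k_2|^2-|\mathbf k|^2-|\mathbf k_3|^2)\,d\mathbf k\,d\mathbf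 k_1d\mathbf k_2d\mathbf k_3$ on the resonant manifold; writing $\mathbf k_1=\mathbf k+a$, $\mathbf k_2=\mathbf k+b$, $\mathbf k_3=\mathbf k+a+b$ with $a\perp b$, it is $\frac{1}{2|a|}\,d\mathbf k\,da\,d\mathcal H^2(b)$ with $b$ ranging over the plane $a^\perp$. "Almost every quadruple" is with respect to this measure. Operator in the variable $\omega=|\mathbf k|^2$: on $L^2((0,\infty);\sqrt\omega\,d\omega)$, $L_\mu$ is the bounded operator extending by density, from $g\in C_c^\infty(0,\infty)$, $$L_\mu g(\omega)=\iint_{D(\omega)}\Omega\,n_1n_2n_3\Big[-\frac{g(\omega)}{n_\mu(\omega)}-\frac{g_3}{n_3}+\frac{g_1}{n_1}+\frac{g_2}{n_2}\Big]d\omega_1d\omega_2,$$ where $D(\omega)=\{\omega_1\ge0,\ \omega_2\ge0,\ \omega_1+\omega_2\ge\omega\}$, $\omega_3=\omega_1+\omega_2-\omega$, $g_i=g(\omega_i)$, $n_i=n_\mu(\omega_i)$, and $\Omega=\min(\sqrt\omega,\sqrt{\omega_1},\sqrt{\omega_2},\sqrt{\omega_3})/\sqrt\omega$. *)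

theory Defs
  imports "HOL-Analysis.Analysis"
begin

type_synonym R3 = "real^3"

section \<open>Square-integrable functions and operators on them\<close>

text \<open>
  Elements of \<open>L\<^sup>2(M)\<close> are represented by functions, operators on \<open>L\<^sup>2(M)\<close> by maps on
  functions; all identities are required up to \<open>M\<close>-null sets. Linearity and boundedness
  together force an operator to respect equality almost everywhere.
\<close>

definition L2 :: "'a measure \<Rightarrow> ('a \<Rightarrow> real) set" where
  "L2 M = {f \<in> borel_measurable M. integrable M (\<lambda>x. (f x)\<^sup>2)}"

definition L2_inner :: "'a measure \<Rightarrow> ('a \<Rightarrow> real) \<Rightarrow> ('a \<Rightarrow> real) \<Rightarrow> real" where
  "L2_inner M f g = (LINT x|M. f x * g x)"

definition L2_norm :: "'a measure \<Rightarrow> ('a \<Rightarrow> real) \<Rightarrow> real" where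
  "L2_norm M f = sqrt (L2_inner M f f)"

definition L2_bounded_operator ::
    "'a measure \<Rightarrow> (('a \<Rightarrow> real) \<Rightarrow> ('a \<Rightarrow> real)) \<Rightarrow> bool" where
  "L2_bounded_operator M T \<longleftrightarrow>
     (\<forall>f\<in>L2 M. T f \<in> L2 M) \<and>
     (\<forall>f\<in>L2 M. \<forall>g\<in>L2 M. AE x in M. T (\<lambda>y. f y + g y) x = T f x + T g x) \<and>
     (\<forall>c. \<forall>f\<in>L2 M. AE x in M. T (\<lambda>y. c * f y) x = c * T f x) \<and>
     (\<exists>C. \<forall>f\<in>L2 M. L2_norm M (T f) \<le> C * L2_norm M f)"

definition L2_self_adjoint ::
    "'a measure \<Rightarrow> (('a \<Rightarrow> real) \<Rightarrow> ('a \<Rightarrow> real)) \<Rightarrow> bool" where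
  "L2_self_adjoint M T \<longleftrightarrow>
     (\<forall>f\<in>L2 M. \<forall>g\<in>L2 M. L2_inner M (T f) g = L2_inner M f (T g))"

definition L2_Ker ::
    "'a measure \<Rightarrow> (('a \<Rightarrow> real) \<Rightarrow> ('a \<Rightarrow> real)) \<Rightarrow> ('a \<Rightarrow> real) set" where
  "L2_Ker M T = {f \<in> L2 M. AE x in M. T f x = 0}"

definition L2_Span1 :: "'a measure \<Rightarrow> ('a \<Rightarrow> real) \<Rightarrow> ('a \<Rightarrow> real) set" where
  "L2_Span1 M h = {f \<in> L2 M. \<exists>c. AE x in M. f x = c * h x}"


section \<open>The resonant manifold\<close>

text \<open>
  Area measure on the plane orthogonal to \<open>a \<noteq> 0\<close>. The area of a Borel set \<open>B\<close> of the plane is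
  the volume of the cylinder of height one over \<open>B\<close>, so the area measure is the image, under
  the orthogonal projection onto the plane, of Lebesgue measure on the slab
  \<open>0 \<le> x \<bullet> sgn a \<le> 1\<close>, where \<open>sgn a = a / |a|\<close>.
\<close>

definition perp_area :: "R3 \<Rightarrow> R3 measure" where
  "perp_area a =
     distr (restrict_space lborel {x. 0 \<le> x \<bullet> sgn a \<and> x \<bullet> sgn a \<le> 1}) borel
       (\<lambda>x. x - (x \<bullet> sgn a) *\<^sub>R sgn a)"

text \<open>
  The measure \<open>d\<sigma>\<close> on quadruples \<open>(k, k\<^sub>1, k\<^sub>2, k\<^sub>3)\<close>. Lemma \<open>emeasure_resonant_measure\<close> below
  confirms that the iterated integral is countably additive.
\<close>

definition resonant_integral :: "(R3 \<times> R3 \<times> R3 \<times> R3) set \<Rightarrow> ennreal" where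
  "resonant_integral A =
     (\<integral>\<^sup>+ k. (\<integral>\<^sup>+ a. ennreal (1 / (2 * norm a)) *
        (\<integral>\<^sup>+ b. indicator A (k, k + a, k + b, k + a + b) \<partial>perp_area a) \<partial>lborel) \<partial>lborel)"

definition resonant_measure :: "(R3 \<times> R3 \<times> R3 \<times> R3) measure" where
  "resonant_measure = measure_of UNIV (sets borel) resonant_integral"

lemma sets_resonant_measure [measurable_cong, simp]: "sets resonant_measure = sets borel"
  by (simp add: resonant_measure_def sets.sigma_sets_eq[of borel, simplified])

lemma emeasure_resonant_measure:
  assumes A: "A \<in> sets borel"
  shows "emeasure resonant_measure A = resonant_integral A"
proof -
  let ?S = "\<lambda>a x. 0 \<le> x \<bullet> sgn a \<and> x \<bullet> sgn (a::R3) \<le> (1::real)"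
  let ?p = "\<lambda>a x. x - (x \<bullet> sgn a) *\<^sub>R sgn (a::R3)"
  let ?q = "\<lambda>(k, a, x). (k, k + a, k + ?p a x, k + a + ?p a x)"
  let ?w = "\<lambda>(k::R3, a, x). ennreal (1 / (2 * norm a)) * indicator {x. ?S a x} x"
  let ?P = "lborel \<Otimes>\<^sub>M lborel \<Otimes>\<^sub>M lborel :: (R3 \<times> R3 \<times> R3) measure"
  have [measurable]: "(sgn :: R3 \<Rightarrow> R3) \<in> borel_measurable borel"
    unfolding sgn_div_norm[abs_def] by measurable
  have sigma_finite_lborel: "sigma_finite_measure (lborel :: R3 measure)"
    by unfold_locales
  have sigma_finite_pairL:
    "sigma_finite_measure (lborel \<Otimes>\<^sub>M lborel :: (R3 \<times> R3) measure)"
    by (simp add: lborel_prod) unfold_locales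
  define N where "N = distr (density ?P ?w) borel ?q"
  have w: "?w \<in> borel_measurable ?P"
    by (simp add: indicator_def) measurable
  have q: "?q \<in> measurable ?P borel"
    by (simp add: borel_prod[symmetric]) measurable
  have sl: "{x. ?S a x} \<in> sets borel" for a
    by measurable
  have perp: "(\<integral>\<^sup>+ b. f b \<partial>perp_area a) = (\<integral>\<^sup>+ x. indicator {x. ?S a x} x * f (?p a x) \<partial>lborel)"
    if [measurable]: "f \<in> borel_measurable borel" for f :: "R3 \<Rightarrow> ennreal" and a
  proof -
    have "(\<integral>\<^sup>+ b. f b \<partial>perp_area a)
        = (\<integral>\<^sup>+ x. f (?p a x) \<partial>restrict_space lborel {x. ?S a x})"
      unfolding perp_area_def
      by (subst nn_integral_distr) (auto intro!: measurable_restrict_space1)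
    also have "\<dots> = (\<integral>\<^sup>+ x. f (?p a x) * indicator {x. ?S a x} x \<partial>lborel)"
      using sl by (subst nn_integral_restrict_space) auto
    finally show ?thesis by (simp add: mult.commute)
  qed
  have N: "emeasure N B = resonant_integral B" if B[measurable]: "B \<in> sets borel" for B
  proof -
    have qi: "(\<lambda>z. indicator B (?q z) :: ennreal) \<in> borel_measurable ?P"
      using measurable_compose[OF q, of "indicator B :: _ \<Rightarrow> ennreal" borel] by simp
    have "emeasure N B = (\<integral>\<^sup>+ z. indicator B z \<partial>N)"
      by (simp add: N_def)
    also have "\<dots> = (\<integral>\<^sup>+ z. indicator B (?q z) \<partial>density ?P ?w)"
      unfolding N_def using q by (subst nn_integral_distr) auto
    also have "\<dots> = (\<integral>\<^sup>+ z. ?w z * indicator B (?q z) \<partial>?P)"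
      using w qi by (rule nn_integral_density)
    also have "\<dots> = (\<integral>\<^sup>+ k. (\<integral>\<^sup>+ y. ?w (k, y) * indicator B (?q (k, y))
                         \<partial>(lborel \<Otimes>\<^sub>M lborel)) \<partial>lborel)"
      using w qi by (intro sigma_finite_measure.nn_integral_fst[symmetric]
          sigma_finite_pairL borel_measurable_times_ennreal)
    also have "\<dots> = (\<integral>\<^sup>+ k. (\<integral>\<^sup>+ a. (\<integral>\<^sup>+ x. ?w (k, a, x) * indicator B (?q (k, a, x))
                         \<partial>lborel) \<partial>lborel) \<partial>lborel)"
    proof (rule nn_integral_cong)
      fix k :: "R3"
      have "(\<lambda>y. ?w (k, y) * indicator B (?q (k, y))) \<in> borel_measurable (lborel \<Otimes>\<^sub>M lborel)"
        using measurable_compose[OF measurable_Pair1' borel_measurable_times_ennreal[OF w qi], of k]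
        by simp
      then show "(\<integral>\<^sup>+ y. ?w (k, y) * indicator B (?q (k, y)) \<partial>(lborel \<Otimes>\<^sub>M lborel))
          = (\<integral>\<^sup>+ a. (\<integral>\<^sup>+ x. ?w (k, a, x) * indicator B (?q (k, a, x)) \<partial>lborel) \<partial>lborel)"
        by (intro sigma_finite_measure.nn_integral_fst[symmetric] sigma_finite_lborel)
    qed
    also have "\<dots> = resonant_integral B"
      unfolding resonant_integral_def
    proof (intro nn_integral_cong)
      fix k a :: "R3"
      have f: "(\<lambda>b. indicator B (k, k + a, k + b, k + a + b) :: ennreal) \<in> borel_measurable borel"
        by (rule measurable_compose[where N = borel]) (auto simp: borel_prod[symmetric])
      have [measurable]: "(\<lambda>x. indicator {x. ?S a x} x :: ennreal) \<in> borel_measurable borel"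
        using sl by simp
      have m: "(\<lambda>x. indicator {x. ?S a x} x * indicator B (k, k + a, k + ?p a x, k + a + ?p a x)
            :: ennreal) \<in> borel_measurable lborel"
        using measurable_compose[of "?p a" borel, OF _ f] by measurable
      have "(\<integral>\<^sup>+ x. ?w (k, a, x) * indicator B (?q (k, a, x)) \<partial>lborel)
          = (\<integral>\<^sup>+ x. ennreal (1 / (2 * norm a)) * (indicator {x. ?S a x} x *
               indicator B (k, k + a, k + ?p a x, k + a + ?p a x)) \<partial>lborel)"
        by (simp add: mult.assoc)
      also have "\<dots> = ennreal (1 / (2 * norm a)) *
          (\<integral>\<^sup>+ b. indicator B (k, k + a, k + b, k + a + b) \<partial>perp_area a)"
        using m by (simp only: nn_integral_cmult perp[OF f])
      finally show "(\<integral>\<^sup>+ x. ?w (k, a, x) * indicator B (?q (k, a, x)) \<partial>lborel)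
          = ennreal (1 / (2 * norm a)) *
          (\<integral>\<^sup>+ b. indicator B (k, k + a, k + b, k + a + b) \<partial>perp_area a)" .
    qed
    finally show ?thesis .
  qed
  have sp: "sets N = sets borel" "space N = UNIV" by (simp_all add: N_def)
  have "resonant_measure = measure_of UNIV (sets borel) (emeasure N)"
    unfolding resonant_measure_def
    by (rule measure_of_eq) (auto simp: N sets.sigma_sets_eq[of borel, simplified])
  also have "\<dots> = N"
    using measure_of_of_measure[of N] by (simp add: sp)
  finally show ?thesis using N[OF A] by simp
qed


section \<open>The linearised collision operators\<close>

definition n_tilde :: "real \<Rightarrow> R3 \<Rightarrow> real" where
  "n_tilde \<mu> k = 1 / ((norm k)\<^sup>2 + \<mu>)"

definition collisional_invariant :: "(R3 \<Rightarrow> real) \<Rightarrow> bool" where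
  "collisional_invariant \<Phi> \<longleftrightarrow>
     (AE (k, k1, k2, k3) in resonant_measure. \<Phi> k1 + \<Phi> k2 = \<Phi> k + \<Phi> k3)"

text \<open>
  \<open>has_bochner_integral\<close> asserts that the quadratic form is finite on all of \<open>L\<^sup>2\<close> as well as
  its value. By polarisation the operator is unique up to null sets.
\<close>

definition is_collision_operator ::
    "real \<Rightarrow> ((R3 \<Rightarrow> real) \<Rightarrow> (R3 \<Rightarrow> real)) \<Rightarrow> bool" where
  "is_collision_operator \<mu> T \<longleftrightarrow>
     L2_bounded_operator lborel T \<and> L2_self_adjoint lborel T \<and>
     (\<forall>g\<in>L2 lborel.
        has_bochner_integral resonant_measure
          (\<lambda>(k, k1, k2, k3).
             1 / 4 * (n_tilde \<mu> k * n_tilde \<mu> k1 * n_tilde \<mu> k2 * n_tilde \<mu> k3 *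
               (g k1 / n_tilde \<mu> k1 + g k2 / n_tilde \<mu> k2
                  - g k / n_tilde \<mu> k - g k3 / n_tilde \<mu> k3)\<^sup>2))
          (- L2_inner lborel (T g) g))"

definition n_energy :: "real \<Rightarrow> real \<Rightarrow> real" where
  "n_energy \<mu> \<omega> = 1 / (\<omega> + \<mu>)"

definition energy_measure :: "real measure" where
  "energy_measure = density (restrict_space lborel {0<..}) (\<lambda>\<omega>. ennreal (sqrt \<omega>))"

text \<open>\<open>C\<^sub>c\<^sup>\<infinity>(0,\<infinity>)\<close>, its elements being extended by zero to the real line.\<close>

definition test_function :: "(real \<Rightarrow> real) \<Rightarrow> bool" where
  "test_function g \<longleftrightarrow>
     (\<forall>n x. (deriv ^^ n) g field_differentiable (at x)) \<and>
     compact (closure {x. g x \<noteq> 0}) \<and> closure {x. g x \<noteq> 0} \<subseteq> {0<..}"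

definition radial_collision_formula :: "real \<Rightarrow> (real \<Rightarrow> real) \<Rightarrow> real \<Rightarrow> real" where
  "radial_collision_formula \<mu> g \<omega> =
     (LINT (\<omega>1, \<omega>2) : {(\<omega>1, \<omega>2). 0 \<le> \<omega>1 \<and> 0 \<le> \<omega>2 \<and> \<omega> \<le> \<omega>1 + \<omega>2} | lborel.
        let \<omega>3 = \<omega>1 + \<omega>2 - \<omega>;
            \<Omega> = min (min (sqrt \<omega>) (sqrt \<omega>1)) (min (sqrt \<omega>2) (sqrt \<omega>3)) / sqrt \<omega>;
            n = n_energy \<mu>
        in \<Omega> * n \<omega>1 * n \<omega>2 * n \<omega>3 *
             (- (g \<omega> / n \<omega>) - g \<omega>3 / n \<omega>3 + g \<omega>1 / n \<omega>1 + g \<omega>2 / n \<omega>2))"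

text \<open>Test functions are dense, so the bounded extension is unique up to null sets.\<close>

definition is_radial_collision_operator ::
    "real \<Rightarrow> ((real \<Rightarrow> real) \<Rightarrow> (real \<Rightarrow> real)) \<Rightarrow> bool" where
  "is_radial_collision_operator \<mu> T \<longleftrightarrow>
     L2_bounded_operator energy_measure T \<and>
     (\<forall>g. test_function g \<longrightarrow>
        (AE \<omega> in energy_measure. T g \<omega> = radial_collision_formula \<mu> g \<omega>))"

end

theory Submission
  imports Defs
begin

text \<open>
  The momentum operator \<open>L\<close> is self-adjoint and \<open>- L\<close> has a nonnegative quadratic form, so a
  function lies in the kernel as soon as the form vanishes there (\<open>L2_kernel_if_form_zero\<close>). The
  form is the integral of a positive weight times the square of the defect
  \<open>\<Phi> k1 + \<Phi> k2 - \<Phi> k - \<Phi> k3\<close> of \<open>\<Phi> = g / n\<close>. Hence the kernel consists of those \<open>g\<close> for which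
  \<open>\<Phi>\<close> is a collisional invariant.

  A resonant quadruple is a rectangle \<open>k, k + a, k + b, k + a + b\<close> with \<open>a\<close> and \<open>b\<close> orthogonal.
  The condition on \<open>\<Phi>\<close> is invariant under translation of \<open>k\<close>, so it passes to the integrals of
  \<open>\<Phi>\<close> over translates of a fixed box. These integrals depend continuously on \<open>k\<close> and therefore
  satisfy the rectangle rule for every rectangle. A continuous solution of the rectangle rule is a
  polynomial \<open>\<alpha> + \<beta> \<bullet> k + \<gamma> |k|\<^sup>2\<close> (\<open>continuous_rectangle_rule_imp_quadratic\<close>): rectangles along
  the axes separate the variables, and rectangles at 45 degrees to them make all second differences
  constant. To return from the averages to \<open>\<Phi>\<close>, one uses that averaging over one box commutes
  with averaging over another: comparing coefficients, the polynomials belonging to different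
  boxes are the averages of a single polynomial, which then has the same integral as \<open>\<Phi>\<close> over
  every box and equals \<open>\<Phi>\<close> almost everywhere
  (\<open>AE_quadratic_if_box_mass_quadratic\<close>). If \<open>\<beta>\<close> or \<open>\<gamma>\<close> is nonzero, then the square of \<open>n\<close> times
  the polynomial is at least of order \<open>R\<^sup>-\<^sup>2\<close> on a ball of radius \<open>R / 2\<close>, whose volume is of order
  \<open>R\<^sup>3\<close>, so that only multiples of \<open>n\<close> are square integrable (\<open>L2_quadratic_imp_const\<close>).

  For the radial operator the form has to be computed from the integral formula. The measure
  \<open>min(\<surd>\<omega>, \<surd>\<omega>1, \<surd>\<omega>2, \<surd>\<omega>3) n n1 n2 n3 d\<omega> d\<omega>1 d\<omega>2\<close> is invariant under the exchanges of the four
  energies that preserve \<open>\<omega> + \<omega>3 = \<omega>1 + \<omega>2\<close>. On test functions this gives the symmetric form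
  \<open>- 1/4 \<integral> [g / n] [h / n]\<close>, where \<open>[\<phi>] = \<phi>1 + \<phi>2 - \<phi> - \<phi>3\<close> (\<open>radial_form_test\<close>). For a kernel
  element \<open>g\<close>, approximation by test functions and the lemma of Fatou yield \<open>[g / n] = 0\<close> almost
  everywhere. Fixing \<open>\<omega>1\<close> and \<open>\<omega>2\<close> and integrating over \<open>\<omega>\<close> turns this into
  \<open>\<phi> x + \<phi> y = H (x + y)\<close> with a continuous \<open>H\<close>, whose solutions are affine
  (\<open>AE_affine_if_pexider\<close>), and integrability excludes the linear term. Conversely, \<open>n\<close> pairs to
  zero with \<open>L h\<close> for every test function \<open>h\<close>; as \<open>L\<close> is symmetric on test functions, which are
  dense, \<open>L n = 0\<close> follows.
\<close>

section \<open>Continuous solutions of the rectangle rule\<close>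

lemma continuous_additive_real_imp_linear:
  fixes f :: "real \<Rightarrow> real"
  assumes add: "\<And>x y. f (x + y) = f x + f y" and cont: "continuous_on UNIV f"
  shows "f x = x * f 1"
proof -
  have f0: "f 0 = 0" using add[of 0 0] by simp
  have fm: "f (- x) = - f x" for x using add[of x "-x"] f0 by simp
  have nat: "f (real n * x) = real n * f x" for n x
    by (induction n) (simp_all add: f0 add distrib_right)
  have int: "f (of_int i * x) = of_int i * f x" for i x
    by (cases i rule: int_cases2) (simp_all add: nat fm)
  have lin: "f x = x * f 1" if "x \<in> \<rat>" for x
  proof -
    from that obtain i n where x: "x = of_int i / of_int n" "n > 0"
      by (auto elim: Rats_cases')
    have "of_int n * x = of_int i * 1" using x by simp
    then have "of_int n * f x = of_int i * f 1" using int[of n x] int[of i 1] by simp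
    moreover have "of_int n \<noteq> (0::real)" using x(2) by simp
    ultimately have "f x = of_int i * f 1 / of_int n" by (metis nonzero_mult_div_cancel_left)
    then show ?thesis unfolding x(1) by simp
  qed
  have rat: "f y - y * f 1 = 0" if "y \<in> \<rat>" for y using lin[OF that] by linarith
  have dense: "x \<in> closure \<rat>"
    unfolding closure_approachable
  proof (intro allI impI)
    fix e :: real assume "0 < e"
    then obtain q where "q \<in> \<rat>" "x < q" "q < x + e" using Rats_dense_in_real[of x "x + e"] by auto
    then show "\<exists>y\<in>\<rat>. dist y x < e" by (intro bexI[of _ q]) (auto simp: dist_real_def)
  qed
  have c: "continuous_on (closure \<rat>) (\<lambda>x. f x - x * f 1)"
    by (intro continuous_intros continuous_on_subset[OF cont] subset_UNIV)
  have "f x - x * f 1 = 0"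
    by (rule continuous_constant_on_closure[OF c rat]) (simp_all add: dense)
  then show ?thesis by simp
qed

text \<open>
  If the second difference does not depend on the base point, it is additive in each increment,
  hence bilinear. Subtracting the square with the same second difference leaves an additive
  function.
\<close>

lemma quadratic_if_second_difference_constant:
  fixes f :: "real \<Rightarrow> real"
  assumes cont: "continuous_on UNIV f"
    and diff: "\<And>x s t. f (x + s + t) - f (x + s) - f (x + t) + f x = C s t"
  shows "\<exists>\<beta> \<gamma>. (\<forall>s. f s = f 0 + \<beta> * s + \<gamma> * s\<^sup>2) \<and> (\<forall>s t. C s t = 2 * \<gamma> * s * t)"
proof -
  have C: "C s t = f (s + t) - f s - f t + f 0" for s t
    using diff[of 0 s t] by simp
  have sym: "C s t = C t s" for s t by (simp add: C add.commute)
  have add: "C (s + s') t = C s t + C s' t" for s s' t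
    using diff[of 0 s' t] diff[of s' s t] diff[of 0 "s + s'" t] by (simp add: algebra_simps)
  have cont': "continuous_on UNIV (\<lambda>s. C s t)" for t
    unfolding C by (intro continuous_intros continuous_on_compose2[OF cont]) auto
  have lin: "C s t = s * C 1 t" for s t
    using continuous_additive_real_imp_linear[of "\<lambda>s. C s t"] add cont' by blast
  have Cst: "C s t = s * t * C 1 1" for s t
    using lin[of s t] lin[of t 1] sym[of 1 t] by simp
  define \<gamma> where "\<gamma> = C 1 1 / 2"
  define g where "g = (\<lambda>s. f s - f 0 - \<gamma> * s\<^sup>2)"
  have "g (s + t) = g s + g t" for s t
    using C[of s t] Cst[of s t] by (simp add: g_def \<gamma>_def field_simps power2_eq_square)
  moreover have "continuous_on UNIV g"
    unfolding g_def by (intro continuous_intros cont)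
  ultimately have g: "g s = s * g 1" for s
    using continuous_additive_real_imp_linear[of g] by blast
  have "f s = f 0 + g 1 * s + \<gamma> * s\<^sup>2" for s
    using g[of s] by (simp add: g_def algebra_simps)
  moreover have "C s t = 2 * \<gamma> * s * t" for s t
    using Cst[of s t] by (simp add: \<gamma>_def)
  ultimately show ?thesis by blast
qed

text \<open>
  Rectangles along the axes split \<open>\<Phi>\<close> into functions \<open>f i\<close> of one coordinate each. A rectangle with
  sides along \<open>i + j\<close> and \<open>i - j\<close> relates the second difference of \<open>f i\<close> at \<open>x\<close> to that of \<open>f j\<close> at
  an independent point \<open>y\<close>. So neither depends on its base point, and the two quadratic coefficients
  coincide. In dimension one the rule says nothing, since one of two orthogonal vectors is zero.
\<close>

lemma continuous_rectangle_rule_imp_quadratic: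
  fixes \<Phi> :: "'a::euclidean_space \<Rightarrow> real"
  assumes dim: "DIM('a) \<ge> 2"
    and cont: "continuous_on UNIV \<Phi>"
    and rect: "\<And>k a b. a \<bullet> b = 0 \<Longrightarrow> \<Phi> (k + a) + \<Phi> (k + b) = \<Phi> k + \<Phi> (k + a + b)"
  shows "\<exists>\<alpha> \<beta> \<gamma>. \<forall>k. \<Phi> k = \<alpha> + \<beta> \<bullet> k + \<gamma> * (norm k)\<^sup>2"
proof -
  define f where "f = (\<lambda>i s. \<Phi> (s *\<^sub>R i) - \<Phi> 0)"
  have f0: "f i 0 = 0" for i by (simp add: f_def)
  have contf: "continuous_on UNIV (f i)" for i
    unfolding f_def
    by (intro continuous_on_diff continuous_on_const continuous_on_compose2[OF cont]
        continuous_on_scaleR continuous_on_id) simp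
  have sum_coords: "\<Phi> (\<Sum>i\<in>A. c i *\<^sub>R i) - \<Phi> 0 = (\<Sum>i\<in>A. f i (c i))"
    if "finite A" "A \<subseteq> Basis" for A c
    using that
  proof (induction A rule: finite_induct)
    case (insert j A)
    have "(\<Sum>i\<in>A. c i *\<^sub>R i) \<bullet> (c j *\<^sub>R j) = 0"
      unfolding inner_sum_left
    proof (intro sum.neutral ballI)
      fix i assume "i \<in> A"
      then have "i \<in> Basis" "j \<in> Basis" "i \<noteq> j"
        using insert.hyps(2) insert.prems by auto
      then show "c i *\<^sub>R i \<bullet> c j *\<^sub>R j = 0" by (simp add: inner_not_same_Basis)
    qed
    from rect[OF this, of 0]
    have "\<Phi> (\<Sum>i\<in>insert j A. c i *\<^sub>R i) - \<Phi> 0 = (\<Phi> (\<Sum>i\<in>A. c i *\<^sub>R i) - \<Phi> 0) + f j (c j)"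
      using insert.hyps by (simp add: f_def add.commute)
    then show ?case
      using insert.IH insert.prems insert.hyps by simp
  qed simp
  have second: "f i (x + s + t) - f i (x + s) - f i (x + t) + f i x
      = - (f j (y + s - t) - f j (y + s) - f j (y - t) + f j y)"
    if ij: "i \<in> Basis" "j \<in> Basis" "i \<noteq> j" for i j x y s t
  proof -
    have two: "\<Phi> (u *\<^sub>R i + v *\<^sub>R j) = \<Phi> 0 + f i u + f j v" for u v
    proof -
      have "(u *\<^sub>R i) \<bullet> (v *\<^sub>R j) = 0" using ij by (simp add: inner_Basis)
      from rect[OF this, of 0] show ?thesis by (simp add: f_def)
    qed
    \<comment> \<open>The sides of a rectangle at 45 degrees to the axes.\<close>
    have "(s *\<^sub>R i + s *\<^sub>R j) \<bullet> (t *\<^sub>R i + (-t) *\<^sub>R j) = 0"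
      using ij by (simp add: inner_add_left inner_add_right inner_diff_right inner_Basis)
    note rect[OF this, of "x *\<^sub>R i + y *\<^sub>R j"]
    moreover have "(x *\<^sub>R i + y *\<^sub>R j) + (s *\<^sub>R i + s *\<^sub>R j) = (x + s) *\<^sub>R i + (y + s) *\<^sub>R j"
      by (simp add: scaleR_add_left)
    moreover have "(x *\<^sub>R i + y *\<^sub>R j) + (t *\<^sub>R i + (-t) *\<^sub>R j) = (x + t) *\<^sub>R i + (y - t) *\<^sub>R j"
      by (simp add: scaleR_add_left scaleR_diff_left)
    moreover have "(x *\<^sub>R i + y *\<^sub>R j) + (s *\<^sub>R i + s *\<^sub>R j) + (t *\<^sub>R i + (-t) *\<^sub>R j)
        = (x + s + t) *\<^sub>R i + (y + s - t) *\<^sub>R j"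
      by (simp add: scaleR_add_left scaleR_diff_left)
    ultimately have "\<Phi> ((x + s) *\<^sub>R i + (y + s) *\<^sub>R j) + \<Phi> ((x + t) *\<^sub>R i + (y - t) *\<^sub>R j)
        = \<Phi> (x *\<^sub>R i + y *\<^sub>R j) + \<Phi> ((x + s + t) *\<^sub>R i + (y + s - t) *\<^sub>R j)"
      by (simp only:)
    then show ?thesis unfolding two by linarith
  qed
  have quad: "\<exists>\<beta> \<gamma>. (\<forall>s. f i s = \<beta> * s + \<gamma> * s\<^sup>2) \<and>
      (\<forall>j\<in>Basis - {i}. \<forall>s t. f j (s - t) - f j s - f j (- t) = - (2 * \<gamma> * s * t))"
    if i: "i \<in> Basis" for i
  proof -
    have "\<not> Basis \<subseteq> {i}" using dim card_mono[of "{i}" Basis] by auto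
    then obtain j where j: "j \<in> Basis" "j \<noteq> i" by blast
    define C where "C = (\<lambda>s t. f i (s + t) - f i s - f i t)"
    have diff: "f i (x + s + t) - f i (x + s) - f i (x + t) + f i x = C s t" for x s t
      using second[OF i j(1), of x s t 0] second[OF i j(1), of 0 s t 0] j(2)
      by (simp add: C_def f0)
    have "\<exists>\<beta> \<gamma>. (\<forall>s. f i s = f i 0 + \<beta> * s + \<gamma> * s\<^sup>2) \<and> (\<forall>s t. C s t = 2 * \<gamma> * s * t)"
      by (rule quadratic_if_second_difference_constant) (rule contf, rule diff)
    then obtain \<beta> \<gamma> where q: "\<forall>s. f i s = \<beta> * s + \<gamma> * s\<^sup>2"
        "\<forall>s t. f i (s + t) - f i s - f i t = 2 * \<gamma> * s * t"
      unfolding C_def f0 add_0_left by (elim exE conjE)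
    have "f j (s - t) - f j s - f j (- t) = - (2 * \<gamma> * s * t)"
      if "j \<in> Basis - {i}" for j s t
    proof -
      have "j \<in> Basis" "i \<noteq> j" using that by auto
      from second[OF i this, of 0 s t 0] show ?thesis
        using q(2)[rule_format, of s t] f0[of i] f0[of j] by simp
    qed
    with q(1) show ?thesis by blast
  qed
  then have "\<forall>i\<in>Basis. \<exists>\<beta> \<gamma>. (\<forall>s. f i s = \<beta> * s + \<gamma> * s\<^sup>2) \<and>
      (\<forall>j\<in>Basis - {i}. \<forall>s t. f j (s - t) - f j s - f j (- t) = - (2 * \<gamma> * s * t))"
    by (rule ballI)
  then obtain \<beta> \<gamma> where q:
    "\<forall>i\<in>Basis. (\<forall>s. f i s = \<beta> i * s + \<gamma> i * s\<^sup>2) \<and>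
      (\<forall>j\<in>Basis - {i}. \<forall>s t. f j (s - t) - f j s - f j (- t) = - (2 * \<gamma> i * s * t))"
    unfolding bchoice_iff by (elim exE)
  have q1: "f i s = \<beta> i * s + \<gamma> i * s\<^sup>2" if "i \<in> Basis" for i s
    using bspec[OF q that] by blast
  have q2: "f j (s - t) - f j s - f j (- t) = - (2 * \<gamma> i * s * t)"
    if "i \<in> Basis" "j \<in> Basis - {i}" for i j s t
    using bspec[OF q that(1)] that(2) by blast
  have \<gamma>_eq: "\<gamma> i = \<gamma> j" if "i \<in> Basis" "j \<in> Basis" for i j
  proof (cases "i = j")
    case False
    with that have "f j (1 - 1) - f j 1 - f j (- 1) = - (2 * \<gamma> i * 1 * 1)"
      by (intro q2) auto
    with that show ?thesis by (simp add: q1)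
  qed simp
  obtain e :: 'a where e: "e \<in> Basis" using nonempty_Basis by blast
  have "\<Phi> k = \<Phi> 0 + (\<Sum>i\<in>Basis. \<beta> i *\<^sub>R i) \<bullet> k + \<gamma> e * (norm k)\<^sup>2" for k
  proof -
    have "\<Phi> k - \<Phi> 0 = (\<Sum>i\<in>Basis. f i (k \<bullet> i))"
      using sum_coords[of Basis "\<lambda>i. k \<bullet> i"] by (simp add: euclidean_representation)
    also have "\<dots> = (\<Sum>i\<in>Basis. \<beta> i * (k \<bullet> i) + \<gamma> e * (k \<bullet> i)\<^sup>2)"
      by (intro sum.cong refl) (simp add: q1 \<gamma>_eq[OF _ e])
    also have "\<dots> = (\<Sum>i\<in>Basis. \<beta> i * (i \<bullet> k)) + \<gamma> e * (\<Sum>i\<in>Basis. (k \<bullet> i) * (k \<bullet> i))"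
      by (simp add: sum.distrib sum_distrib_left power2_eq_square inner_commute)
    also have "\<dots> = (\<Sum>i\<in>Basis. \<beta> i *\<^sub>R i) \<bullet> k + \<gamma> e * (k \<bullet> k)"
      by (simp only: euclidean_inner[symmetric] inner_sum_left inner_scaleR_left)
    finally show ?thesis by (simp add: power2_norm_eq_inner)
  qed
  then show ?thesis by blast
qed

section \<open>Averages over boxes\<close>

lemma AE_lborel_continuous_imp_all:
  fixes G :: "'a::euclidean_space \<Rightarrow> real"
  assumes S: "open S" and cont: "continuous_on S G" and ae: "AE x in lborel. x \<in> S \<longrightarrow> G x = 0"
    and x: "x \<in> S"
  shows "G x = 0"
proof (rule ccontr)
  assume nz: "G x \<noteq> 0"
  let ?U = "S \<inter> G -` (- {0})"
  have U: "open ?U"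
    using continuous_openin_preimage_gen[OF cont, of "- {0}"] S
    by (simp add: openin_open_eq open_Compl)
  have "AE x in lborel. x \<notin> ?U" using ae by eventually_elim auto
  then have "?U \<in> null_sets lborel"
    using U by (subst (asm) AE_iff_null_sets[symmetric]) auto
  then have "negligible ?U"
    by (simp add: negligible_iff_null_sets null_sets_completionI)
  moreover have "?U \<noteq> {}" using nz x by auto
  ultimately show False using open_not_negligible[OF U] by blast
qed

text \<open>
  The positive and the negative part of \<open>f\<close> are densities of measures that agree on boxes. Boxes are
  stable under intersection and generate the Borel sets, so the measures, and hence the densities,
  agree.
\<close>

lemma lborel_eq_if_box_integrals_zero:
  fixes f :: "'a::euclidean_space \<Rightarrow> real"
  assumes f[measurable]: "f \<in> borel_measurable borel"
    and int: "\<And>a b. set_integrable lborel (box a b) f"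
    and zero: "\<And>a b. (LINT x:box a b|lborel. f x) = 0"
  shows "AE x in lborel. f x = 0"
proof -
  define M where "M = density lborel (\<lambda>x. ennreal (f x))"
  define N where "N = density lborel (\<lambda>x. ennreal (- f x))"
  have box: "emeasure M (box a b) = emeasure N (box a b)" "emeasure M (box a b) \<noteq> \<infinity>" for a b
  proof -
    let ?g = "\<lambda>x. indicator (box a b) x * f x"
    have g: "integrable lborel ?g" "integral\<^sup>L lborel ?g = 0"
      using int[of a b] zero[of a b] by (simp_all add: set_integrable_def set_lebesgue_integral_def)
    have M: "emeasure M (box a b) = (\<integral>\<^sup>+ x. ennreal (?g x) \<partial>lborel)"
      by (auto simp: M_def emeasure_density intro!: nn_integral_cong split: split_indicator)
    have N: "emeasure N (box a b) = (\<integral>\<^sup>+ x. ennreal (- ?g x) \<partial>lborel)"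
      by (auto simp: N_def emeasure_density intro!: nn_integral_cong split: split_indicator)
    have fin: "(\<integral>\<^sup>+ x. ennreal (?g x) \<partial>lborel) < \<infinity>" "(\<integral>\<^sup>+ x. ennreal (- ?g x) \<partial>lborel) < \<infinity>"
      using g(1) unfolding real_integrable_def by (auto simp: less_top)
    have "enn2real (\<integral>\<^sup>+ x. ennreal (?g x) \<partial>lborel) = enn2real (\<integral>\<^sup>+ x. ennreal (- ?g x) \<partial>lborel)"
      using g(2) real_lebesgue_integral_def[OF g(1)] by simp
    then have "(\<integral>\<^sup>+ x. ennreal (?g x) \<partial>lborel) = (\<integral>\<^sup>+ x. ennreal (- ?g x) \<partial>lborel)"
      using fin by (metis ennreal_enn2real infinity_ennreal_def)
    with M N fin show "emeasure M (box a b) = emeasure N (box a b)" "emeasure M (box a b) \<noteq> \<infinity>"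
      by auto
  qed
  have "M = N"
  proof (rule measure_eqI_generator_eq)
    let ?E = "range (\<lambda>(a, b). box a b::'a set)"
    show "Int_stable ?E"
      by (auto simp: Int_stable_def box_Int_box)
    show "?E \<subseteq> Pow UNIV" "sets M = sigma_sets UNIV ?E" "sets N = sigma_sets UNIV ?E"
      by (simp_all add: M_def N_def borel_eq_box)
    let ?A = "\<lambda>n::nat. box (- (real n *\<^sub>R One)) (real n *\<^sub>R One) :: 'a set"
    show "range ?A \<subseteq> ?E" by auto
    show "(\<Union>i. ?A i) = UNIV" by (rule UN_box_eq_UNIV)
    show "emeasure M (?A i) \<noteq> \<infinity>" for i by (rule box)
    show "emeasure M X = emeasure N X" if "X \<in> ?E" for X using that box(1) by auto
  qed
  then have "AE x in lborel. ennreal (f x) = ennreal (- f x)"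
    unfolding M_def N_def by (intro sigma_finite_measure.density_unique[OF lborel.sigma_finite_measure_axioms]) auto
  then show ?thesis
    by eventually_elim (metis ennreal_eq_0_iff ennreal_neg linorder_linear neg_0_le_iff_le
        neg_le_0_iff_le order_antisym)
qed

lemma lborel_integral_translate:
  fixes g :: "'a::euclidean_space \<Rightarrow> real"
  assumes [measurable]: "g \<in> borel_measurable borel"
  shows "(LINT u|lborel. g (c + u)) = (LINT u|lborel. g u)"
proof -
  have "(LINT u|lborel. g u) = (LINT u|distr lborel borel ((+) c). g u)"
    by (simp add: lborel_distr_plus)
  also have "\<dots> = (LINT u|lborel. g (c + u))"
    by (subst integral_distr) auto
  finally show ?thesis ..
qed

lemma lborel_integrable_translate:
  fixes g :: "'a::euclidean_space \<Rightarrow> real"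
  assumes [measurable]: "g \<in> borel_measurable borel"
  shows "integrable lborel (\<lambda>u. g (c + u)) \<longleftrightarrow> integrable lborel g"
proof -
  have "integrable (distr lborel borel ((+) c)) g \<longleftrightarrow> integrable lborel (\<lambda>u. g (c + u))"
    by (subst integrable_distr_eq) auto
  then show ?thesis by (simp add: lborel_distr_plus)
qed

lemma lborel_integral_reflect:
  fixes g :: "'a::euclidean_space \<Rightarrow> real"
  assumes [measurable]: "g \<in> borel_measurable borel"
  shows "(LINT u|lborel. g (- u)) = (LINT u|lborel. g u)"
proof -
  have "lborel = distr lborel borel (uminus :: 'a \<Rightarrow> 'a)"
    using lborel_affine[of "-1" "0::'a"] by (simp add: density_1)
  then have "(LINT u|lborel. g u) = (LINT u|distr lborel borel uminus. g u)"
    by simp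
  also have "\<dots> = (LINT u|lborel. g (- u))"
    by (subst integral_distr) auto
  finally show ?thesis ..
qed

text \<open>
  The convolution of \<open>f\<close> with the indicator of a box centred at the origin, in other words the
  average of \<open>f\<close> over the box around \<open>k\<close> times the volume of the box.
\<close>

definition box_mass :: "'a::euclidean_space \<Rightarrow> ('a \<Rightarrow> real) \<Rightarrow> 'a \<Rightarrow> real" where
  "box_mass l f k = (LINT u|lborel. indicator (box (- l) l) u * f (k + u))"

definition locally_integrable :: "('a::euclidean_space \<Rightarrow> real) \<Rightarrow> bool" where
  "locally_integrable f \<longleftrightarrow> f \<in> borel_measurable borel \<and> (\<forall>a b. set_integrable lborel (box a b) f)"

lemma locally_integrableD:
  assumes "locally_integrable f"
  shows "f \<in> borel_measurable borel" "set_integrable lborel (box a b) f"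
  using assms by (auto simp: locally_integrable_def)

lemma box_mass_shift:
  assumes [measurable]: "f \<in> borel_measurable borel"
  shows "box_mass l f k = (LINT u|lborel. indicator (box (k - l) (k + l)) u * f u)"
proof -
  have "(\<lambda>u. indicator (box (- l) l) u * f (k + u))
      = (\<lambda>u. indicator (box (k - l) (k + l)) (k + u) * f (k + u))"
    by (auto simp: fun_eq_iff indicator_def mem_box inner_diff_left inner_add_left)
  then show ?thesis
    unfolding box_mass_def
    by (simp only: lborel_integral_translate[of "\<lambda>v. indicator (box (k - l) (k + l)) v * f v"] assms
        borel_measurable_times borel_measurable_indicator borel_open open_box)
qed

lemma integrable_box_mass:
  assumes f: "locally_integrable f"
  shows "integrable lborel (\<lambda>u. indicator (box (- l) l) u * f (k + u))"
proof -
  note [measurable] = locally_integrableD(1)[OF f]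
  have "(\<lambda>u. indicator (box (- l) l) u * f (k + u))
      = (\<lambda>u. indicator (box (k - l) (k + l)) (k + u) * f (k + u))"
    by (auto simp: fun_eq_iff indicator_def mem_box inner_diff_left inner_add_left)
  then show ?thesis
    using locally_integrableD(2)[OF f, of "k - l" "k + l"]
      lborel_integrable_translate[of "\<lambda>v. indicator (box (k - l) (k + l)) v * f v" k]
    by (simp add: set_integrable_def)
qed

text \<open>
  As the centre converges, the indicators of the boxes converge off the boundary of the limiting
  box, which is a null set, and all these boxes lie in one large box.
\<close>

lemma continuous_box_mass:
  assumes f: "locally_integrable f"
  shows "continuous_on UNIV (box_mass l f)"
proof -
  note [measurable] = locally_integrableD(1)[OF f]
  have "(box_mass l f \<circ> s) \<longlonglongrightarrow> box_mass l f k" if s: "s \<longlonglongrightarrow> k" for s k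
  proof -
    obtain B where B: "\<And>n. norm (s n) \<le> B"
      using convergent_imp_Bseq[OF convergentI[OF s]] by (auto simp: Bseq_def)
    obtain a where a: "cball (0::'a) (B + norm l * DIM('a)) \<subseteq> box (- a) a"
      using bounded_subset_box_symmetric[OF bounded_cball] by blast
    have sub: "box (s n - l) (s n + l) \<subseteq> box (- a) a" for n
    proof
      fix u assume u: "u \<in> box (s n - l) (s n + l)"
      have "norm (u - s n) \<le> (\<Sum>i\<in>Basis. \<bar>(u - s n) \<bullet> i\<bar>)" by (rule norm_le_l1)
      also have "\<dots> \<le> (\<Sum>i\<in>(Basis :: 'a set). norm l)"
      proof (rule sum_mono)
        fix i :: 'a assume i: "i \<in> Basis"
        with u have "s n \<bullet> i - l \<bullet> i < u \<bullet> i" "u \<bullet> i < s n \<bullet> i + l \<bullet> i"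
          by (auto simp: mem_box inner_diff_left inner_add_left)
        moreover have "\<bar>l \<bullet> i\<bar> \<le> norm l" using Basis_le_norm[OF i] .
        ultimately show "\<bar>(u - s n) \<bullet> i\<bar> \<le> norm l" by (simp add: inner_diff_left)
      qed
      finally have "norm (u - s n) \<le> norm l * DIM('a)" by (simp add: mult.commute)
      then have "norm u \<le> B + norm l * DIM('a)"
        using B[of n] norm_triangle_sub[of u "s n"] by linarith
      then show "u \<in> box (- a) a" using a by auto
    qed
    have front: "AE u in lborel. u \<notin> cbox (k - l) (k + l) - box (k - l) (k + l)"
    proof (rule AE_not_in)
      show "cbox (k - l) (k + l) - box (k - l) (k + l) \<in> null_sets lborel"
        using negligible_frontier_interval[of "k - l" "k + l"]
        by (simp add: negligible_iff_null_sets null_sets_completion_iff)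
    qed
    have "(\<lambda>n. LINT u|lborel. indicator (box (s n - l) (s n + l)) u * f u)
        \<longlonglongrightarrow> (LINT u|lborel. indicator (box (k - l) (k + l)) u * f u)"
    proof (rule integral_dominated_convergence)
      show "integrable lborel (\<lambda>u. indicator (box (- a) a) u * \<bar>f u\<bar>)"
        using integrable_abs[OF locally_integrableD(2)[OF f, of "- a" a, unfolded set_integrable_def]]
        by (simp add: abs_mult)
      show "AE u in lborel. norm (indicator (box (s n - l) (s n + l)) u * f u)
          \<le> indicator (box (- a) a) u * \<bar>f u\<bar>" for n
        using sub[of n] by (intro AE_I2) (auto simp: indicator_def)
      show "AE u in lborel. (\<lambda>n. indicator (box (s n - l) (s n + l)) u * f u)
          \<longlonglongrightarrow> indicator (box (k - l) (k + l)) u * f u"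
        using front
      proof eventually_elim
        case (elim u)
        have "\<forall>\<^sub>F n in sequentially. (indicator (box (s n - l) (s n + l)) u :: real)
            = indicator (box (k - l) (k + l)) u"
        proof (cases "u \<in> box (k - l) (k + l)")
          case True
          then have "k \<in> box (u - l) (u + l)"
            by (auto simp: mem_box inner_diff_left inner_add_left algebra_simps)
          from topological_tendstoD[OF s open_box this] show ?thesis
            by eventually_elim
               (use True in \<open>auto simp: indicator_def mem_box inner_diff_left inner_add_left algebra_simps\<close>)
        next
          case False
          with elim have "u \<notin> cbox (k - l) (k + l)" by blast
          then have "k \<in> - cbox (u - l) (u + l)"
            by (auto simp: mem_box inner_diff_left inner_add_left algebra_simps)
          from topological_tendstoD[OF s open_Compl[OF closed_cbox] this] show ?thesis
          proof eventually_elim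
            case (elim n)
            then have "u \<notin> cbox (s n - l) (s n + l)"
              by (auto simp: mem_box inner_diff_left inner_add_left algebra_simps)
            then have "u \<notin> box (s n - l) (s n + l)" using box_subset_cbox by blast
            with False show ?case by simp
          qed
        qed
        then show ?case
          by (intro tendsto_eventually) (auto elim: eventually_mono)
      qed
    qed measurable
    then show ?thesis by (simp add: box_mass_shift o_def)
  qed
  then show ?thesis
    by (simp add: continuous_on_sequentially continuous_within_sequentially)
qed


lemma continuous_imp_locally_integrable:
  fixes f :: "'a::euclidean_space \<Rightarrow> real"
  assumes cont: "continuous_on UNIV f"
  shows "locally_integrable f"
  unfolding locally_integrable_def
proof (intro conjI allI)
  show "f \<in> borel_measurable borel" using cont by (rule borel_measurable_continuous_onI)
  fix a b
  have "set_integrable lborel (cbox a b) f"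
    unfolding set_integrable_def
    by (rule borel_integrable_compact) (auto intro: continuous_on_subset[OF cont])
  then show "set_integrable lborel (box a b) f"
    by (rule set_integrable_subset) (auto intro: box_subset_cbox[THEN subsetD])
qed

lemma locally_integrable_diff:
  assumes "locally_integrable f" "locally_integrable g"
  shows "locally_integrable (\<lambda>x. f x - g x)"
  using assms unfolding locally_integrable_def by (auto intro: set_integral_diff)

lemma locally_integrable_abs:
  assumes "locally_integrable f"
  shows "locally_integrable (\<lambda>x. \<bar>f x\<bar>)"
  using assms unfolding locally_integrable_def by (auto intro: set_integrable_abs)

lemma box_mass_commute:
  assumes f: "locally_integrable f"
  shows "box_mass l (box_mass m f) k = box_mass m (box_mass l f) k"
proof -
  note [measurable] = locally_integrableD(1)[OF f]
  let ?F = "\<lambda>u v. indicator (box (- l) l) u * (indicator (box (- m) m) v * f (k + u + v)) :: real"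
  have int: "integrable (lborel \<Otimes>\<^sub>M lborel) (case_prod ?F)"
  proof (rule lborel_pair.Fubini_integrable)
    show "case_prod ?F \<in> borel_measurable (lborel \<Otimes>\<^sub>M lborel)" by measurable
    have "(\<lambda>u. LINT v|lborel. norm (case (u, v) of (u, v) \<Rightarrow> ?F u v))
        = (\<lambda>u. indicator (box (- l) l) u * box_mass m (\<lambda>x. \<bar>f x\<bar>) (k + u))"
      by (simp add: box_mass_def abs_mult)
    then show "integrable lborel (\<lambda>u. LINT v|lborel. norm (case (u, v) of (u, v) \<Rightarrow> ?F u v))"
      using integrable_box_mass[OF continuous_imp_locally_integrable[OF continuous_box_mass[OF
            locally_integrable_abs[OF f]]]] by simp
    show "AE u in lborel. integrable lborel (\<lambda>v. case (u, v) of (u, v) \<Rightarrow> ?F u v)"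
      using integrable_box_mass[OF f, of m] by (intro AE_I2) simp
  qed
  have "box_mass l (box_mass m f) k = (LINT u|lborel. LINT v|lborel. ?F u v)"
    by (simp add: box_mass_def)
  also have "\<dots> = (LINT v|lborel. LINT u|lborel. ?F u v)"
    using lborel_pair.Fubini_integral[OF int] by simp
  also have "\<dots> = (LINT v|lborel. LINT u|lborel.
      indicator (box (- m) m) v * (indicator (box (- l) l) u * f (k + v + u)))"
    by (simp add: ac_simps)
  also have "\<dots> = box_mass m (box_mass l f) k"
    by (simp add: box_mass_def)
  finally show ?thesis .
qed

text \<open>
  Over a symmetric box the linear part in \<open>u\<close> of the polynomial at \<open>k + u\<close> integrates to zero, and
  \<open>c\<close> is the second moment of the box.
\<close>

lemma box_mass_quadratic:
  fixes m :: "'a::euclidean_space"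
  shows "\<exists>c. \<forall>\<alpha> \<beta> \<gamma> k. box_mass m (\<lambda>k. \<alpha> + \<beta> \<bullet> k + \<gamma> * (norm k)\<^sup>2) k
    = measure lborel (box (- m) m) * (\<alpha> + \<beta> \<bullet> k + \<gamma> * (norm k)\<^sup>2) + \<gamma> * c"
proof (intro exI allI)
  let ?I = "indicator (box (- m) m) :: 'a \<Rightarrow> real"
  fix \<alpha> \<gamma> :: real and \<beta> k :: 'a
  define P where "P = \<alpha> + \<beta> \<bullet> k + \<gamma> * (norm k)\<^sup>2"
  \<comment> \<open>The gradient at \<open>k\<close>, which is the coefficient of
    \<open>u\<close> in the expansion around \<open>k\<close>.\<close>
  define w where "w = \<beta> + (2 * \<gamma>) *\<^sub>R k"
  have int: "integrable lborel (\<lambda>u. ?I u * f u)" if "continuous_on UNIV f" for f :: "'a \<Rightarrow> real"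
    using integrable_box_mass[OF continuous_imp_locally_integrable[OF that], of m 0] by simp
  have i1: "integrable lborel ?I" using int[of "\<lambda>_. 1"] by simp
  have i2: "integrable lborel (\<lambda>u. ?I u * (norm u)\<^sup>2)"
    by (intro int continuous_intros)
  have i3: "integrable lborel (\<lambda>u. ?I u * (w \<bullet> u))"
    by (intro int continuous_intros)
  have "- u \<in> box (- m) m \<longleftrightarrow> u \<in> box (- m) m" for u
    unfolding mem_box by (intro ball_cong refl) auto
  then have "(\<lambda>u. ?I (- u)) = ?I"
    by (auto simp: fun_eq_iff indicator_def)
  then have "(LINT u|lborel. ?I u * (w \<bullet> u)) = - (LINT u|lborel. ?I u * (w \<bullet> u))"
    using lborel_integral_reflect[of "\<lambda>u. ?I u * (w \<bullet> u)"] by (simp add: fun_eq_iff)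
  then have z: "(LINT u|lborel. ?I u * (w \<bullet> u)) = 0" by simp
  have "?I u * (\<alpha> + \<beta> \<bullet> (k + u) + \<gamma> * (norm (k + u))\<^sup>2)
      = P * ?I u + (\<gamma> * (?I u * (norm u)\<^sup>2) + ?I u * (w \<bullet> u))" for u
    by (simp add: P_def w_def power2_norm_eq_inner inner_add_left inner_add_right inner_commute
        algebra_simps)
  then show "box_mass m (\<lambda>k. \<alpha> + \<beta> \<bullet> k + \<gamma> * (norm k)\<^sup>2) k
      = measure lborel (box (- m) m) * (\<alpha> + \<beta> \<bullet> k + \<gamma> * (norm k)\<^sup>2)
        + \<gamma> * (LINT u|lborel. ?I u * (norm u)\<^sup>2)"
    using i1 i2 i3 z unfolding box_mass_def P_def[symmetric] by simp
qed

lemma quadratic_eq_imp_coeffs_eq: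
  fixes \<beta> \<beta>' :: "'a::euclidean_space"
  assumes eq: "\<And>k. \<alpha> + \<beta> \<bullet> k + \<gamma> * (norm k)\<^sup>2 = \<alpha>' + \<beta>' \<bullet> k + \<gamma>' * (norm k)\<^sup>2"
  shows "\<alpha> = \<alpha>'" "\<beta> = \<beta>'" "\<gamma> = \<gamma>'"
proof -
  show a: "\<alpha> = \<alpha>'" using eq[of 0] by simp
  have "\<beta> \<bullet> k = \<beta>' \<bullet> k" for k
    using eq[of k] eq[of "- k"] by simp
  then show b: "\<beta> = \<beta>'" by (metis vector_eq_rdot)
  obtain e :: 'a where "e \<in> Basis" using nonempty_Basis by blast
  then show "\<gamma> = \<gamma>'" using eq[of e] a b by simp
qed

text \<open>
  Let \<open>P l\<close> be the polynomial that gives the mass of \<open>f\<close> on the boxes of shape \<open>l\<close>. Taking the mass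
  of \<open>P l\<close> on boxes of shape \<open>m\<close> is the same as taking that of \<open>P m\<close> on boxes of shape \<open>l\<close>, because
  both are iterated masses of \<open>f\<close>. The coefficients of this identity for one fixed \<open>m\<close> show that
  every \<open>P l\<close> is the mass of the same polynomial.
\<close>

lemma AE_quadratic_if_box_mass_quadratic:
  fixes f :: "'a::euclidean_space \<Rightarrow> real"
  assumes f: "locally_integrable f"
    and quad: "\<And>l. (\<And>i. i \<in> Basis \<Longrightarrow> 0 < l \<bullet> i) \<Longrightarrow>
      \<exists>\<alpha> \<beta> \<gamma>. \<forall>k. box_mass l f k = \<alpha> + \<beta> \<bullet> k + \<gamma> * (norm k)\<^sup>2"
  shows "\<exists>\<alpha> \<beta> \<gamma>. AE k in lborel. f k = \<alpha> + \<beta> \<bullet> k + \<gamma> * (norm k)\<^sup>2"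
proof -
  note [measurable] = locally_integrableD(1)[OF f]
  define V where "V = (\<lambda>m::'a. measure lborel (box (- m) m))"
  have "\<forall>m. \<exists>c. \<forall>\<alpha> \<beta> \<gamma> k. box_mass m (\<lambda>k. \<alpha> + \<beta> \<bullet> k + \<gamma> * (norm k)\<^sup>2) k
      = V m * (\<alpha> + \<beta> \<bullet> k + \<gamma> * (norm k)\<^sup>2) + \<gamma> * c"
    unfolding V_def using box_mass_quadratic by blast
  then obtain s where s: "\<And>m \<alpha> \<beta> \<gamma> k. box_mass m (\<lambda>k. \<alpha> + \<beta> \<bullet> k + \<gamma> * (norm k)\<^sup>2) k
      = V m * (\<alpha> + \<beta> \<bullet> k + \<gamma> * (norm k)\<^sup>2) + \<gamma> * s m"
    unfolding choice_iff by blast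
  have e: "0 < One \<bullet> i" if "i \<in> Basis" for i :: 'a using that by simp
  obtain \<alpha>e \<beta>e \<gamma>e where Pe: "\<And>k. box_mass One f k = \<alpha>e + \<beta>e \<bullet> k + \<gamma>e * (norm k)\<^sup>2"
    using quad[of One, OF e] by blast
  have Ve: "V One > 0" unfolding V_def by (subst measure_lborel_box) (auto intro!: prod_pos simp: inner_diff_left inner_add_left)
  \<comment> \<open>The polynomial whose masses on boxes of shape One are those of
    \<open>f\<close>.\<close>
  define \<gamma> where "\<gamma> = \<gamma>e / V One"
  define \<beta> where "\<beta> = (1 / V One) *\<^sub>R \<beta>e"
  define \<alpha> where "\<alpha> = (\<alpha>e - \<gamma> * s One) / V One"
  define P where "P = (\<lambda>k. \<alpha> + \<beta> \<bullet> k + \<gamma> * (norm k)\<^sup>2)"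
  have P: "locally_integrable P"
    unfolding P_def by (intro continuous_imp_locally_integrable continuous_intros)
  note [measurable] = locally_integrableD(1)[OF P]
  have mass_eq: "box_mass l f k = box_mass l P k"
    if l: "\<And>i. i \<in> Basis \<Longrightarrow> 0 < l \<bullet> i" for l k
  proof -
    obtain \<alpha>l \<beta>l \<gamma>l where Pl: "\<And>k. box_mass l f k = \<alpha>l + \<beta>l \<bullet> k + \<gamma>l * (norm k)\<^sup>2"
      using quad[of l, OF l] by blast
    have comm: "V One * (\<alpha>l + \<beta>l \<bullet> k + \<gamma>l * (norm k)\<^sup>2) + \<gamma>l * s One
        = V l * (\<alpha>e + \<beta>e \<bullet> k + \<gamma>e * (norm k)\<^sup>2) + \<gamma>e * s l" for k
    proof -
      have "box_mass One (box_mass l f) k = box_mass l (box_mass One f) k"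
        by (rule box_mass_commute[OF f])
      moreover have "box_mass l f = (\<lambda>k. \<alpha>l + \<beta>l \<bullet> k + \<gamma>l * (norm k)\<^sup>2)"
        "box_mass One f = (\<lambda>k. \<alpha>e + \<beta>e \<bullet> k + \<gamma>e * (norm k)\<^sup>2)"
        using Pl Pe by auto
      ultimately show ?thesis by (simp only: s)
    qed
    have comm': "(V One * \<alpha>l + \<gamma>l * s One) + (V One *\<^sub>R \<beta>l) \<bullet> k + (V One * \<gamma>l) * (norm k)\<^sup>2
        = (V l * \<alpha>e + \<gamma>e * s l) + (V l *\<^sub>R \<beta>e) \<bullet> k + (V l * \<gamma>e) * (norm k)\<^sup>2" for k
      using comm[of k] by (simp add: algebra_simps)
    note co = quadratic_eq_imp_coeffs_eq[OF comm']
    have g: "\<gamma>l = V l * \<gamma>" using co(3) Ve by (simp add: \<gamma>_def field_simps)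
    have b: "\<beta>l = V l *\<^sub>R \<beta>"
    proof -
      have "\<beta>l = (1 / V One) *\<^sub>R (V One *\<^sub>R \<beta>l)" using Ve by simp
      then show ?thesis by (simp add: co(2) \<beta>_def)
    qed
    have ge: "\<gamma>e = V One * \<gamma>" using Ve by (simp add: \<gamma>_def)
    have a: "\<alpha>l = V l * \<alpha> + \<gamma> * s l"
    proof -
      have "V One * \<alpha>l = V l * (\<alpha>e - \<gamma> * s One) + V One * (\<gamma> * s l)"
        using co(1) unfolding g ge by (simp add: algebra_simps)
      also have "\<alpha>e - \<gamma> * s One = V One * \<alpha>" using Ve by (simp add: \<alpha>_def)
      finally have "V One * \<alpha>l = V One * (V l * \<alpha> + \<gamma> * s l)" by (simp add: algebra_simps)
      then show ?thesis using Ve by simp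
    qed
    show ?thesis
      unfolding Pl P_def s a b g by (simp add: algebra_simps)
  qed
  have "AE k in lborel. f k - P k = 0"
  proof (rule lborel_eq_if_box_integrals_zero)
    show "(\<lambda>k. f k - P k) \<in> borel_measurable borel" by measurable
    show "set_integrable lborel (box a b) (\<lambda>k. f k - P k)" for a b
      using locally_integrable_diff[OF f P] by (auto simp: locally_integrable_def)
    show "(LINT k:box a b|lborel. f k - P k) = 0" for a b
    proof (cases "box a b = {}")
      case False
      let ?l = "(1/2) *\<^sub>R (b - a)" and ?k = "(1/2) *\<^sub>R (a + b)"
      have l: "0 < ?l \<bullet> i" if "i \<in> Basis" for i
        using False that by (auto simp: box_ne_empty inner_diff_left)
      have "?k - ?l = a" "?k + ?l = b"
        by (simp_all add: algebra_simps flip: scaleR_add_left)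
      with mass_eq[OF l, of ?k] have "(LINT u:box a b|lborel. f u) = (LINT u:box a b|lborel. P u)"
        by (simp add: box_mass_shift set_lebesgue_integral_def)
      then show ?thesis
        using locally_integrableD(2)[OF f] locally_integrableD(2)[OF P] by (simp add: set_integral_diff)
    qed (simp add: set_lebesgue_integral_def)
  qed
  then show ?thesis unfolding P_def by (intro exI) (auto elim: eventually_mono)
qed

section \<open>Collisional invariants\<close>

text \<open>
  The projection and the slab from which the area measure on the plane orthogonal to \<open>a\<close> is built.
\<close>

definition perp_proj :: "R3 \<Rightarrow> R3 \<Rightarrow> R3" where
  "perp_proj a x = x - (x \<bullet> sgn a) *\<^sub>R sgn a"

definition unit_slab :: "R3 \<Rightarrow> R3 set" where
  "unit_slab a = {x. 0 \<le> x \<bullet> sgn a \<and> x \<bullet> sgn a \<le> 1}"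

lemma borel_measurable_sgn_R3 [measurable]: "(sgn :: R3 \<Rightarrow> R3) \<in> borel_measurable borel"
  unfolding sgn_div_norm[abs_def] by measurable

lemma borel_measurable_perp_proj [measurable]: "perp_proj a \<in> borel_measurable borel"
  unfolding perp_proj_def[abs_def] by measurable

lemma sets_unit_slab [measurable]: "unit_slab a \<in> sets borel"
  unfolding unit_slab_def by measurable

lemma perp_proj_orthogonal: "a \<bullet> perp_proj a x = 0"
proof (cases "a = 0")
  case False
  have "a = norm a *\<^sub>R sgn a" by (simp add: sgn_div_norm False)
  moreover have "sgn a \<bullet> sgn a = 1" using False by (simp add: norm_sgn flip: power2_norm_eq_inner)
  then have "sgn a \<bullet> perp_proj a x = 0" by (simp add: perp_proj_def inner_diff_right inner_commute)
  ultimately show ?thesis by (metis inner_scaleR_left mult_zero_right)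
qed simp

lemma nn_integral_perp_area:
  assumes [measurable]: "f \<in> borel_measurable borel"
  shows "(\<integral>\<^sup>+ b. f b \<partial>perp_area a)
    = (\<integral>\<^sup>+ x. indicator (unit_slab a) x * f (perp_proj a x) \<partial>lborel)"
proof -
  have "(\<integral>\<^sup>+ b. f b \<partial>perp_area a)
      = (\<integral>\<^sup>+ x. f (perp_proj a x) \<partial>restrict_space lborel (unit_slab a))"
    unfolding perp_area_def perp_proj_def unit_slab_def
    by (subst nn_integral_distr) (auto intro!: measurable_restrict_space1)
  also have "\<dots> = (\<integral>\<^sup>+ x. f (perp_proj a x) * indicator (unit_slab a) x \<partial>lborel)"
    by (subst nn_integral_restrict_space) auto
  finally show ?thesis by (simp add: mult.commute)
qed

text \<open>
  Null sets of the resonant measure are described with \<open>k\<close> as the innermost variable. For a fixed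
  rectangle shape a condition on almost every \<open>k\<close> can then be translated and integrated.
\<close>

lemma AE_resonant_measure_iff:
  assumes A[measurable]: "A \<in> sets borel"
  shows "(AE z in resonant_measure. z \<in> A) \<longleftrightarrow>
    (AE y in lborel. snd y \<in> unit_slab (fst y) \<longrightarrow>
      (AE k in lborel. (k, k + fst y, k + perp_proj (fst y) (snd y),
        k + fst y + perp_proj (fst y) (snd y)) \<in> A))"
    (is "_ \<longleftrightarrow> (AE y in lborel. ?S y \<longrightarrow> (AE k in lborel. ?q k y \<in> A))")
proof -
  let ?B = "- A"
  have B[measurable]: "?B \<in> sets borel" using A by auto
  define q where "q = (\<lambda>(k, y). ?q k y)"
  define S where "S = {y. ?S y}"
  define H where "H = (\<lambda>k y. ennreal (1 / (2 * norm (fst y))) * (indicator S y * indicator ?B (q (k, y))) :: ennreal)"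
  have q: "q \<in> lborel \<Otimes>\<^sub>M lborel \<rightarrow>\<^sub>M borel"
    unfolding q_def perp_proj_def by (simp add: borel_prod[symmetric] split_beta' lborel_prod[symmetric])
  have S[measurable]: "S \<in> sets borel"
  proof -
    have "{y \<in> space (borel \<Otimes>\<^sub>M borel). 0 \<le> snd y \<bullet> sgn (fst y) \<and> snd y \<bullet> sgn (fst y :: R3) \<le> 1}
        \<in> sets (borel \<Otimes>\<^sub>M borel)"
      by measurable
    then show ?thesis unfolding S_def unit_slab_def borel_prod by simp
  qed
  have ind_q[measurable]: "(\<lambda>z. indicator ?B (q z) :: ennreal) \<in> borel_measurable (lborel \<Otimes>\<^sub>M lborel)"
    by (rule measurable_compose[OF q borel_measurable_indicator[OF B]])
  have [measurable]: "(\<lambda>y. norm (fst y)) \<in> borel_measurable (borel :: (R3 \<times> R3) measure)"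
    by (intro borel_measurable_continuous_onI continuous_intros)
  have H: "case_prod H \<in> borel_measurable (lborel \<Otimes>\<^sub>M lborel)"
    unfolding H_def by measurable
  have "(AE z in resonant_measure. z \<in> A) \<longleftrightarrow> emeasure resonant_measure ?B = 0"
  proof (rule AE_iff_measurable)
    show "?B \<in> sets resonant_measure" by simp
    show "{x \<in> space resonant_measure. \<not> x \<in> A} = ?B"
      using sets_eq_imp_space_eq[OF sets_resonant_measure] by (simp only: space_borel) blast
  qed
  moreover have "emeasure resonant_measure ?B = resonant_integral ?B"
    by (rule emeasure_resonant_measure) simp
  moreover have "resonant_integral ?B = (\<integral>\<^sup>+ k. (\<integral>\<^sup>+ y. H k y \<partial>lborel) \<partial>lborel)"
    unfolding resonant_integral_def
  proof (rule nn_integral_cong)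
    fix k :: R3
    have Hk: "H k \<in> borel_measurable (lborel \<Otimes>\<^sub>M lborel)"
      using measurable_compose[OF measurable_Pair1' H, of k] unfolding lborel_prod by simp
    have "(\<integral>\<^sup>+ y. H k y \<partial>lborel) = (\<integral>\<^sup>+ a. \<integral>\<^sup>+ x. H k (a, x) \<partial>lborel \<partial>lborel)"
      using lborel.nn_integral_fst[OF Hk] unfolding lborel_prod by (rule sym)
    also have "\<dots> = (\<integral>\<^sup>+ a. ennreal (1 / (2 * norm a)) *
        (\<integral>\<^sup>+ b. indicator ?B (k, k + a, k + b, k + a + b) \<partial>perp_area a) \<partial>lborel)"
    proof (rule nn_integral_cong)
      fix a :: R3
      let ?f = "\<lambda>b. indicator ?B (k, k + a, k + b, k + a + b) :: ennreal"
      have f: "?f \<in> borel_measurable borel"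
        by (rule measurable_compose[where N = borel]) (auto simp: borel_prod[symmetric])
      have m: "(\<lambda>x. indicator (unit_slab a) x * ?f (perp_proj a x)) \<in> borel_measurable lborel"
        by (rule borel_measurable_times_ennreal) (simp, rule measurable_compose[OF _ f], simp)
      have "H k (a, x) = ennreal (1 / (2 * norm a)) * (indicator (unit_slab a) x * ?f (perp_proj a x))" for x
        by (simp add: H_def S_def q_def indicator_def)
      then show "(\<integral>\<^sup>+ x. H k (a, x) \<partial>lborel) = ennreal (1 / (2 * norm a)) * (\<integral>\<^sup>+ b. ?f b \<partial>perp_area a)"
        by (simp only: nn_integral_cmult[OF m] nn_integral_perp_area[OF f])
    qed
    finally show "(\<integral>\<^sup>+ a. ennreal (1 / (2 * norm a)) *
        (\<integral>\<^sup>+ b. indicator ?B (k, k + a, k + b, k + a + b) \<partial>perp_area a) \<partial>lborel)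
        = (\<integral>\<^sup>+ y. H k y \<partial>lborel)" by (rule sym)
  qed
  moreover have "\<dots> = (\<integral>\<^sup>+ y. (\<integral>\<^sup>+ k. H k y \<partial>lborel) \<partial>lborel)"
    by (rule lborel_pair.Fubini'[symmetric, OF H])
  moreover have "(\<integral>\<^sup>+ y. (\<integral>\<^sup>+ k. H k y \<partial>lborel) \<partial>lborel) = 0
      \<longleftrightarrow> (AE y in lborel. (\<integral>\<^sup>+ k. H k y \<partial>lborel) = 0)"
  proof (rule nn_integral_0_iff_AE)
    have "(\<lambda>(y, k). H k y) \<in> borel_measurable (lborel \<Otimes>\<^sub>M lborel)"
      using measurable_pair_swap[OF H] by (simp add: split_beta')
    then show "(\<lambda>y. \<integral>\<^sup>+ k. H k y \<partial>lborel) \<in> borel_measurable lborel"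
      by (rule lborel.borel_measurable_nn_integral)
  qed
  moreover have "\<dots> \<longleftrightarrow> (AE y in lborel. ?S y \<longrightarrow> (AE k in lborel. ?q k y \<in> A))"
  proof -
    \<comment> \<open>The weight \<open>1 / (2 |a|)\<close> takes the value \<open>1 / 0 =
      0\<close> at \<open>a = 0\<close> and is positive elsewhere.\<close>
    have "AE y in lborel \<Otimes>\<^sub>M lborel. fst y \<noteq> (0::R3)"
    proof (rule lborel_pair.AE_pair_measure)
      show "{x \<in> space (lborel \<Otimes>\<^sub>M lborel). fst x \<noteq> (0::R3)} \<in> sets (lborel \<Otimes>\<^sub>M lborel)"
        by measurable
      show "AE a in lborel. AE x in lborel. fst (a, x) \<noteq> (0::R3)"
        using AE_lborel_singleton[of "0::R3"] by eventually_elim simp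
    qed
    then have ne: "AE y in lborel. fst (y :: R3 \<times> R3) \<noteq> 0"
      unfolding lborel_prod .
    have eq: "(\<integral>\<^sup>+ k. H k y \<partial>lborel) = 0 \<longleftrightarrow> (?S y \<longrightarrow> (AE k in lborel. ?q k y \<in> A))"
      if "fst y \<noteq> 0" for y
    proof -
      have "(\<lambda>k. H k y) \<in> borel_measurable lborel"
        using measurable_compose[OF measurable_Pair2' H, of y] by simp
      then have "(\<integral>\<^sup>+ k. H k y \<partial>lborel) = 0 \<longleftrightarrow> (AE k in lborel. H k y = 0)"
        by (rule nn_integral_0_iff_AE)
      also have "\<dots> \<longleftrightarrow> (AE k in lborel. ?S y \<longrightarrow> ?q k y \<in> A)"
        using that by (simp add: H_def S_def q_def indicator_def)
      also have "\<dots> \<longleftrightarrow> (?S y \<longrightarrow> (AE k in lborel. ?q k y \<in> A))"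
        by (cases "?S y") simp_all
      finally show ?thesis .
    qed
    show ?thesis
    proof
      assume "AE y in lborel. (\<integral>\<^sup>+ k. H k y \<partial>lborel) = 0"
      with ne show "AE y in lborel. ?S y \<longrightarrow> (AE k in lborel. ?q k y \<in> A)"
        by eventually_elim (use eq in blast)
    next
      assume "AE y in lborel. ?S y \<longrightarrow> (AE k in lborel. ?q k y \<in> A)"
      with ne show "AE y in lborel. (\<integral>\<^sup>+ k. H k y \<partial>lborel) = 0"
        by eventually_elim (use eq in blast)
    qed
  qed
  ultimately show ?thesis by (simp only:)
qed

lemma AE_lborel_translate:
  fixes c :: "'a::euclidean_space"
  assumes "AE x in lborel. P x"
  shows "AE x in lborel. P (x + c)"
proof -
  have "AE x in distr lborel borel ((+) c). P x"
    unfolding lborel_distr_plus by (rule assms)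
  from AE_distrD[OF _ this] show ?thesis by (simp add: add.commute)
qed

lemma invariant_set_borel:
  fixes \<Phi> :: "R3 \<Rightarrow> real"
  assumes [measurable]: "\<Phi> \<in> borel_measurable borel"
  shows "{(k, k1, k2, k3). \<Phi> k1 + \<Phi> k2 = \<Phi> k + \<Phi> k3} \<in> sets borel"
proof -
  have m: "(\<lambda>z. \<Phi> (f z)) \<in> borel_measurable borel" if "continuous_on UNIV f" for f :: "R3 \<times> R3 \<times> R3 \<times> R3 \<Rightarrow> R3"
    using borel_measurable_continuous_onI[OF that] assms by (rule measurable_compose)
  have "{z \<in> space borel. \<Phi> (fst (snd z)) + \<Phi> (fst (snd (snd z))) = \<Phi> (fst z) + \<Phi> (snd (snd (snd z)))}
      \<in> sets borel"
    by (intro borel_measurable_eq borel_measurable_add m continuous_intros)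
  then show ?thesis by (simp add: split_beta')
qed

lemma collisional_invariant_iff:
  assumes [measurable]: "\<Phi> \<in> borel_measurable borel"
  shows "collisional_invariant \<Phi> \<longleftrightarrow>
    (AE y in lborel. snd y \<in> unit_slab (fst y) \<longrightarrow>
      (AE k in lborel. \<Phi> (k + fst y) + \<Phi> (k + perp_proj (fst y) (snd y))
        = \<Phi> k + \<Phi> (k + fst y + perp_proj (fst y) (snd y))))"
  using AE_resonant_measure_iff[OF invariant_set_borel[OF assms]]
  unfolding collisional_invariant_def by (simp add: split_beta')

lemma rectangle_rule_quadratic:
  fixes \<beta> a b :: "'a::real_inner" and \<alpha> \<gamma> :: real
  assumes "a \<bullet> b = 0"
  defines "P \<equiv> \<lambda>k. \<alpha> + \<beta> \<bullet> k + \<gamma> * (norm k)\<^sup>2"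
  shows "P (k + a) + P (k + b) = P k + P (k + a + b)"
  using assms(1) unfolding P_def power2_norm_eq_inner
  by (simp add: inner_add_left inner_add_right inner_commute algebra_simps)

text \<open>
  The rectangle rule holds exactly for the polynomial. The exceptional null set is met only for
  almost no \<open>k\<close> by any of the four corners, since each corner is a translate of \<open>k\<close>.
\<close>

lemma collisional_invariant_if_AE_quadratic:
  assumes \<Phi>: "\<Phi> \<in> borel_measurable borel"
    and ae: "AE k in lborel. \<Phi> k = \<alpha> + \<beta> \<bullet> k + \<gamma> * (norm k)\<^sup>2"
  shows "collisional_invariant \<Phi>"
  unfolding collisional_invariant_iff[OF \<Phi>]
proof (rule AE_I2, rule impI)
  fix y :: "R3 \<times> R3"
  let ?b = "perp_proj (fst y) (snd y)"
  show "AE k in lborel. \<Phi> (k + fst y) + \<Phi> (k + ?b) = \<Phi> k + \<Phi> (k + fst y + ?b)"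
    using ae AE_lborel_translate[OF ae, of "fst y"] AE_lborel_translate[OF ae, of ?b]
      AE_lborel_translate[OF ae, of "fst y + ?b"]
  proof eventually_elim
    case (elim k)
    with rectangle_rule_quadratic[OF perp_proj_orthogonal, of \<alpha> \<beta> k "fst y" \<gamma> "snd y"]
    show ?case by (simp add: add.assoc)
  qed
qed

text \<open>
  The masses of \<open>\<Phi>\<close> on boxes of a fixed shape satisfy the rectangle rule for almost every rectangle
  shape and every \<open>k\<close>. They are continuous, so the rule extends to all rectangles.
\<close>

lemma AE_quadratic_if_collisional_invariant:
  assumes \<Phi>: "locally_integrable \<Phi>" and inv: "collisional_invariant \<Phi>"
  shows "\<exists>\<alpha> \<beta> \<gamma>. AE k in lborel. \<Phi> k = \<alpha> + \<beta> \<bullet> k + \<gamma> * (norm k)\<^sup>2"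
proof (rule AE_quadratic_if_box_mass_quadratic[OF \<Phi>])
  note [measurable] = locally_integrableD(1)[OF \<Phi>]
  fix l :: R3
  define F where "F = box_mass l \<Phi>"
  have contF: "continuous_on UNIV F" unfolding F_def by (rule continuous_box_mass[OF \<Phi>])
  have avg: "F (k + a) + F (k + b) = F k + F (k + a + b)"
    if ae: "AE k in lborel. \<Phi> (k + a) + \<Phi> (k + b) = \<Phi> k + \<Phi> (k + a + b)" for a b k
  proof -
    let ?I = "\<lambda>c u. indicator (box (- l) l) u * \<Phi> (c + u)"
    note int = integrable_box_mass[OF \<Phi>, of l]
    have "(LINT u|lborel. ?I (k + a) u + ?I (k + b) u) = (LINT u|lborel. ?I k u + ?I (k + a + b) u)"
    proof (rule integral_cong_AE)
      show "AE u in lborel. ?I (k + a) u + ?I (k + b) u = ?I k u + ?I (k + a + b) u"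
        using AE_lborel_translate[OF ae, of k]
      proof eventually_elim
        case (elim u)
        then have "\<Phi> (k + a + u) + \<Phi> (k + b + u) = \<Phi> (k + u) + \<Phi> (k + a + b + u)"
          by (simp add: ac_simps)
        then show ?case by (simp flip: distrib_left)
      qed
    qed measurable
    then show ?thesis by (simp add: F_def box_mass_def int)
  qed
  let ?b = "\<lambda>y. perp_proj (fst y) (snd y)"
  have ae: "AE y in lborel. snd y \<in> unit_slab (fst y) \<longrightarrow>
      F (k + fst y) + F (k + ?b y) - F k - F (k + fst y + ?b y) = 0" for k
    using inv[unfolded collisional_invariant_iff[OF locally_integrableD(1)[OF \<Phi>]]]
  proof eventually_elim
    case (elim y)
    then show ?case using avg[of "fst y" "?b y" k] by auto
  qed
  \<comment> \<open>On this open set \<open>(a, x)\<close> satisfies the slab condition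
    strictly. Every orthogonal pair with \<open>a \<noteq> 0\<close> is reached from it, at
    \<open>x = b + sgn a / 2\<close>.\<close>
  define S :: "(R3 \<times> R3) set" where
    "S = {y. fst y \<noteq> 0} \<inter> {y. 0 < snd y \<bullet> fst y} \<inter> {y. snd y \<bullet> fst y < norm (fst y)}"
  have openS: "open S"
    unfolding S_def by (intro open_Int open_Collect_neq open_Collect_less continuous_intros)
  have slab: "snd y \<in> unit_slab (fst y)" if "y \<in> S" for y
    using that by (auto simp: S_def unit_slab_def sgn_div_norm field_simps)
  have rect: "F (k + a) + F (k + b) = F k + F (k + a + b)" if ab: "a \<bullet> b = 0" for k a b
  proof (cases "a = 0")
    case False
    let ?y = "(a, b + (1/2) *\<^sub>R sgn a)"
    have sa: "a \<bullet> sgn a = norm a" "sgn a \<bullet> sgn a = 1" "b \<bullet> sgn a = 0"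
      using ab False by (simp_all add: sgn_div_norm inner_commute power2_norm_eq_inner[symmetric] power2_eq_square)
    have y: "?y \<in> S" using False sa ab
      by (simp add: S_def inner_add_left inner_add_right inner_commute)
    have b: "?b ?y = b" using sa by (simp add: perp_proj_def inner_add_left)
    let ?G = "\<lambda>y. F (k + fst y) + F (k + ?b y) - F k - F (k + fst y + ?b y)"
    have cb: "continuous_on S ?b"
      unfolding perp_proj_def sgn_div_norm by (intro continuous_intros) (auto simp: S_def)
    have "?G ?y = 0"
    proof (rule AE_lborel_continuous_imp_all[where G = ?G and x = ?y, OF openS _ _ y])
      show "continuous_on S ?G"
        by (intro continuous_intros continuous_on_compose2[OF contF] cb) auto
      show "AE y in lborel. y \<in> S \<longrightarrow> ?G y = 0"
        using ae[of k] by eventually_elim (use slab in blast)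
    qed
    then show ?thesis unfolding b by simp
  qed simp
  have "\<exists>\<alpha> \<beta> \<gamma>. \<forall>k. F k = \<alpha> + \<beta> \<bullet> k + \<gamma> * (norm k)\<^sup>2"
    by (rule continuous_rectangle_rule_imp_quadratic[OF _ contF rect]) simp
  then show "\<exists>\<alpha> \<beta> \<gamma>. \<forall>k. box_mass l \<Phi> k = \<alpha> + \<beta> \<bullet> k + \<gamma> * (norm k)\<^sup>2"
    unfolding F_def .
qed

section \<open>Operators on square-integrable functions\<close>

lemma L2_measurable: "f \<in> L2 M \<Longrightarrow> f \<in> borel_measurable M"
  and L2_integrable_square: "f \<in> L2 M \<Longrightarrow> integrable M (\<lambda>x. (f x)\<^sup>2)"
  by (auto simp: L2_def)

lemma L2_dominated:
  assumes f: "f \<in> L2 M" and g: "g \<in> borel_measurable M" and le: "AE x in M. \<bar>g x\<bar> \<le> \<bar>f x\<bar>"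
  shows "g \<in> L2 M"
  unfolding L2_def
proof (intro CollectI conjI g)
  show "integrable M (\<lambda>x. (g x)\<^sup>2)"
  proof (rule Bochner_Integration.integrable_bound[OF L2_integrable_square[OF f]])
    show "(\<lambda>x. (g x)\<^sup>2) \<in> borel_measurable M" using g by measurable
    show "AE x in M. norm ((g x)\<^sup>2) \<le> norm ((f x)\<^sup>2)"
      using le by eventually_elim (simp add: abs_le_square_iff)
  qed
qed

lemma L2_mult_integrable:
  assumes f: "f \<in> L2 M" and g: "g \<in> L2 M"
  shows "integrable M (\<lambda>x. f x * g x)"
proof (rule Bochner_Integration.integrable_bound)
  note [measurable] = L2_measurable[OF f] L2_measurable[OF g]
  show "integrable M (\<lambda>x. (f x)\<^sup>2 + (g x)\<^sup>2)"
    using f g by (intro Bochner_Integration.integrable_add L2_integrable_square)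
  show "(\<lambda>x. f x * g x) \<in> borel_measurable M" by measurable
  show "AE x in M. norm (f x * g x) \<le> norm ((f x)\<^sup>2 + (g x)\<^sup>2)"
  proof (rule AE_I2)
    fix x
    have "2 * (\<bar>f x\<bar> * \<bar>g x\<bar>) \<le> (f x)\<^sup>2 + (g x)\<^sup>2"
      using sum_squares_bound[of "\<bar>f x\<bar>" "\<bar>g x\<bar>"] by simp
    moreover have "0 \<le> \<bar>f x\<bar> * \<bar>g x\<bar>" by simp
    ultimately have "\<bar>f x\<bar> * \<bar>g x\<bar> \<le> (f x)\<^sup>2 + (g x)\<^sup>2" by linarith
    then show "norm (f x * g x) \<le> norm ((f x)\<^sup>2 + (g x)\<^sup>2)"
      by (simp add: abs_mult)
  qed
qed

lemma L2_add:
  assumes f: "f \<in> L2 M" and g: "g \<in> L2 M"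
  shows "(\<lambda>x. f x + g x) \<in> L2 M"
proof -
  have "(\<lambda>x. (f x + g x)\<^sup>2) = (\<lambda>x. (f x)\<^sup>2 + (g x)\<^sup>2 + 2 * (f x * g x))"
    by (simp add: power2_sum mult.assoc)
  moreover have "integrable M \<dots>"
    using f g by (intro Bochner_Integration.integrable_add integrable_mult_right L2_integrable_square L2_mult_integrable)
  ultimately show ?thesis
    using L2_measurable[OF f] L2_measurable[OF g] by (simp add: L2_def)
qed

lemma L2_cmult:
  assumes f: "f \<in> L2 M"
  shows "(\<lambda>x. c * f x) \<in> L2 M"
  using L2_measurable[OF f] L2_integrable_square[OF f] by (simp add: L2_def power_mult_distrib)

lemma L2_diff:
  assumes f: "f \<in> L2 M" and g: "g \<in> L2 M"
  shows "(\<lambda>x. f x - g x) \<in> L2 M"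
  using L2_add[OF f L2_cmult[OF g, of "-1"]] by simp

lemma L2_AE_cong:
  assumes f: "f \<in> L2 M" and g: "g \<in> borel_measurable M" and eq: "AE x in M. f x = g x"
  shows "g \<in> L2 M"
  using f g by (rule L2_dominated) (use eq in eventually_elim, simp)

lemma L2_inner_add_left:
  "f \<in> L2 M \<Longrightarrow> g \<in> L2 M \<Longrightarrow> h \<in> L2 M \<Longrightarrow>
    L2_inner M (\<lambda>x. f x + g x) h = L2_inner M f h + L2_inner M g h"
  by (simp add: L2_inner_def distrib_right L2_mult_integrable)

lemma L2_inner_cmult_left:
  "L2_inner M (\<lambda>x. c * f x) h = c * L2_inner M f h"
  by (simp add: L2_inner_def mult.assoc)

lemma L2_inner_commute: "L2_inner M f g = L2_inner M g f"
  by (simp add: L2_inner_def mult.commute)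

lemma L2_inner_diff_left:
  "f \<in> L2 M \<Longrightarrow> g \<in> L2 M \<Longrightarrow> h \<in> L2 M \<Longrightarrow>
    L2_inner M (\<lambda>x. f x - g x) h = L2_inner M f h - L2_inner M g h"
  by (simp add: L2_inner_def left_diff_distrib L2_mult_integrable)

lemma L2_inner_AE_cong:
  assumes "f \<in> L2 M" "f' \<in> L2 M" "h \<in> L2 M" "AE x in M. f x = f' x"
  shows "L2_inner M f h = L2_inner M f' h"
  unfolding L2_inner_def
proof (rule integral_cong_AE)
  show "AE x in M. f x * h x = f' x * h x" using assms(4) by eventually_elim simp
qed (intro borel_measurable_times L2_measurable assms)+

lemma L2_inner_nonneg: "0 \<le> L2_inner M f f"
  unfolding L2_inner_def by (rule integral_nonneg_AE) (simp add: AE_I2)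

lemma L2_inner_self_eq_0:
  assumes f: "f \<in> L2 M" and z: "L2_inner M f f = 0"
  shows "AE x in M. f x = 0"
proof -
  have "AE x in M. (f x)\<^sup>2 = 0"
    using z L2_integrable_square[OF f]
    by (subst integral_nonneg_eq_0_iff_AE[symmetric]) (simp_all add: L2_inner_def power2_eq_square)
  then show ?thesis by eventually_elim simp
qed

lemma L2_norm_nonneg: "0 \<le> L2_norm M f"
  by (simp add: L2_norm_def L2_inner_nonneg)

lemma L2_norm_square: "(L2_norm M f)\<^sup>2 = L2_inner M f f"
  by (simp add: L2_norm_def L2_inner_nonneg)

text \<open>
  The form is evaluated at \<open>c f - b g\<close> with \<open>b\<close> the inner product of \<open>f\<close> and \<open>g\<close> and \<open>c\<close> that of
  \<open>g\<close> with itself. Up to the factor \<open>c\<close> this is the component of \<open>f\<close> orthogonal to \<open>g\<close>.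
\<close>

lemma L2_Cauchy_Schwarz:
  assumes f: "f \<in> L2 M" and g: "g \<in> L2 M"
  shows "\<bar>L2_inner M f g\<bar> \<le> L2_norm M f * L2_norm M g"
proof -
  let ?a = "L2_inner M f f" and ?b = "L2_inner M f g" and ?c = "L2_inner M g g"
  have quad: "0 \<le> s\<^sup>2 * ?a - 2 * s * t * ?b + t\<^sup>2 * ?c" for s t
  proof -
    let ?h = "\<lambda>x. s * f x - t * g x"
    have "0 \<le> L2_inner M ?h ?h" by (rule L2_inner_nonneg)
    also have "L2_inner M ?h ?h = s * L2_inner M f ?h - t * L2_inner M g ?h"
      using f g by (simp add: L2_inner_diff_left L2_inner_cmult_left L2_cmult L2_diff)
    also have "L2_inner M f ?h = s * ?a - t * ?b"
      using f g by (subst L2_inner_commute)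
        (simp add: L2_inner_diff_left L2_inner_cmult_left L2_cmult L2_inner_commute[of M g f])
    also have "L2_inner M g ?h = s * ?b - t * ?c"
      using f g by (subst L2_inner_commute)
        (simp add: L2_inner_diff_left L2_inner_cmult_left L2_cmult)
    finally show ?thesis by (simp add: power2_eq_square algebra_simps)
  qed
  have "?b\<^sup>2 \<le> ?a * ?c"
  proof (cases "?c = 0")
    case True
    then have "AE x in M. g x = 0" by (rule L2_inner_self_eq_0[OF g])
    then have "AE x in M. f x * g x = 0" by eventually_elim simp
    then have "?b = 0" unfolding L2_inner_def by (rule integral_eq_zero_AE)
    with True show ?thesis by simp
  next
    case False
    then have "?c > 0" using L2_inner_nonneg[of M g] by simp
    have "0 \<le> ?c\<^sup>2 * ?a - 2 * ?c * ?b * ?b + ?b\<^sup>2 * ?c" by (rule quad)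
    also have "\<dots> = ?c * (?a * ?c - ?b\<^sup>2)" by (simp add: power2_eq_square algebra_simps)
    finally show ?thesis using \<open>?c > 0\<close> by (simp add: zero_le_mult_iff)
  qed
  then have "?b\<^sup>2 \<le> (L2_norm M f * L2_norm M g)\<^sup>2"
    by (simp add: power_mult_distrib L2_norm_square)
  then show ?thesis
    by (simp add: abs_le_square_iff[symmetric] L2_norm_nonneg)
qed

lemma L2_bounded_operatorD:
  assumes "L2_bounded_operator M T"
  shows "f \<in> L2 M \<Longrightarrow> T f \<in> L2 M"
    and "f \<in> L2 M \<Longrightarrow> g \<in> L2 M \<Longrightarrow> AE x in M. T (\<lambda>y. f y + g y) x = T f x + T g x"
    and "f \<in> L2 M \<Longrightarrow> AE x in M. T (\<lambda>y. c * f y) x = c * T f x"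
    and "\<exists>C. \<forall>f\<in>L2 M. L2_norm M (T f) \<le> C * L2_norm M f"
  using assms unfolding L2_bounded_operator_def by blast+

lemma L2_operator_diff:
  assumes T: "L2_bounded_operator M T" and f: "f \<in> L2 M" and g: "g \<in> L2 M"
  shows "AE x in M. T (\<lambda>y. f y - g y) x = T f x - T g x"
  using L2_bounded_operatorD(2)[OF T f L2_cmult[OF g, of "-1"]]
    L2_bounded_operatorD(3)[OF T g, of "-1"]
  by eventually_elim simp

text \<open>
  Operators act on functions, not on classes. Boundedness forces the image of a null function to be
  null.
\<close>

lemma L2_operator_AE_cong:
  assumes T: "L2_bounded_operator M T" and f: "f \<in> L2 M" and g: "g \<in> L2 M"
    and eq: "AE x in M. f x = g x"
  shows "AE x in M. T f x = T g x"
proof -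
  let ?d = "\<lambda>x. f x - g x"
  have d: "?d \<in> L2 M" by (rule L2_diff[OF f g])
  have "L2_inner M ?d ?d = 0"
    unfolding L2_inner_def
    by (rule integral_eq_zero_AE) (use eq in eventually_elim, simp)
  then have n0: "L2_norm M ?d = 0" by (simp add: L2_norm_def)
  obtain C where "\<forall>f\<in>L2 M. L2_norm M (T f) \<le> C * L2_norm M f"
    using L2_bounded_operatorD(4)[OF T] by blast
  with d n0 have "L2_norm M (T ?d) \<le> 0" by force
  then have "L2_inner M (T ?d) (T ?d) = 0"
    using L2_norm_nonneg[of M "T ?d"] L2_norm_square[of M "T ?d"] by simp
  then have "AE x in M. T ?d x = 0"
    by (rule L2_inner_self_eq_0[OF L2_bounded_operatorD(1)[OF T d]])
  with L2_operator_diff[OF T f g] show ?thesis by eventually_elim simp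
qed

text \<open>
  A maximum of the form is attained at \<open>g\<close>, so its first variation in the direction \<open>T g\<close>, which
  is twice the square norm of \<open>T g\<close>, vanishes.
\<close>

lemma L2_kernel_if_form_zero:
  assumes T: "L2_bounded_operator M T" and sa: "L2_self_adjoint M T"
    and neg: "\<And>f. f \<in> L2 M \<Longrightarrow> L2_inner M (T f) f \<le> 0"
    and g: "g \<in> L2 M" and z: "L2_inner M (T g) g = 0"
  shows "AE x in M. T g x = 0"
proof -
  let ?h = "T g"
  note TL = L2_bounded_operatorD(1)[OF T]
  have h: "?h \<in> L2 M" using TL[OF g] .
  let ?c = "L2_inner M (T ?h) ?h" and ?n = "L2_inner M ?h ?h"
  have ineq: "2 * t * ?n + t\<^sup>2 * ?c \<le> 0" for t
  proof -
    let ?u = "\<lambda>x. g x + t * ?h x"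
    have th: "(\<lambda>x. t * ?h x) \<in> L2 M" by (rule L2_cmult[OF h])
    have u: "?u \<in> L2 M" by (rule L2_add[OF g th])
    have "AE x in M. T ?u x = T g x + t * T ?h x"
      using L2_bounded_operatorD(2)[OF T g th] L2_bounded_operatorD(3)[OF T h, of t]
      by eventually_elim simp
    then have "L2_inner M (T ?u) ?u = L2_inner M (\<lambda>x. T g x + t * T ?h x) ?u"
      by (intro L2_inner_AE_cong TL u L2_add L2_cmult g h)
    also have "\<dots> = L2_inner M ?h ?u + t * L2_inner M (T ?h) ?u"
      by (simp add: L2_inner_add_left L2_inner_cmult_left L2_cmult TL u g h)
    also have "L2_inner M ?h ?u = t * ?n"
      using z by (subst L2_inner_commute)
        (simp add: L2_inner_add_left L2_inner_cmult_left L2_cmult g h L2_inner_commute[of M g])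
    also have "L2_inner M (T ?h) ?u = ?n + t * ?c"
    proof -
      have "L2_inner M (T ?h) g = ?n"
        using sa g h unfolding L2_self_adjoint_def by blast
      then show ?thesis
        by (subst L2_inner_commute)
          (simp add: L2_inner_add_left L2_inner_cmult_left L2_cmult TL g h L2_inner_commute[of M g]
            L2_inner_commute[of M ?h "T ?h"])
    qed
    finally have "L2_inner M (T ?u) ?u = 2 * t * ?n + t\<^sup>2 * ?c"
      by (simp add: power2_eq_square algebra_simps)
    with neg[OF u] show ?thesis by simp
  qed
  have "?n \<le> 0"
  proof (rule ccontr)
    assume "\<not> ?n \<le> 0"
    then have n: "?n > 0" by simp
    \<comment> \<open>A step so small that the linear term dominates the quadratic one.\<close>
    define t where "t = ?n / (1 + \<bar>?c\<bar>)"
    have t: "t > 0" using n by (simp add: t_def)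
    have "t * \<bar>?c\<bar> \<le> t * (1 + \<bar>?c\<bar>)" using t by simp
    also have "\<dots> = ?n" by (simp add: t_def)
    finally have "t * \<bar>?c\<bar> \<le> ?n" .
    moreover have "- (t * \<bar>?c\<bar>) \<le> t * ?c"
      using mult_left_mono[of "- \<bar>?c\<bar>" ?c t] t by simp
    ultimately have "0 < t * (2 * ?n + t * ?c)"
      using t n by (intro mult_pos_pos) linarith+
    with ineq[of t] show False by (simp add: power2_eq_square algebra_simps)
  qed
  then have "?n = 0" using L2_inner_nonneg[of M ?h] by simp
  then show ?thesis by (rule L2_inner_self_eq_0[OF h])
qed

section \<open>The equilibrium density and the kernel in momentum space\<close>

lemma n_tilde_pos: "\<mu> > 0 \<Longrightarrow> n_tilde \<mu> k > 0"
  unfolding n_tilde_def by (intro divide_pos_pos add_nonneg_pos) auto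

lemma borel_measurable_n_tilde [measurable]: "n_tilde \<mu> \<in> borel_measurable borel"
  unfolding n_tilde_def[abs_def] by measurable

lemma emeasure_ball_R3_le:
  fixes r :: real
  assumes "0 \<le> r"
  shows "emeasure lborel (ball (0::R3) r) \<le> ennreal ((2 * r) ^ 3)"
proof -
  have "ball (0::R3) r \<subseteq> cbox (- (r *\<^sub>R One)) (r *\<^sub>R One)"
  proof
    fix x :: R3 assume "x \<in> ball 0 r"
    then have "\<bar>x \<bullet> i\<bar> \<le> r" if "i \<in> Basis" for i
      using Basis_le_norm[OF that, of x] by simp
    then show "x \<in> cbox (- (r *\<^sub>R One)) (r *\<^sub>R One)"
      by (auto simp: mem_box abs_le_iff minus_le_iff)
  qed
  then have "emeasure lborel (ball (0::R3) r) \<le> emeasure lborel (cbox (- (r *\<^sub>R One)) (r *\<^sub>R One) :: R3 set)"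
    by (intro emeasure_mono) auto
  also have "\<dots> = ennreal (\<Prod>i\<in>(Basis :: R3 set). 2 * r)"
  proof -
    have "(r *\<^sub>R One - - (r *\<^sub>R One)) \<bullet> i = 2 * r" if "i \<in> Basis" for i :: R3
      using that by (simp only: inner_diff_left inner_minus_left inner_scaleR_left) simp
    then have "(\<Prod>i\<in>(Basis :: R3 set). (r *\<^sub>R One - - (r *\<^sub>R One)) \<bullet> i) = (\<Prod>i\<in>(Basis :: R3 set). 2 * r)"
      by (intro prod.cong) auto
    then show ?thesis
      using assms by (subst emeasure_lborel_cbox) auto
  qed
  also have "\<dots> = ennreal ((2 * r) ^ 3)" by simp
  finally show ?thesis .
qed

text \<open>
  On the shell between the radii \<open>2\<^sup>j\<close> and \<open>2\<^sup>j\<^sup>+\<^sup>1\<close> the square is at most \<open>16\<^sup>-\<^sup>j\<close>, while the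
  volume is at most \<open>64 \<cdot> 8\<^sup>j\<close>. The products form a geometric series.
\<close>

lemma n_tilde_L2:
  assumes \<mu>: "\<mu> > 0"
  shows "n_tilde \<mu> \<in> L2 lborel"
  unfolding L2_def
proof (intro CollectI conjI)
  let ?f = "\<lambda>k::R3. ennreal ((n_tilde \<mu> k)\<^sup>2)"
  let ?s = "\<lambda>(j::nat) k::R3. ennreal ((1/16) ^ j) * indicator (ball 0 (2 ^ (j + 1))) k"
  have le: "?f k \<le> ennreal (1 / \<mu>\<^sup>2) * indicator (ball 0 1) k + (\<Sum>j. ?s j k)" for k
  proof (cases "norm k < 1")
    case True
    have "n_tilde \<mu> k \<le> 1 / \<mu>"
      unfolding n_tilde_def using \<mu> by (intro divide_left_mono mult_pos_pos add_nonneg_pos) auto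
    then have "(n_tilde \<mu> k)\<^sup>2 \<le> (1 / \<mu>)\<^sup>2"
      using n_tilde_pos[OF \<mu>, of k] by (intro power_mono) auto
    then show ?thesis using True
      by (intro order_trans[OF _ add_increasing2]) (auto intro!: ennreal_leI simp: power_divide)
  next
    case False
    define j where "j = (LEAST j. norm k < 2 ^ (j + 1))"
    have ex: "\<exists>j. norm k < 2 ^ (j + 1)"
    proof -
      obtain n where "norm k < 2 ^ n" using real_arch_pow[of 2 "norm k"] by auto
      moreover have "(2::real) ^ n \<le> 2 ^ (n + 1)" by (intro power_increasing) auto
      ultimately show ?thesis by (intro exI[of _ n]) linarith
    qed
    have j: "norm k < 2 ^ (j + 1)" unfolding j_def by (rule LeastI_ex[OF ex])
    have j': "2 ^ j \<le> norm k"
    proof (cases j)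
      case 0
      then show ?thesis using False by simp
    next
      case (Suc i)
      then have "\<not> norm k < 2 ^ (i + 1)" unfolding j_def using not_less_Least by (metis lessI)
      then show ?thesis using Suc by simp
    qed
    have "(2 ^ j)\<^sup>2 \<le> (norm k)\<^sup>2" using j' by (intro power_mono) auto
    then have "(2 ^ j)\<^sup>2 \<le> (norm k)\<^sup>2 + \<mu>" using \<mu> by linarith
    then have "n_tilde \<mu> k \<le> 1 / (2 ^ j)\<^sup>2"
      unfolding n_tilde_def using \<mu>
      by (intro divide_left_mono mult_pos_pos add_nonneg_pos) auto
    then have "(n_tilde \<mu> k)\<^sup>2 \<le> (1 / (2 ^ j)\<^sup>2)\<^sup>2"
      using n_tilde_pos[OF \<mu>, of k] by (intro power_mono) auto
    also have "\<dots> = (1 / 16) ^ j"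
      by (simp add: power_divide power_mult[symmetric] mult.commute[of j])
         (simp add: power_mult)
    finally have "?f k \<le> ?s j k" using j by (auto intro: ennreal_leI)
    also have "\<dots> \<le> (\<Sum>j. ?s j k)"
    proof -
      define t where "t = (\<lambda>j. ?s j k)"
      have "t j \<le> suminf t" using sum_le_suminf[of t "{j}"] by simp
      then show ?thesis unfolding t_def .
    qed
    finally show ?thesis by (simp add: add_increasing)
  qed
  have "(\<integral>\<^sup>+ k. ?f k \<partial>lborel)
      \<le> (\<integral>\<^sup>+ k. ennreal (1 / \<mu>\<^sup>2) * indicator (ball 0 1) k + (\<Sum>j. ?s j k) \<partial>lborel)"
    by (intro nn_integral_mono le)
  also have "\<dots> = ennreal (1 / \<mu>\<^sup>2) * emeasure lborel (ball (0::R3) 1)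
      + (\<Sum>j. ennreal ((1/16) ^ j) * emeasure lborel (ball (0::R3) (2 ^ (j + 1))))"
  proof -
    have m: "(\<lambda>k. ennreal c * indicator (ball (0::R3) r) k) \<in> borel_measurable lborel"
        "(\<integral>\<^sup>+ k. ennreal c * indicator (ball (0::R3) r) k \<partial>lborel) = ennreal c * emeasure lborel (ball (0::R3) r)"
      for c r
      by (intro borel_measurable_times_ennreal borel_measurable_const borel_measurable_indicator)
         (auto simp: nn_integral_cmult_indicator)
    have "(\<lambda>k. \<Sum>j. ?s j k) \<in> borel_measurable lborel"
      by (intro borel_measurable_suminf_order m)
    then show ?thesis by (simp only: nn_integral_add m nn_integral_suminf)
  qed
  also have "\<dots> \<le> ennreal (1 / \<mu>\<^sup>2) * ennreal 8 + (\<Sum>j. ennreal (64 * (1/2) ^ j))"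
  proof (intro add_mono mult_left_mono suminf_le summableI)
    show "emeasure lborel (ball (0::R3) 1) \<le> ennreal 8"
      using emeasure_ball_R3_le[of 1] by simp
    fix j :: nat
    have "ennreal ((1/16) ^ j) * emeasure lborel (ball (0::R3) (2 ^ (j + 1)))
        \<le> ennreal ((1/16) ^ j) * ennreal ((2 * 2 ^ (j + 1)) ^ 3)"
      by (intro mult_left_mono emeasure_ball_R3_le) auto
    also have "\<dots> = ennreal ((1/16) ^ j * (2 * 2 ^ (j + 1)) ^ 3)"
      by (intro ennreal_mult[symmetric]) auto
    also have "(1/16) ^ j * (2 * 2 ^ (j + 1)) ^ 3 = 64 * ((1/2) ^ j :: real)"
    proof -
      have "(2 * 2 ^ (j + 1)) ^ 3 = 64 * (8 ^ j :: real)"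
        by (simp add: power_mult_distrib power_mult[symmetric] mult.commute[of j]) (simp add: power_mult)
      then show ?thesis by (simp add: power_mult_distrib[symmetric])
    qed
    finally show "ennreal ((1/16) ^ j) * emeasure lborel (ball (0::R3) (2 ^ (j + 1)))
        \<le> ennreal (64 * (1/2) ^ j)" .
  qed auto
  also have "\<dots> < \<infinity>"
    by (simp add: ennreal_suminf_neq_top summable_mult summable_geometric ennreal_mult_eq_top_iff less_top[symmetric])
  finally show "integrable lborel (\<lambda>k. (n_tilde \<mu> k)\<^sup>2)"
    by (intro integrableI_nonneg) auto
qed measurable

text \<open>
  For large \<open>R\<close>, the ball of radius \<open>R / 2\<close> around \<open>R e\<close> contributes at least a multiple of \<open>R\<close> to
  the integral of the square. The unit vector \<open>e\<close> is chosen so that the linear and the quadratic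
  term have the same sign on the ball and cannot cancel.
\<close>

lemma L2_quadratic_imp_const:
  fixes \<alpha> \<gamma> :: real and \<beta> :: R3
  assumes \<mu>: "\<mu> > 0"
    and L2: "(\<lambda>k. n_tilde \<mu> k * (\<alpha> + \<beta> \<bullet> k + \<gamma> * (norm k)\<^sup>2)) \<in> L2 lborel"
  shows "\<beta> = 0 \<and> \<gamma> = 0"
proof (rule ccontr)
  assume nz: "\<not> (\<beta> = 0 \<and> \<gamma> = 0)"
  define s :: real where "s = (if \<gamma> < 0 then -1 else 1)"
  define e :: R3 where "e = s *\<^sub>R (if \<beta> = 0 then axis 1 1 else sgn \<beta>)"
  define c where "c = norm \<beta> / 2 + \<bar>\<gamma>\<bar> / 4"
  define d where "d = c / (2 * (9 / 4 + \<mu>))"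
  define V where "V = measure lborel (ball (0::R3) 1) / 8"
  let ?h = "\<lambda>k. (n_tilde \<mu> k * (\<alpha> + \<beta> \<bullet> k + \<gamma> * (norm k)\<^sup>2))\<^sup>2"
  define J where "J = (LINT k|lborel. ?h k)"
  have int: "integrable lborel ?h" by (rule L2_integrable_square[OF L2])
  have ss: "s * s = 1" "s * \<bar>\<gamma>\<bar> = \<gamma>" "\<bar>s\<bar> = 1" by (auto simp: s_def)
  have e: "norm e = 1" by (auto simp: e_def ss norm_sgn norm_axis_1)
  have \<beta>: "\<beta> \<bullet> k = s * (norm \<beta> * (e \<bullet> k))" for k
  proof (cases "\<beta> = 0")
    case False
    have "s * (norm \<beta> * (e \<bullet> k)) = (s * s) * ((norm \<beta> *\<^sub>R sgn \<beta>) \<bullet> k)"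
      using False by (simp add: e_def)
    also have "norm \<beta> *\<^sub>R sgn \<beta> = \<beta>" using False by (simp add: sgn_div_norm)
    finally show ?thesis by (simp add: ss)
  qed simp
  have c: "c > 0" using nz by (auto simp: c_def intro: add_pos_nonneg add_nonneg_pos)
  have d: "d > 0" using c \<mu> by (simp add: d_def)
  have V: "V > 0" by (simp add: V_def content_ball_pos)
  have bound: "d\<^sup>2 * V * R \<le> J" if R: "R \<ge> 1" "R \<ge> 2 * \<bar>\<alpha>\<bar> / c" for R
  proof -
    let ?B = "ball (R *\<^sub>R e) (R / 2)"
    have lower: "(d / R)\<^sup>2 \<le> ?h k" if k: "k \<in> ?B" for k
    proof -
      have dist: "norm (k - R *\<^sub>R e) < R / 2" using k by (simp add: dist_norm norm_minus_commute)
      have ek: "R / 2 \<le> e \<bullet> k"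
      proof -
        have "\<bar>e \<bullet> (k - R *\<^sub>R e)\<bar> \<le> norm (k - R *\<^sub>R e)"
          using Cauchy_Schwarz_ineq2[of e "k - R *\<^sub>R e"] e by simp
        moreover have "e \<bullet> (k - R *\<^sub>R e) = e \<bullet> k - R"
          using e by (simp add: inner_diff_right flip: power2_norm_eq_inner)
        ultimately show ?thesis using dist by linarith
      qed
      have nk: "R / 2 \<le> norm k" using ek Cauchy_Schwarz_ineq2[of e k] e by simp
      have nk': "norm k \<le> 3 / 2 * R"
        using norm_triangle_sub[of k "R *\<^sub>R e"] dist e R by simp
      have "c * R \<le> norm \<beta> * (e \<bullet> k) + \<bar>\<gamma>\<bar> * (norm k)\<^sup>2"
      proof -
        have "norm \<beta> * (R / 2) \<le> norm \<beta> * (e \<bullet> k)" using ek by (intro mult_left_mono) auto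
        moreover have "R / 4 \<le> (norm k)\<^sup>2"
        proof -
          have "R / 4 \<le> (R / 2)\<^sup>2" using R by (simp add: power2_eq_square)
          also have "\<dots> \<le> (norm k)\<^sup>2" using nk R by (intro power_mono) auto
          finally show ?thesis .
        qed
        then have "\<bar>\<gamma>\<bar> * (R / 4) \<le> \<bar>\<gamma>\<bar> * (norm k)\<^sup>2" by (intro mult_left_mono) auto
        ultimately show ?thesis by (simp add: c_def algebra_simps)
      qed
      also have "\<dots> \<le> \<bar>norm \<beta> * (e \<bullet> k) + \<bar>\<gamma>\<bar> * (norm k)\<^sup>2\<bar>" by simp
      also have "\<dots> = \<bar>s * (norm \<beta> * (e \<bullet> k) + \<bar>\<gamma>\<bar> * (norm k)\<^sup>2)\<bar>" by (simp add: abs_mult ss)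
      also have "s * (norm \<beta> * (e \<bullet> k) + \<bar>\<gamma>\<bar> * (norm k)\<^sup>2) = \<beta> \<bullet> k + \<gamma> * (norm k)\<^sup>2"
        using ss(2) by (simp add: \<beta> distrib_left mult.assoc[symmetric])
      finally have "c * R \<le> \<bar>\<beta> \<bullet> k + \<gamma> * (norm k)\<^sup>2\<bar>" .
      moreover have "\<bar>\<alpha>\<bar> \<le> c * R / 2" using R(2) c by (simp add: field_simps)
      ultimately have P: "c * R / 2 \<le> \<bar>\<alpha> + \<beta> \<bullet> k + \<gamma> * (norm k)\<^sup>2\<bar>" by linarith
      have n: "1 / (R\<^sup>2 * (9 / 4 + \<mu>)) \<le> n_tilde \<mu> k"
      proof -
        have "(norm k)\<^sup>2 \<le> (3 / 2 * R)\<^sup>2" using nk' by (intro power_mono) auto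
        moreover have "\<mu> * 1 \<le> \<mu> * R\<^sup>2" using R \<mu> by (intro mult_left_mono) auto
        ultimately have "(norm k)\<^sup>2 + \<mu> \<le> R\<^sup>2 * (9 / 4 + \<mu>)"
          by (simp add: algebra_simps power2_eq_square)
        then show ?thesis unfolding n_tilde_def using \<mu>
          by (intro divide_left_mono mult_pos_pos add_nonneg_pos) (use R in auto)
      qed
      have "d / R = 1 / (R\<^sup>2 * (9 / 4 + \<mu>)) * (c * R / 2)"
      proof -
        have "c / (2 * M) / R = 1 / (R\<^sup>2 * M) * (c * R / 2)" if "M > 0" for M
          using R that by (simp add: power2_eq_square field_simps)
        from this[of "9 / 4 + \<mu>"] \<mu> show ?thesis by (simp add: d_def)
      qed
      also have "\<dots> \<le> n_tilde \<mu> k * \<bar>\<alpha> + \<beta> \<bullet> k + \<gamma> * (norm k)\<^sup>2\<bar>"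
        using n P n_tilde_pos[OF \<mu>, of k] c R by (intro mult_mono) auto
      finally have "\<bar>d / R\<bar> \<le> \<bar>n_tilde \<mu> k * (\<alpha> + \<beta> \<bullet> k + \<gamma> * (norm k)\<^sup>2)\<bar>"
        using d R n_tilde_pos[OF \<mu>, of k] by (simp add: abs_mult)
      then show ?thesis by (simp only: abs_le_square_iff)
    qed
    have "d\<^sup>2 * V * R = (d / R)\<^sup>2 * measure lborel ?B"
    proof -
      have "measure lborel ?B = R ^ 3 * V"
        using R content_ball_conv_unit_ball[of "R / 2" "R *\<^sub>R e"]
        by (simp add: V_def power_divide)
      then show ?thesis using R by (simp add: power2_eq_square power3_eq_cube)
    qed
    also have "\<dots> = (LINT k|lborel. (d / R)\<^sup>2 * indicator ?B k)" by simp
    also have "\<dots> \<le> J"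
      unfolding J_def
    proof (rule integral_mono[OF _ int])
      show "integrable lborel (\<lambda>k. (d / R)\<^sup>2 * indicator ?B k)"
        using emeasure_lborel_ball_finite by (intro integrable_mult_right integrable_real_indicator) auto
      show "(d / R)\<^sup>2 * indicator ?B k \<le> ?h k" for k
        using lower[of k] by (auto simp: indicator_def)
    qed
    finally show ?thesis .
  qed
  define R where "R = 1 + 2 * \<bar>\<alpha>\<bar> / c + (\<bar>J\<bar> + 1) / (d\<^sup>2 * V)"
  have pos: "0 \<le> 2 * \<bar>\<alpha>\<bar> / c" "0 \<le> (\<bar>J\<bar> + 1) / (d\<^sup>2 * V)" using c d V by auto
  have "d\<^sup>2 * V * R \<le> J" using pos by (intro bound) (auto simp: R_def)
  moreover have "d\<^sup>2 * V * ((\<bar>J\<bar> + 1) / (d\<^sup>2 * V)) \<le> d\<^sup>2 * V * R"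
    using pos d V by (intro mult_left_mono) (auto simp: R_def)
  moreover have "d\<^sup>2 * V * ((\<bar>J\<bar> + 1) / (d\<^sup>2 * V)) = \<bar>J\<bar> + 1" using d V by simp
  ultimately show False by linarith
qed

text \<open>
  On a box \<open>1 / n\<close> is bounded, and \<open>|t| \<le> 1 + t\<^sup>2\<close> reduces integrability to square integrability.
\<close>

lemma locally_integrable_L2_over_n_tilde:
  assumes \<mu>: "\<mu> > 0" and g: "g \<in> L2 lborel"
  shows "locally_integrable (\<lambda>k. g k / n_tilde \<mu> k)"
  unfolding locally_integrable_def
proof (intro conjI allI)
  have [measurable]: "g \<in> borel_measurable borel" using L2_measurable[OF g] by simp
  show "(\<lambda>k. g k / n_tilde \<mu> k) \<in> borel_measurable borel" by measurable
  fix a b :: R3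
  obtain B where B: "\<And>k. k \<in> box a b \<Longrightarrow> norm k \<le> B"
    using bounded_box[of a b] unfolding bounded_iff by blast
  show "set_integrable lborel (box a b) (\<lambda>k. g k / n_tilde \<mu> k)"
    unfolding set_integrable_def
  proof (rule Bochner_Integration.integrable_bound)
    have "emeasure lborel (box a b) < \<infinity>" by (rule emeasure_lborel_box_finite)
    then show "integrable lborel (\<lambda>k. indicator (box a b) k * 1 + (B\<^sup>2 + \<mu>)\<^sup>2 * (g k)\<^sup>2)"
      using L2_integrable_square[OF g]
      by (intro Bochner_Integration.integrable_add integrable_mult_right integrable_mult_left
          integrable_real_indicator) auto
    show "(\<lambda>k. indicator (box a b) k *\<^sub>R (g k / n_tilde \<mu> k)) \<in> borel_measurable lborel"
      by measurable
    show "AE k in lborel. norm (indicator (box a b) k *\<^sub>R (g k / n_tilde \<mu> k))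
        \<le> norm (indicator (box a b) k * 1 + (B\<^sup>2 + \<mu>)\<^sup>2 * (g k)\<^sup>2)"
    proof (rule AE_I2)
      fix k
      show "norm (indicator (box a b) k *\<^sub>R (g k / n_tilde \<mu> k))
        \<le> norm (indicator (box a b) k * 1 + (B\<^sup>2 + \<mu>)\<^sup>2 * (g k)\<^sup>2)"
      proof (cases "k \<in> box a b")
        case True
        let ?m = "(norm k)\<^sup>2 + \<mu>"
        have m: "0 < ?m" "?m \<le> B\<^sup>2 + \<mu>"
          using \<mu> B[OF True] by (auto intro: add_nonneg_pos power_mono)
        have "\<bar>g k * ?m\<bar> \<le> 1 + (g k * ?m)\<^sup>2"
          using sum_squares_bound[of 1 "\<bar>g k * ?m\<bar>"] by simp
        also have "(g k * ?m)\<^sup>2 \<le> (B\<^sup>2 + \<mu>)\<^sup>2 * (g k)\<^sup>2"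
          using m by (auto simp: power_mult_distrib mult.commute intro!: mult_left_mono power_mono)
        finally show ?thesis using True by (simp add: n_tilde_def)
      qed simp
    qed
  qed
qed

text \<open>
  The integrand of the quadratic form is a positive weight times the square of the defect of the
  invariant. So the form vanishes exactly for invariants.
\<close>

lemma kernel_iff_collisional_invariant:
  assumes \<mu>: "\<mu> > 0" and T: "is_collision_operator \<mu> T" and g: "g \<in> L2 lborel"
  shows "g \<in> L2_Ker lborel T \<longleftrightarrow> collisional_invariant (\<lambda>k. g k / n_tilde \<mu> k)"
proof -
  define Q where "Q = (\<lambda>g (k, k1, k2, k3). 1 / 4 * (n_tilde \<mu> k * n_tilde \<mu> k1 * n_tilde \<mu> k2 * n_tilde \<mu> k3 *
      (g k1 / n_tilde \<mu> k1 + g k2 / n_tilde \<mu> k2 - g k / n_tilde \<mu> k - g k3 / n_tilde \<mu> k3)\<^sup>2))"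
  have bd: "L2_bounded_operator lborel T" and sa: "L2_self_adjoint lborel T"
    and form: "\<And>g. g \<in> L2 lborel \<Longrightarrow> has_bochner_integral resonant_measure (Q g) (- L2_inner lborel (T g) g)"
    using T by (auto simp: is_collision_operator_def Q_def)
  have Q0: "0 \<le> Q f z" for f z
    unfolding Q_def split_beta'
    by (intro mult_nonneg_nonneg zero_le_power2 less_imp_le[OF n_tilde_pos[OF \<mu>]]) simp
  have eq: "(LINT z|resonant_measure. Q f z) = - L2_inner lborel (T f) f"
    and int: "integrable resonant_measure (Q f)" if "f \<in> L2 lborel" for f
    using form[OF that] by (auto simp: has_bochner_integral_iff)
  have neg: "L2_inner lborel (T f) f \<le> 0" if "f \<in> L2 lborel" for f
  proof -
    have "0 \<le> (LINT z|resonant_measure. Q f z)"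
      using Q0 by (intro integral_nonneg_AE AE_I2) blast
    then show ?thesis using eq[OF that] by simp
  qed
  have "collisional_invariant (\<lambda>k. g k / n_tilde \<mu> k) \<longleftrightarrow> (AE z in resonant_measure. Q g z = 0)"
    unfolding collisional_invariant_def
    using n_tilde_pos[OF \<mu>] by (intro AE_cong) (auto simp: Q_def less_imp_neq[symmetric])
  also have "\<dots> \<longleftrightarrow> (LINT z|resonant_measure. Q g z) = 0"
    by (rule integral_nonneg_eq_0_iff_AE[symmetric, OF int[OF g]]) (use Q0 in \<open>intro AE_I2, blast\<close>)
  also have "\<dots> \<longleftrightarrow> L2_inner lborel (T g) g = 0" using eq[OF g] by simp
  also have "\<dots> \<longleftrightarrow> g \<in> L2_Ker lborel T"
  proof
    assume "L2_inner lborel (T g) g = 0"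
    then show "g \<in> L2_Ker lborel T"
      using L2_kernel_if_form_zero[OF bd sa neg g] g by (simp add: L2_Ker_def)
  next
    assume "g \<in> L2_Ker lborel T"
    then have "AE x in lborel. T g x = 0" by (simp add: L2_Ker_def)
    then have "AE x in lborel. T g x * g x = 0" by eventually_elim simp
    then show "L2_inner lborel (T g) g = 0"
      unfolding L2_inner_def by (rule integral_eq_zero_AE)
  qed
  finally show ?thesis ..
qed

section \<open>Smooth bumps\<close>

text \<open>
  The functions \<open>p(1/x) exp(-1/x)\<close>, extended by zero, are closed under differentiation, which
  makes all of them smooth at once.
\<close>

definition flat :: "real poly \<Rightarrow> real \<Rightarrow> real" where
  "flat p x = (if x > 0 then poly p (1 / x) * exp (- (1 / x)) else 0)"

lemma tendsto_poly_mult_exp_minus: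
  fixes p :: "real poly"
  shows "((\<lambda>y. poly p y * exp (- y)) \<longlongrightarrow> 0) at_top"
proof -
  have "((\<lambda>y. \<Sum>i\<le>degree p. coeff p i * (y ^ i / exp y)) \<longlongrightarrow> (\<Sum>i\<le>degree p. coeff p i * 0)) at_top"
    by (intro tendsto_sum tendsto_mult_left tendsto_power_div_exp_0)
  moreover have "poly p y * exp (- y) = (\<Sum>i\<le>degree p. coeff p i * (y ^ i / exp y))" for y
    by (simp add: poly_altdef sum_distrib_right exp_minus divide_inverse mult.assoc)
  ultimately show ?thesis by simp
qed

lemma flat_has_derivative:
  "(flat p has_real_derivative flat ([:0, 0, 1:] * (p - pderiv p)) x) (at x)"
proof -
  consider "x > 0" | "x < 0" | "x = 0" by linarith
  then show ?thesis
  proof cases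
    case 1
    have i: "((\<lambda>x. 1 / x) has_real_derivative - (1 / x\<^sup>2)) (at x)"
      using 1 by (auto intro!: derivative_eq_intros simp: power2_eq_square)
    have "((\<lambda>x. poly p (1 / x) * exp (- (1 / x))) has_real_derivative
        poly (pderiv p) (1 / x) * - (1 / x\<^sup>2) * exp (- (1 / x))
          + exp (- (1 / x)) * - (- (1 / x\<^sup>2)) * poly p (1 / x)) (at x)"
      by (rule DERIV_mult DERIV_chain2[OF poly_DERIV i] DERIV_chain2[OF DERIV_exp DERIV_minus[OF i]])+
    also have "poly (pderiv p) (1 / x) * - (1 / x\<^sup>2) * exp (- (1 / x))
          + exp (- (1 / x)) * - (- (1 / x\<^sup>2)) * poly p (1 / x)
        = flat ([:0, 0, 1:] * (p - pderiv p)) x"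
      using 1 by (simp add: flat_def power2_eq_square algebra_simps)
    finally have "((\<lambda>x. poly p (1 / x) * exp (- (1 / x))) has_real_derivative
        flat ([:0, 0, 1:] * (p - pderiv p)) x) (at x)" .
    then show ?thesis
      by (rule has_field_derivative_transform_within_open[where S = "{0<..}"])
         (use 1 in \<open>auto simp: flat_def\<close>)
  next
    case 2
    have "((\<lambda>x. 0) has_real_derivative flat ([:0, 0, 1:] * (p - pderiv p)) x) (at x)"
      using 2 by (simp add: flat_def)
    then show ?thesis
      by (rule has_field_derivative_transform_within_open[where S = "{..<0}"])
         (use 2 in \<open>auto simp: flat_def\<close>)
  next
    case 3
    have "((\<lambda>h. flat p h / h) \<longlongrightarrow> 0) (at 0)"
    proof (rule filterlim_split_at_real)
      have "((\<lambda>h::real. 0) \<longlongrightarrow> (0::real)) (at_left 0)" by simp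
      then show "((\<lambda>h. flat p h / h) \<longlongrightarrow> 0) (at_left 0)"
        by (rule Lim_transform_eventually)
           (auto simp: flat_def eventually_at_filter intro!: always_eventually)
      have "((\<lambda>h. poly (pCons 0 p) (inverse h) * exp (- inverse h)) \<longlongrightarrow> 0) (at_right 0)"
        by (rule filterlim_compose[OF tendsto_poly_mult_exp_minus filterlim_inverse_at_top_right])
      then show "((\<lambda>h. flat p h / h) \<longlongrightarrow> 0) (at_right 0)"
        by (rule Lim_transform_eventually)
           (auto simp: flat_def eventually_at_filter field_simps intro!: always_eventually)
    qed
    then show ?thesis
      using 3 by (simp add: DERIV_def flat_def)
  qed
qed

text \<open>
  The sums of products of two such functions, one vanishing to the left of \<open>a\<close> and the other to the
  right of \<open>b\<close>. The family is closed under derivatives by the product rule.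
\<close>

inductive flat_span :: "real \<Rightarrow> real \<Rightarrow> real \<Rightarrow> (real \<Rightarrow> real) \<Rightarrow> bool" for c a b where
  base: "flat_span c a b (\<lambda>x. flat p (c * (x - a)) * flat q (c * (b - x)))"
| add: "flat_span c a b f \<Longrightarrow> flat_span c a b g \<Longrightarrow> flat_span c a b (\<lambda>x. f x + g x)"

lemma flat_smult: "flat (smult c p) x = c * flat p x"
  by (simp add: flat_def)

lemma flat_span_has_derivative:
  assumes "flat_span c a b f"
  shows "\<exists>f'. flat_span c a b f' \<and> (\<forall>x. (f has_real_derivative f' x) (at x))"
  using assms
proof induction
  case (base p q)
  let ?D = "\<lambda>p. [:0, 0, 1:] * (p - pderiv p)"
  have "((\<lambda>x. flat p (c * (x - a)) * flat q (c * (b - x))) has_real_derivative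
      flat (smult c (?D p)) (c * (x - a)) * flat q (c * (b - x))
        + flat p (c * (x - a)) * flat (smult (- c) (?D q)) (c * (b - x))) (at x)" for x
  proof -
    have 1: "((\<lambda>x. c * (x - a)) has_real_derivative c) (at x)"
      by (auto intro!: derivative_eq_intros)
    have 2: "((\<lambda>x. c * (b - x)) has_real_derivative - c) (at x)"
      by (auto intro!: derivative_eq_intros)
    note DERIV_mult[OF DERIV_chain2[OF flat_has_derivative[of p] 1]
        DERIV_chain2[OF flat_has_derivative[of q] 2]]
    then show ?thesis
      unfolding flat_smult by (simp only: mult_ac add_ac)
  qed
  then show ?case
    using flat_span.add[OF flat_span.base[of c a b "smult c (?D p)" q]
        flat_span.base[of c a b p "smult (- c) (?D q)"]] by blast
next
  case (add f g)
  then obtain f' g' where "flat_span c a b f'" "\<forall>x. (f has_real_derivative f' x) (at x)"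
    "flat_span c a b g'" "\<forall>x. (g has_real_derivative g' x) (at x)" by blast
  then show ?case
    by (intro exI[of _ "\<lambda>x. f' x + g' x"]) (auto intro: flat_span.add DERIV_add)
qed

lemma flat_span_deriv:
  assumes "flat_span c a b f"
  shows "flat_span c a b ((deriv ^^ n) f)"
proof (induction n)
  case (Suc n)
  then obtain f' where f': "flat_span c a b f'" "\<forall>x. ((deriv ^^ n) f has_real_derivative f' x) (at x)"
    using flat_span_has_derivative by blast
  then have "deriv ((deriv ^^ n) f) = f'" by (intro ext DERIV_imp_deriv) blast
  then show ?case using f'(1) by simp
qed (simp add: assms)

text \<open>
  For \<open>c\<close> tending to infinity the bumps converge to the indicator of the interval, because the
  exponents \<open>1 / (c (x - a))\<close> and \<open>1 / (c (b - x))\<close> tend to zero inside it.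
\<close>

definition bump :: "real \<Rightarrow> real \<Rightarrow> real \<Rightarrow> real \<Rightarrow> real" where
  "bump c a b x = flat 1 (c * (x - a)) * flat 1 (c * (b - x))"

lemma flat_1_bounds: "0 \<le> flat 1 x" "flat 1 x \<le> 1"
  by (auto simp: flat_def)

lemma bump_bounds: "0 \<le> bump c a b x" "bump c a b x \<le> 1"
  using flat_1_bounds by (auto simp: bump_def intro: mult_le_one)

lemma bump_outside: "c > 0 \<Longrightarrow> x \<notin> {a<..<b} \<Longrightarrow> bump c a b x = 0"
  by (auto simp: bump_def flat_def zero_less_mult_iff)

lemma test_function_closed_under:
  assumes smooth: "\<And>n x. (deriv ^^ n) f field_differentiable at x"
    and sub: "{x. f x \<noteq> 0} \<subseteq> K" and K: "compact K" "K \<subseteq> {0<..}"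
  shows "test_function f"
proof -
  have c: "closure {x. f x \<noteq> 0} \<subseteq> K"
    using sub compact_imp_closed[OF K(1)] by (rule closure_minimal)
  then have "compact (closure {x. f x \<noteq> 0})"
    using bounded_subset[OF compact_imp_bounded[OF K(1)] c] by (simp add: compact_eq_bounded_closed)
  with c K smooth show ?thesis unfolding test_function_def by blast
qed

lemma test_function_bump:
  assumes "0 < a" "0 < c"
  shows "test_function (bump c a b)"
proof -
  have b: "flat_span c a b (bump c a b)"
    unfolding bump_def[abs_def] by (rule flat_span.base)
  have diff: "(deriv ^^ n) (bump c a b) field_differentiable at x" for n x
    using flat_span_has_derivative[OF flat_span_deriv[OF b]] by (auto simp: field_differentiable_def)
  have "{x. bump c a b x \<noteq> 0} \<subseteq> {a..b}"
  proof
    fix x assume "x \<in> {x. bump c a b x \<noteq> 0}"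
    then have "x \<in> {a<..<b}" using bump_outside[OF \<open>0 < c\<close>, of x a b] by blast
    then show "x \<in> {a..b}" by simp
  qed
  moreover have "{a..b} \<subseteq> {0<..}" using \<open>0 < a\<close> by (auto simp: subset_eq)
  ultimately show ?thesis
    using diff by (intro test_function_closed_under[where K = "{a..b}"] compact_Icc)
qed

lemma bump_tendsto_indicator:
  "(\<lambda>n. bump (real (Suc n)) a b x) \<longlonglongrightarrow> indicator {a<..<b} x"
proof (cases "x \<in> {a<..<b}")
  case True
  have lim: "(\<lambda>n. flat 1 (real (Suc n) * t)) \<longlonglongrightarrow> 1" if "t > 0" for t
  proof -
    have "(\<lambda>n. exp (- (inverse (real (Suc n)) * (1 / t)))) \<longlonglongrightarrow> exp (- (0 * (1 / t)))"
      by (intro tendsto_intros LIMSEQ_inverse_real_of_nat)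
    moreover have "flat 1 (real (Suc n) * t) = exp (- (inverse (real (Suc n)) * (1 / t)))" for n
    proof -
      have "0 < real (Suc n) * t" using that by simp
      then have "flat 1 (real (Suc n) * t) = exp (- (1 / (real (Suc n) * t)))"
        by (simp only: flat_def if_True poly_1 mult_1_left)
      then show ?thesis by (simp only: divide_inverse inverse_mult_distrib mult_1_left)
    qed
    ultimately show ?thesis by simp
  qed
  have "(\<lambda>n. bump (real (Suc n)) a b x) \<longlonglongrightarrow> 1 * 1"
    unfolding bump_def using True by (intro tendsto_mult lim) auto
  with True show ?thesis by simp
next
  case False
  then have "bump (real (Suc n)) a b x = 0" for n by (intro bump_outside) auto
  with False show ?thesis by simp
qed


lemma test_function_differentiable:
  "test_function f \<Longrightarrow> (deriv ^^ n) f field_differentiable at x"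
  unfolding test_function_def by blast

lemma test_function_support:
  assumes "test_function f"
  obtains K where "compact K" "K \<subseteq> {0<..}" "{x. f x \<noteq> 0} \<subseteq> K"
proof (rule that)
  show "compact (closure {x. f x \<noteq> 0})" "closure {x. f x \<noteq> 0} \<subseteq> {0<..}"
    using assms unfolding test_function_def by blast+
  show "{x. f x \<noteq> 0} \<subseteq> closure {x. f x \<noteq> 0}" by (rule closure_subset)
qed

lemma test_function_add:
  assumes f: "test_function f" and g: "test_function g"
  shows "test_function (\<lambda>x. f x + g x)"
proof -
  have d: "(deriv ^^ n) (\<lambda>x. f x + g x) = (\<lambda>x. (deriv ^^ n) f x + (deriv ^^ n) g x)" for n
  proof (induction n)
    case (Suc n)
    show ?case
      unfolding funpow.simps o_def Suc
      by (intro ext deriv_add test_function_differentiable f g)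
  qed simp
  obtain K where K: "compact K" "K \<subseteq> {0<..}" "{x. f x \<noteq> 0} \<subseteq> K"
    by (rule test_function_support[OF f])
  obtain L where L: "compact L" "L \<subseteq> {0<..}" "{x. g x \<noteq> 0} \<subseteq> L"
    by (rule test_function_support[OF g])
  show ?thesis
  proof (rule test_function_closed_under)
    show "(deriv ^^ n) (\<lambda>x. f x + g x) field_differentiable at x" for n x
      unfolding d by (intro field_differentiable_add test_function_differentiable f g)
    show "{x. f x + g x \<noteq> 0} \<subseteq> K \<union> L"
    proof
      fix x assume "x \<in> {x. f x + g x \<noteq> 0}"
      then have "f x \<noteq> 0 \<or> g x \<noteq> 0" by auto
      then show "x \<in> K \<union> L" using K(3) L(3) by blast
    qed
    show "compact (K \<union> L)" "K \<union> L \<subseteq> {0<..}" using K L by auto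
  qed
qed

lemma test_function_cmult:
  assumes f: "test_function f"
  shows "test_function (\<lambda>x. c * f x)"
proof -
  have d: "(deriv ^^ n) (\<lambda>x. c * f x) = (\<lambda>x. c * (deriv ^^ n) f x)" for n
  proof (induction n)
    case (Suc n)
    show ?case
      unfolding funpow.simps o_def Suc
      by (intro ext deriv_cmult test_function_differentiable f)
  qed simp
  obtain K where K: "compact K" "K \<subseteq> {0<..}" "{x. f x \<noteq> 0} \<subseteq> K"
    by (rule test_function_support[OF f])
  show ?thesis
  proof (rule test_function_closed_under[OF _ _ K(1,2)])
    show "(deriv ^^ n) (\<lambda>x. c * f x) field_differentiable at x" for n x
      unfolding d by (intro field_differentiable_mult field_differentiable_const test_function_differentiable f)
    show "{x. c * f x \<noteq> 0} \<subseteq> K" using K(3) by auto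
  qed
qed

lemma test_function_continuous: "test_function f \<Longrightarrow> continuous_on UNIV f"
  using test_function_differentiable[of f 0]
  by (intro continuous_at_imp_continuous_on ballI field_differentiable_imp_continuous_at) simp

lemma test_function_bounds:
  assumes f: "test_function f"
  obtains B r R where "0 < r" "0 \<le> B" "0 < R" "\<And>x. \<bar>f x\<bar> \<le> B" "\<And>x. x \<notin> {r..R} \<Longrightarrow> f x = 0"
proof -
  obtain K where K: "compact K" "K \<subseteq> {0<..}" "{x. f x \<noteq> 0} \<subseteq> K"
    by (rule test_function_support[OF f])
  show ?thesis
  proof (cases "K = {}")
    case True
    then show ?thesis using K(3) by (intro that[of 1 0 1]) auto
  next
    case False
    obtain r where r: "r \<in> K" "\<And>x. x \<in> K \<Longrightarrow> r \<le> x" using compact_attains_inf[OF K(1) False] by blast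
    obtain R where R: "R \<in> K" "\<And>x. x \<in> K \<Longrightarrow> x \<le> R" using compact_attains_sup[OF K(1) False] by blast
    have "bounded (f ` K)"
      by (intro compact_imp_bounded compact_continuous_image continuous_on_subset[OF test_function_continuous[OF f]] K(1)) simp
    then obtain B where B: "\<And>x. x \<in> K \<Longrightarrow> \<bar>f x\<bar> \<le> B" unfolding bounded_iff by auto
    have B0: "0 \<le> B" using B[OF r(1)] by linarith
    have out: "f x = 0" if "x \<notin> K" for x using that K(3) by blast
    show ?thesis
    proof (rule that[of r B R])
      show "0 < r" "0 < R" using r(1) R(1) K(2) by auto
      show "\<bar>f x\<bar> \<le> B" for x using B[of x] out[of x] B0 by (cases "x \<in> K") auto
      show "f x = 0" if "x \<notin> {r..R}" for x using that r(2) R(2) by (intro out) auto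
    qed (rule B0)
  qed
qed

section \<open>Density of the test functions\<close>

lemma space_energy_measure [simp]: "space energy_measure = {0<..}"
  by (simp add: energy_measure_def space_restrict_space)

lemma measurable_energy_measure:
  "(f \<in> borel_measurable energy_measure) = (f \<in> borel_measurable (restrict_space lborel {0<..}))"
  by (simp add: energy_measure_def)

lemma borel_imp_energy_measurable:
  "f \<in> borel_measurable borel \<Longrightarrow> f \<in> borel_measurable energy_measure"
  unfolding measurable_energy_measure by (rule measurable_restrict_space1) simp

lemma sets_energy_measure: "A \<in> sets energy_measure \<longleftrightarrow> A \<in> sets borel \<and> A \<subseteq> {0<..}"
  by (auto simp: energy_measure_def sets_restrict_space_iff)

text \<open>
  Elements of \<open>L\<^sup>2(0,\<infinity>)\<close> may be arbitrary on the rest of the line. Cutting them off makes them Borel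
  functions on the whole line.
\<close>

lemma energy_measurable_iff:
  fixes f :: "real \<Rightarrow> real"
  shows "f \<in> borel_measurable energy_measure \<longleftrightarrow> (\<lambda>x. indicator {0<..} x * f x) \<in> borel_measurable borel"
  unfolding measurable_energy_measure
  by (subst borel_measurable_restrict_space_iff) (simp_all add: mult.commute)

lemma energy_integrable_iff:
  fixes f :: "real \<Rightarrow> real"
  assumes f: "f \<in> borel_measurable borel"
  shows "integrable energy_measure f \<longleftrightarrow> integrable lborel (\<lambda>x. indicator {0<..} x * (sqrt x * f x))"
proof -
  have "integrable energy_measure f \<longleftrightarrow> integrable (restrict_space lborel {0<..}) (\<lambda>x. sqrt x * f x)"
    unfolding energy_measure_def using f
    by (subst integrable_density) (auto intro!: measurable_restrict_space1 simp: AE_restrict_space_iff)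
  also have "\<dots> \<longleftrightarrow> integrable lborel (\<lambda>x. indicator {0<..} x * (sqrt x * f x))"
    by (subst integrable_restrict_space) (auto simp: mult.commute)
  finally show ?thesis .
qed

lemma energy_integral:
  fixes f :: "real \<Rightarrow> real"
  assumes f: "f \<in> borel_measurable borel"
  shows "(LINT x|energy_measure. f x) = (LINT x|lborel. indicator {0<..} x * (sqrt x * f x))"
proof -
  have "(LINT x|energy_measure. f x) = (LINT x|restrict_space lborel {0<..}. sqrt x * f x)"
    unfolding energy_measure_def using f
    by (subst integral_density) (auto intro!: measurable_restrict_space1 simp: AE_restrict_space_iff)
  also have "\<dots> = (LINT x|lborel. indicator {0<..} x * (sqrt x * f x))"
    by (subst integral_restrict_space) (auto simp: mult.commute)
  finally show ?thesis .
qed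

lemma AE_energy_measure_iff:
  "(AE x in energy_measure. P x) \<longleftrightarrow> (AE x in lborel. 0 < x \<longrightarrow> P x)"
proof -
  have "(AE x in energy_measure. P x) \<longleftrightarrow> (AE x in restrict_space lborel {0<..}. 0 < ennreal (sqrt x) \<longrightarrow> P x)"
    unfolding energy_measure_def
    by (rule AE_density) (auto intro!: measurable_restrict_space1)
  also have "\<dots> \<longleftrightarrow> (AE x in lborel. x \<in> {0<..} \<longrightarrow> 0 < ennreal (sqrt x) \<longrightarrow> P x)"
    by (rule AE_restrict_space_iff) simp
  also have "\<dots> \<longleftrightarrow> (AE x in lborel. 0 < x \<longrightarrow> P x)"
    by (rule AE_cong) auto
  finally show ?thesis .
qed

lemma test_function_L2:
  assumes f: "test_function f"
  shows "f \<in> L2 energy_measure"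
proof -
  have m: "f \<in> borel_measurable borel"
    by (rule borel_measurable_continuous_onI[OF test_function_continuous[OF f]])
  obtain B r R where b: "0 < r" "0 \<le> B" "0 < R" "\<And>x. \<bar>f x\<bar> \<le> B" "\<And>x. x \<notin> {r..R} \<Longrightarrow> f x = 0"
    by (rule test_function_bounds[OF f]) blast
  have "integrable lborel (\<lambda>x. indicator {0<..} x * (sqrt x * (f x)\<^sup>2))"
  proof (rule Bochner_Integration.integrable_bound)
    show "integrable lborel (\<lambda>x. (sqrt R * B\<^sup>2) * indicator {r..R} x)"
      by (intro integrable_mult_right integrable_real_indicator) (auto simp: emeasure_lborel_Icc_eq)
    show "AE x in lborel. norm (indicator {0<..} x * (sqrt x * (f x)\<^sup>2)) \<le> norm (sqrt R * B\<^sup>2 * indicator {r..R} x)"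
    proof (rule AE_I2)
      fix x
      show "norm (indicator {0<..} x * (sqrt x * (f x)\<^sup>2)) \<le> norm (sqrt R * B\<^sup>2 * indicator {r..R} x)"
      proof (cases "x \<in> {r..R}")
        case True
        have "(f x)\<^sup>2 \<le> B\<^sup>2" using b(4)[of x] b(2) by (simp add: abs_le_square_iff[symmetric])
        then have "sqrt x * (f x)\<^sup>2 \<le> sqrt R * B\<^sup>2" using True b(1) by (intro mult_mono) auto
        with True b(1) show ?thesis by (simp add: abs_mult)
      qed (simp add: b(5))
    qed
  qed (use m in measurable)
  then have "integrable energy_measure (\<lambda>x. (f x)\<^sup>2)"
    using m by (subst energy_integrable_iff) auto
  then show ?thesis using borel_imp_energy_measurable[OF m] by (simp add: L2_def)
qed

text \<open>
  Membership in the closure of the test functions. The closure is shown to be everything by a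
  monotone class argument starting from intervals.
\<close>

definition test_approx :: "(real \<Rightarrow> real) \<Rightarrow> bool" where
  "test_approx g \<longleftrightarrow> g \<in> L2 energy_measure \<and>
    (\<forall>e>0. \<exists>h. test_function h \<and> (LINT x|energy_measure. (g x - h x)\<^sup>2) < e)"

lemma L2_dist_triangle:
  assumes f: "f \<in> L2 M" and g: "g \<in> L2 M" and h: "h \<in> L2 M"
  shows "(LINT x|M. (f x - h x)\<^sup>2) \<le> 2 * (LINT x|M. (f x - g x)\<^sup>2) + 2 * (LINT x|M. (g x - h x)\<^sup>2)"
proof -
  note i = L2_integrable_square[OF L2_diff]
  have "(LINT x|M. (f x - h x)\<^sup>2) \<le> (LINT x|M. 2 * (f x - g x)\<^sup>2 + 2 * (g x - h x)\<^sup>2)"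
  proof (rule integral_mono)
    fix x
    show "(f x - h x)\<^sup>2 \<le> 2 * (f x - g x)\<^sup>2 + 2 * (g x - h x)\<^sup>2"
      using zero_le_power2[of "(f x - g x) - (g x - h x)"]
      by (simp add: power2_eq_square algebra_simps)
  qed (use i f g h in \<open>auto intro!: Bochner_Integration.integrable_add integrable_mult_right\<close>)
  also have "\<dots> = 2 * (LINT x|M. (f x - g x)\<^sup>2) + 2 * (LINT x|M. (g x - h x)\<^sup>2)"
    using i f g h by (subst Bochner_Integration.integral_add) (auto intro!: integrable_mult_right)
  finally show ?thesis .
qed

lemma test_approx_closed:
  assumes g: "g \<in> L2 energy_measure"
    and ap: "\<And>e. 0 < e \<Longrightarrow> \<exists>u. test_approx u \<and> (LINT x|energy_measure. (g x - u x)\<^sup>2) < e"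
  shows "test_approx g"
  unfolding test_approx_def
proof (intro conjI allI impI g)
  fix e :: real assume e: "0 < e"
  obtain u where u: "test_approx u" "(LINT x|energy_measure. (g x - u x)\<^sup>2) < e / 4"
    using ap[of "e / 4"] e by auto
  obtain h where h: "test_function h" "(LINT x|energy_measure. (u x - h x)\<^sup>2) < e / 4"
    using u(1) e unfolding test_approx_def by (meson divide_pos_pos zero_less_numeral)
  have "u \<in> L2 energy_measure" using u(1) by (simp add: test_approx_def)
  from L2_dist_triangle[OF g this test_function_L2[OF h(1)]] u(2) h(2)
  have "(LINT x|energy_measure. (g x - h x)\<^sup>2) < e" by linarith
  with h(1) show "\<exists>h. test_function h \<and> (LINT x|energy_measure. (g x - h x)\<^sup>2) < e" by blast
qed

lemma test_function_imp_approx: "test_function h \<Longrightarrow> test_approx h"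
  unfolding test_approx_def by (auto intro!: exI[of _ h] test_function_L2)

lemma test_approx_L2: "test_approx g \<Longrightarrow> g \<in> L2 energy_measure"
  by (simp add: test_approx_def)

lemma test_approx_dominated_limit:
  assumes U: "\<And>n. test_approx (U n)" and G: "G \<in> L2 energy_measure"
    and u: "u \<in> borel_measurable energy_measure"
    and le: "\<And>n x. 0 < x \<Longrightarrow> \<bar>U n x\<bar> \<le> \<bar>G x\<bar>"
    and lim: "\<And>x. 0 < x \<Longrightarrow> (\<lambda>n. U n x) \<longlonglongrightarrow> u x"
  shows "test_approx u"
proof -
  have le_u: "\<bar>u x\<bar> \<le> \<bar>G x\<bar>" if "0 < x" for x
    using tendsto_rabs[OF lim[OF that]] le[OF that] by (intro LIMSEQ_le_const2) auto
  have uL: "u \<in> L2 energy_measure"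
    using G u by (rule L2_dominated) (auto intro!: AE_I2 le_u)
  note m[measurable] = L2_measurable[OF test_approx_L2[OF U]] u
  have "(\<lambda>n. LINT x|energy_measure. (u x - U n x)\<^sup>2) \<longlonglongrightarrow> (LINT x|energy_measure. 0)"
  proof (rule integral_dominated_convergence)
    show "integrable energy_measure (\<lambda>x. 4 * (G x)\<^sup>2)"
      using L2_integrable_square[OF G] by simp
    show "AE x in energy_measure. (\<lambda>n. (u x - U n x)\<^sup>2) \<longlonglongrightarrow> 0"
    proof (rule AE_I2)
      fix x assume "x \<in> space energy_measure"
      then have "(\<lambda>n. (u x - U n x)\<^sup>2) \<longlonglongrightarrow> (u x - u x)\<^sup>2"
        by (intro tendsto_intros lim) simp
      then show "(\<lambda>n. (u x - U n x)\<^sup>2) \<longlonglongrightarrow> 0" by simp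
    qed
    show "AE x in energy_measure. norm ((u x - U n x)\<^sup>2) \<le> 4 * (G x)\<^sup>2" for n
    proof (rule AE_I2)
      fix x assume "x \<in> space energy_measure"
      then have "\<bar>u x - U n x\<bar> \<le> \<bar>2 * G x\<bar>" using le_u[of x] le[of x n] by auto
      then have "(u x - U n x)\<^sup>2 \<le> (2 * G x)\<^sup>2" by (simp only: abs_le_square_iff)
      then show "norm ((u x - U n x)\<^sup>2) \<le> 4 * (G x)\<^sup>2" by (simp add: power_mult_distrib)
    qed
  qed measurable
  then have lim0: "(\<lambda>n. LINT x|energy_measure. (u x - U n x)\<^sup>2) \<longlonglongrightarrow> 0" by simp
  show ?thesis
  proof (rule test_approx_closed[OF uL])
    fix e :: real assume "0 < e"
    from order_tendstoD(2)[OF lim0 this] obtain n where "(LINT x|energy_measure. (u x - U n x)\<^sup>2) < e"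
      by (auto simp: eventually_sequentially)
    with U show "\<exists>u'. test_approx u' \<and> (LINT x|energy_measure. (u x - u' x)\<^sup>2) < e" by blast
  qed
qed

lemma test_approx_cmult:
  assumes g: "test_approx g"
  shows "test_approx (\<lambda>x. c * g x)"
  unfolding test_approx_def
proof (intro conjI allI impI L2_cmult test_approx_L2 g)
  fix e :: real assume e: "0 < e"
  have "0 < e / (1 + c\<^sup>2)" using e by (intro divide_pos_pos add_pos_nonneg) auto
  then obtain h where h: "test_function h" "(LINT x|energy_measure. (g x - h x)\<^sup>2) < e / (1 + c\<^sup>2)"
    using g unfolding test_approx_def by blast
  have "(LINT x|energy_measure. (c * g x - c * h x)\<^sup>2) = c\<^sup>2 * (LINT x|energy_measure. (g x - h x)\<^sup>2)"
    by (simp add: right_diff_distrib[symmetric] power_mult_distrib)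
  also have "\<dots> \<le> c\<^sup>2 * (e / (1 + c\<^sup>2))" using h(2) by (intro mult_left_mono) auto
  also have "\<dots> < e" using e by (simp add: divide_simps add_pos_nonneg) 
  finally show "\<exists>h. test_function h \<and> (LINT x|energy_measure. (c * g x - h x)\<^sup>2) < e"
    using test_function_cmult[OF h(1), of c] by blast
qed

lemma test_approx_add:
  assumes f: "test_approx f" and g: "test_approx g"
  shows "test_approx (\<lambda>x. f x + g x)"
  unfolding test_approx_def
proof (intro conjI allI impI L2_add test_approx_L2 f g)
  fix e :: real assume e: "0 < e"
  then have e4: "0 < e / 4" by simp
  obtain h where h: "test_function h" "(LINT x|energy_measure. (f x - h x)\<^sup>2) < e / 4"
    using f e4 unfolding test_approx_def by blast
  obtain k where k: "test_function k" "(LINT x|energy_measure. (g x - k x)\<^sup>2) < e / 4"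
    using g e4 unfolding test_approx_def by blast
  have "(LINT x|energy_measure. ((f x + g x) - (h x + k x))\<^sup>2)
      \<le> 2 * (LINT x|energy_measure. ((f x + g x) - (h x + g x))\<^sup>2)
        + 2 * (LINT x|energy_measure. ((h x + g x) - (h x + k x))\<^sup>2)"
    by (intro L2_dist_triangle L2_add test_approx_L2 f g test_function_imp_approx h k)
  also have "\<dots> < e" using h k by simp
  finally show "\<exists>h. test_function h \<and> (LINT x|energy_measure. (f x + g x - h x)\<^sup>2) < e"
    using test_function_add[OF h(1) k(1)] by blast
qed

lemma L2_indicator_interval:
  assumes "0 < a"
  shows "indicator {a<..<b::real} \<in> L2 energy_measure"
  unfolding L2_def
proof (intro CollectI conjI borel_imp_energy_measurable borel_measurable_indicator)
  have "integrable lborel (\<lambda>x. indicator {0<..} x * (sqrt x * (indicator {a<..<b} x)\<^sup>2) :: real)"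
  proof (rule Bochner_Integration.integrable_bound)
    show "integrable lborel (\<lambda>x. sqrt b * indicator {a<..<b} x)"
      by (cases "a \<le> b") (auto intro!: integrable_mult_right integrable_real_indicator)
    show "AE x in lborel. norm (indicator {0<..} x * (sqrt x * (indicator {a<..<b} x)\<^sup>2) :: real)
        \<le> norm (sqrt b * indicator {a<..<b} x)"
      using assms by (intro AE_I2) (auto simp: indicator_def)
  qed measurable
  then show "integrable energy_measure (\<lambda>x. (indicator {a<..<b} x)\<^sup>2 :: real)"
    by (subst energy_integrable_iff) auto
qed simp

lemma test_approx_indicator_interval:
  assumes "0 < a"
  shows "test_approx (indicator {a<..<b})"
proof (rule test_approx_dominated_limit)
  show "test_approx (bump (real (Suc n)) a b)" for n
    using assms by (intro test_function_imp_approx test_function_bump) auto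
  show "indicator {a<..<b} \<in> L2 energy_measure" by (rule L2_indicator_interval[OF assms])
  show "(indicator {a<..<b} :: real \<Rightarrow> real) \<in> borel_measurable energy_measure"
    by (intro borel_imp_energy_measurable borel_measurable_indicator) simp
  show "\<bar>bump (real (Suc n)) a b x\<bar> \<le> \<bar>indicator {a<..<b} x\<bar>" for n x
    using bump_bounds[of "real (Suc n)" a b x] bump_outside[of "real (Suc n)" x a b]
    by (cases "x \<in> {a<..<b}") auto
  show "(\<lambda>n. bump (real (Suc n)) a b x) \<longlonglongrightarrow> indicator {a<..<b} x" for x
    by (rule bump_tendsto_indicator)
qed

lemma test_approx_0: "test_approx (\<lambda>x. 0)"
  using test_approx_cmult[OF test_approx_indicator_interval[of 1 1], of 0] by simp

text \<open>
  The sets that pass form a Dynkin system containing the open intervals. Intersecting with a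
  fixed interval away from \<open>0\<close> keeps every indicator square integrable.
\<close>

lemma test_approx_indicator_bounded:
  assumes A: "A \<in> sets borel" and a: "0 < a"
  shows "test_approx (indicator (A \<inter> {a<..<b}))"
proof -
  let ?I = "{a<..<b}"
  let ?G = "range (\<lambda>(a, b). {a<..<b::real})"
  have G: "sets borel = sigma_sets UNIV ?G"
  proof -
    have "(\<lambda>(a, b). box a b) = (\<lambda>(a, b). {a<..<b::real})" by (auto simp: fun_eq_iff)
    then have "borel = sigma UNIV ?G" using borel_eq_box[where 'a = real] by (simp only:)
    from arg_cong[OF this, of sets] show ?thesis by (simp add: sets_measure_of)
  qed
  have "Int_stable ?G" by (auto simp: Int_stable_def)
  moreover have "?G \<subseteq> Pow UNIV" by simp
  moreover have "A \<in> sigma_sets UNIV ?G"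
    using A unfolding G .
  ultimately show ?thesis
  proof (induction rule: sigma_sets_induct_disjoint)
    case (basic B)
    then obtain c d where "B = {c<..<d}" by auto
    then have "B \<inter> ?I = {max c a<..<min d b}" by auto
    then show ?case using a by (simp add: test_approx_indicator_interval)
  next
    case empty
    show ?case using test_approx_0 by simp
  next
    case (compl B)
    have "indicator ((UNIV - B) \<inter> ?I) = (\<lambda>x. indicator ?I x + (-1) * (indicator (B \<inter> ?I) x :: real))"
      by (auto simp: fun_eq_iff indicator_def)
    then show ?case
      by (simp only: test_approx_add[OF test_approx_indicator_interval[OF a] test_approx_cmult[OF compl(2)]])
  next
    case (union B)
    have part: "test_approx (indicator ((\<Union>i<n. B i) \<inter> ?I))" for n
    proof (induction n)
      case 0
      show ?case using test_approx_0 by simp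
    next
      case (Suc n)
      have "B n \<inter> B i = {}" if "i < n" for i
        using union(1) that by (auto simp: disjoint_family_on_def)
      then have "indicator ((\<Union>i<Suc n. B i) \<inter> ?I)
          = (\<lambda>x. indicator ((\<Union>i<n. B i) \<inter> ?I) x + (indicator (B n \<inter> ?I) x :: real))"
        by (auto simp: fun_eq_iff indicator_def less_Suc_eq)
      then show ?case using test_approx_add[OF Suc union(3)] by simp
    qed
    show ?case
    proof (rule test_approx_dominated_limit[OF part L2_indicator_interval[OF a]])
      have "B i \<in> sets borel" for i
        using union(2) unfolding G by auto
      then show "(indicator ((\<Union>i. B i) \<inter> ?I) :: real \<Rightarrow> real) \<in> borel_measurable energy_measure"
        by (intro borel_imp_energy_measurable borel_measurable_indicator) auto
      show "\<bar>indicator ((\<Union>i<n. B i) \<inter> ?I) x\<bar> \<le> \<bar>indicator ?I x :: real\<bar>" for n x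
        by (simp add: indicator_def)
      show "(\<lambda>n. indicator ((\<Union>i<n. B i) \<inter> ?I) x) \<longlonglongrightarrow> (indicator ((\<Union>i. B i) \<inter> ?I) x :: real)" for x
      proof (cases "x \<in> (\<Union>i. B i) \<inter> ?I")
        case True
        then obtain i where i: "x \<in> B i" "x \<in> ?I" by auto
        have "indicator ((\<Union>i<n. B i) \<inter> ?I) x = (1::real)" if "n \<ge> Suc i" for n
          using i that by (auto simp: indicator_def intro!: bexI[of _ i])
        then have "\<forall>\<^sub>F n in sequentially. indicator ((\<Union>i<n. B i) \<inter> ?I) x = (1::real)"
          by (auto simp: eventually_sequentially)
        then show ?thesis using True by (simp add: tendsto_eventually)
      next
        case False
        then have "indicator ((\<Union>i<n. B i) \<inter> ?I) x = (0::real)" for n by (auto simp: indicator_def)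
        with False show ?thesis by simp
      qed
    qed
  qed
qed

lemma test_approx_nonneg:
  assumes u: "u \<in> L2 energy_measure" "\<And>x. 0 \<le> u x"
  shows "test_approx u"
proof -
  have "u \<in> borel_measurable energy_measure" by (rule L2_measurable[OF u(1)])
  then have "u \<in> L2 energy_measure \<longrightarrow> test_approx u"
    using u(2)
  proof (induction rule: borel_measurable_induct_real)
    case (set A)
    show ?case
    proof
      assume L: "indicator A \<in> L2 energy_measure"
      have A: "A \<in> sets borel" "A \<subseteq> {0<..}" using set by (auto simp: sets_energy_measure)
      show "test_approx (indicator A)"
      proof (rule test_approx_dominated_limit[OF test_approx_indicator_bounded[OF A(1)] L])
        show "0 < 1 / real (Suc n)" for n by simp
        show "(indicator A :: real \<Rightarrow> real) \<in> borel_measurable energy_measure" by (rule L2_measurable[OF L])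
        show "\<bar>indicator (A \<inter> {1 / real (Suc n)<..<real (Suc n)}) x\<bar> \<le> \<bar>indicator A x :: real\<bar>" for n x
          by (simp add: indicator_def)
        fix x :: real assume x: "0 < x"
        obtain N where N: "x < real N" "1 / x < real N" using reals_Archimedean2[of "max x (1 / x)"] by auto
        have "x \<in> {1 / real (Suc n)<..<real (Suc n)}" if "n \<ge> N" for n
        proof -
          have "real N \<le> real (Suc n)" using that by simp
          then have "x < real (Suc n)" "1 / x < real (Suc n)" using N by linarith+
          then show ?thesis using x by (simp add: divide_simps mult.commute del: of_nat_Suc)
        qed
        then have "\<forall>\<^sub>F n in sequentially. indicator (A \<inter> {1 / real (Suc n)<..<real (Suc n)}) x = (indicator A x :: real)"
          unfolding eventually_sequentially by (intro exI[of _ N]) (auto simp: indicator_def)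
        then show "(\<lambda>n. indicator (A \<inter> {1 / real (Suc n)<..<real (Suc n)}) x) \<longlonglongrightarrow> (indicator A x :: real)"
          by (rule tendsto_eventually)
      qed
    qed
  next
    case (mult v c)
    show ?case
    proof
      assume L: "(\<lambda>x. c * v x) \<in> L2 energy_measure"
      show "test_approx (\<lambda>x. c * v x)"
      proof (cases "c = 0")
        case True
        then show ?thesis using test_approx_0 by simp
      next
        case False
        then have "v \<in> L2 energy_measure" using L2_cmult[OF L, of "1 / c"] by simp
        with mult show ?thesis by (intro test_approx_cmult) blast
      qed
    qed
  next
    case (add v w)
    show ?case
    proof
      assume L: "(\<lambda>x. w x + v x) \<in> L2 energy_measure"
      have "v \<in> L2 energy_measure" "w \<in> L2 energy_measure"
        using add by (auto intro!: L2_dominated[OF L] AE_I2)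
      with add show "test_approx (\<lambda>x. w x + v x)" by (intro test_approx_add) blast+
    qed
  next
    case (seq U)
    show ?case
    proof
      assume L: "u \<in> L2 energy_measure"
      have le: "U i x \<le> u x" if "0 < x" for i x
        using seq.hyps(3) seq.hyps(4)[of x] that by (intro incseq_le) (auto simp: incseq_def le_fun_def)
      have UL: "U i \<in> L2 energy_measure" for i
        using L seq.hyps(1)
      proof (rule L2_dominated)
        show "AE x in energy_measure. \<bar>U i x\<bar> \<le> \<bar>u x\<bar>"
        proof (rule AE_I2)
          fix x assume "x \<in> space energy_measure"
          then show "\<bar>U i x\<bar> \<le> \<bar>u x\<bar>" using le[of x i] seq.hyps(2)[of i x] by simp
        qed
      qed
      show "test_approx u"
      proof (rule test_approx_dominated_limit[OF _ L L2_measurable[OF L]])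
        show "test_approx (U n)" for n using seq.IH UL by blast
        show "\<bar>U n x\<bar> \<le> \<bar>u x\<bar>" if "0 < x" for n x using le[OF that, of n] seq.hyps(2)[of n x] by simp
        show "(\<lambda>n. U n x) \<longlonglongrightarrow> u x" if "0 < x" for x using seq.hyps(4)[of x] that by simp
      qed
    qed
  qed
  with u(1) show ?thesis by blast
qed

lemma test_functions_dense:
  assumes g: "g \<in> L2 energy_measure"
  shows "test_approx g"
proof -
  note [measurable] = L2_measurable[OF g]
  have "(\<lambda>x. max 0 (g x)) \<in> borel_measurable energy_measure"
    "(\<lambda>x. max 0 (- g x)) \<in> borel_measurable energy_measure" by measurable
  then have p: "(\<lambda>x. max 0 (g x)) \<in> L2 energy_measure" "(\<lambda>x. max 0 (- g x)) \<in> L2 energy_measure"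
    by (auto intro!: L2_dominated[OF g] AE_I2)
  have "test_approx (\<lambda>x. max 0 (g x) + (-1) * max 0 (- g x))"
    by (intro test_approx_add test_approx_cmult test_approx_nonneg p) auto
  moreover have "(\<lambda>x. max 0 (g x) + (-1) * max 0 (- g x)) = g" by (auto simp: fun_eq_iff max_def)
  ultimately show ?thesis by simp
qed

section \<open>A Pexider equation on the half-line\<close>

lemma AE_lborel_continuous_imp_all_pos:
  fixes G :: "real \<Rightarrow> real"
  assumes "continuous_on {0<..} G" "AE x in lborel. 0 < x \<longrightarrow> G x = 0" "0 < x"
  shows "G x = 0"
  using assms by (intro AE_lborel_continuous_imp_all[of "{0<..}" G x]) auto

text \<open>
  Integrating the equation over \<open>w\<close> gives \<open>\<phi> x + \<phi> y = H (x + y)\<close> with \<open>H s\<close> twice the mean of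
  \<open>\<phi>\<close> on \<open>[0, s]\<close>, which is continuous. Integrating over \<open>y\<close> then exhibits \<open>\<phi> x\<close>, up to a constant,
  as an integral of \<open>H\<close> over an interval of length one, so that \<open>\<phi>\<close> has a continuously differentiable
  version \<open>f\<close> with \<open>f' x = H (x + 2) - H (x + 1)\<close>. By the equation for \<open>f\<close> this is
  \<open>f 2 - f 1\<close> for every \<open>x\<close>.
\<close>

lemma AE_affine_if_pexider:
  fixes \<phi> :: "real \<Rightarrow> real"
  assumes \<phi>[measurable]: "\<phi> \<in> borel_measurable borel"
    and int: "\<And>s. set_integrable lborel {0..s} \<phi>"
    and eq: "AE p in lborel \<Otimes>\<^sub>M lborel. 0 < fst p \<and> 0 < snd p \<longrightarrow>
      (AE w in lborel. 0 < w \<and> w < fst p + snd p \<longrightarrow>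
        \<phi> (fst p) + \<phi> (snd p) = \<phi> w + \<phi> (fst p + snd p - w))"
  shows "\<exists>\<alpha> \<gamma>. AE x in lborel. 0 < x \<longrightarrow> \<phi> x = \<alpha> + \<gamma> * x"
proof -
  define F where "F = (\<lambda>s. LINT w:{0..s}|lborel. \<phi> w)"
  define H where "H = (\<lambda>s. 2 * F s / s)"
  have contF: "continuous_on {0<..} F"
  proof -
    have "isCont F x" if "0 < x" for x
    proof -
      have "continuous_on {0..2 * x} (\<lambda>s. integral {0..s} \<phi>)"
        using set_borel_integral_eq_integral(1)[OF int] by (rule indefinite_integral_continuous_1)
      then have "continuous_on {0..2 * x} F"
        using set_borel_integral_eq_integral(2)[OF int] by (simp add: F_def)
      then have "continuous_on {0<..<2 * x} F"
        by (rule continuous_on_subset) auto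
      then show ?thesis
        using that by (simp add: continuous_on_eq_continuous_at)
    qed
    then show ?thesis by (simp add: continuous_at_imp_continuous_on)
  qed
  have contH: "continuous_on {0<..} H"
    unfolding H_def by (intro continuous_intros contF) auto
  have pex: "AE p in lborel \<Otimes>\<^sub>M lborel. 0 < fst p \<and> 0 < snd p \<longrightarrow>
      \<phi> (fst p) + \<phi> (snd p) = H (fst p + snd p)"
    using eq
  proof eventually_elim
    case (elim p)
    show ?case
    proof
      assume p: "0 < fst p \<and> 0 < snd p"
      define s where "s = fst p + snd p"
      define v where "v = \<phi> (fst p) + \<phi> (snd p)"
      have s: "s > 0" using p by (simp add: s_def)
      let ?I = "indicator {0..s} :: real \<Rightarrow> real"
      have ae: "AE w in lborel. 0 < w \<and> w < s \<longrightarrow> v = \<phi> w + \<phi> (s - w)"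
        using elim p by (simp add: s_def v_def)
      have i1: "integrable lborel (\<lambda>w. ?I w * \<phi> w)"
        using int[of s] by (simp add: set_integrable_def)
      have refl: "?I (s + -1 * w) = ?I w" for w by (auto simp: indicator_def)
      have i2: "integrable lborel (\<lambda>w. ?I w * \<phi> (s - w))"
        using lborel_integrable_real_affine[OF i1, of "-1" s] refl by simp
      have Fs: "(LINT w|lborel. ?I w * \<phi> w) = F s"
        by (simp add: F_def set_lebesgue_integral_def)
      have Fs': "(LINT w|lborel. ?I w * \<phi> (s - w)) = F s"
        using lborel_integral_real_affine[of "-1" "\<lambda>w. ?I w * \<phi> w" s] refl by (simp add: Fs)
      have "s * v = (LINT w|lborel. ?I w * v)"
        using s by simp
      also have "\<dots> = (LINT w|lborel. ?I w * \<phi> w + ?I w * \<phi> (s - w))"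
      proof (rule integral_cong_AE)
        show "AE w in lborel. ?I w * v = ?I w * \<phi> w + ?I w * \<phi> (s - w)"
          using ae AE_lborel_singleton[of 0] AE_lborel_singleton[of s]
          by eventually_elim (auto simp: indicator_def)
      qed measurable
      also have "\<dots> = 2 * F s" using i1 i2 Fs Fs' by simp
      finally have "v = H s" using s by (simp add: H_def field_simps)
      then show "\<phi> (fst p) + \<phi> (snd p) = H (fst p + snd p)" by (simp add: v_def s_def)
    qed
  qed
  have pex': "AE x in lborel. AE y in lborel. 0 < x \<and> 0 < y \<longrightarrow> \<phi> x + \<phi> y = H (x + y)"
    using lborel_pair.AE_pair[OF pex] by simp
  \<comment> \<open>The base point \<open>1\<close> stays away from \<open>0\<close>, where
    \<open>H\<close> may be singular; \<open>H\<close> is evaluated only at \<open>x + y\<close>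
    with \<open>x > 0\<close> and \<open>y \<ge> 1\<close>.\<close>
  define G where "G = (\<lambda>x. integral {1..x} H)"
  have G: "(G has_real_derivative H x) (at x)" if "1 < x" for x
  proof -
    have "(G has_real_derivative H x) (at x within {1..x + 1})"
      unfolding G_def using that
      by (intro integral_has_real_derivative continuous_on_subset[OF contH]) auto
    then show ?thesis
      using that by (simp add: at_within_interior[of x "{1..x + 1}"] interior_atLeastAtMost_real)
  qed
  define c where "c = (LINT w:{1..2}|lborel. \<phi> w)"
  define f where "f = (\<lambda>x. G (x + 2) - G (x + 1) - c)"
  have int12: "integrable lborel (\<lambda>w. indicator {1..2} w * \<phi> w)"
    using set_integrable_subset[OF int[of 2], of "{1..2}"] by (simp add: set_integrable_def)
  have \<phi>_f: "AE x in lborel. 0 < x \<longrightarrow> \<phi> x = f x"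
    using pex'
  proof eventually_elim
    case (elim x)
    show ?case
    proof
      assume x: "0 < x"
      let ?I = "indicator {1..2} :: real \<Rightarrow> real"
      have contHx: "continuous_on {0<..} (\<lambda>y. H (x + y))"
        using x by (intro continuous_on_compose2[OF contH] continuous_intros) auto
      have FTC: "(LINT y|lborel. H (x + y) * ?I y) = G (x + 2) - G (x + 1)"
      proof (rule integral_FTC_Icc_real)
        fix y :: real assume y: "1 \<le> y" "y \<le> 2"
        have "((\<lambda>y. G (x + y)) has_real_derivative H (x + y) * 1) (at y)"
          using x y by (intro DERIV_chain2[OF G]) (auto intro!: derivative_eq_intros)
        then show "DERIV (\<lambda>y. G (x + y)) y :> H (x + y)" by simp
        show "isCont (\<lambda>y. H (x + y)) y"
          using contHx y by (simp add: continuous_on_eq_continuous_at)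
      qed simp
      have intH: "integrable lborel (\<lambda>y. ?I y * H (x + y))"
      proof -
        have "continuous_on {1..2} (\<lambda>y. H (x + y))" by (rule continuous_on_subset[OF contHx]) auto
        from borel_integrable_compact[OF compact_Icc this] show ?thesis by simp
      qed
      have "\<phi> x = (LINT y|lborel. ?I y * \<phi> x)" by simp
      also have "\<dots> = (LINT y|lborel. ?I y * H (x + y) - ?I y * \<phi> y)"
      proof (rule integral_cong_AE)
        show "AE y in lborel. ?I y * \<phi> x = ?I y * H (x + y) - ?I y * \<phi> y"
          using elim
        proof eventually_elim
          case (elim y)
          show ?case
          proof (cases "y \<in> {1..2}")
            case True
            then have "\<phi> x + \<phi> y = H (x + y)" using elim x by simp
            with True show ?thesis by simp
          qed simp
        qed
        show "(\<lambda>y. ?I y * H (x + y) - ?I y * \<phi> y) \<in> borel_measurable lborel"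
          using intH int12 by (intro borel_measurable_diff borel_measurable_integrable)
      qed measurable
      also have "\<dots> = (LINT y|lborel. ?I y * H (x + y)) - c"
        using intH int12 by (simp add: c_def set_lebesgue_integral_def)
      also have "\<dots> = f x" using FTC by (simp add: f_def mult.commute)
      finally show "\<phi> x = f x" .
    qed
  qed
  have f': "(f has_real_derivative H (x + 2) - H (x + 1)) (at x)" if x: "0 < x" for x
  proof -
    have "((\<lambda>x. G (x + d)) has_real_derivative H (x + d) * 1) (at x)" if "1 \<le> d" for d
      using x that by (intro DERIV_chain2[OF G]) (auto intro!: derivative_eq_intros)
    from DERIV_diff[OF DERIV_diff[OF this[of 2] this[of 1]] DERIV_const[of c]]
    show ?thesis by (simp add: f_def)
  qed
  have contf: "continuous_on {0<..} f"
    using f' by (intro continuous_at_imp_continuous_on ballI DERIV_isCont) auto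
  have 1: "AE x in lborel. 0 < x \<longrightarrow> (\<forall>y>0. f x + f y - H (x + y) = 0)"
    using pex' \<phi>_f
  proof eventually_elim
    case (elim x)
    show ?case
    proof (intro impI allI)
      fix y :: real assume x: "0 < x" and y: "0 < y"
      show "f x + f y - H (x + y) = 0"
      proof (rule AE_lborel_continuous_imp_all_pos[of "\<lambda>y. f x + f y - H (x + y)", OF _ _ y])
        show "continuous_on {0<..} (\<lambda>y. f x + f y - H (x + y))"
          using x by (intro continuous_intros contf continuous_on_compose2[OF contH]) auto
        show "AE y in lborel. 0 < y \<longrightarrow> f x + f y - H (x + y) = 0"
          using elim(1) \<phi>_f by eventually_elim (use x elim(2) in auto)
      qed
    qed
  qed
  have 2: "f x + f y = H (x + y)" if "0 < x" "0 < y" for x y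
  proof -
    have "f x + f y - H (x + y) = 0"
    proof (rule AE_lborel_continuous_imp_all_pos[of "\<lambda>x. f x + f y - H (x + y)", OF _ _ that(1)])
      show "continuous_on {0<..} (\<lambda>x. f x + f y - H (x + y))"
        using that by (intro continuous_intros contf continuous_on_compose2[OF contH]) auto
      show "AE x in lborel. 0 < x \<longrightarrow> f x + f y - H (x + y) = 0"
        using 1 by eventually_elim (use that in blast)
    qed
    then show ?thesis by simp
  qed
  define \<gamma> where "\<gamma> = f 2 - f 1"
  have "((\<lambda>x. f x - \<gamma> * x) has_real_derivative 0) (at x within {0<..})" if "x \<in> {0<..}" for x
  proof -
    have "H (x + 2) - H (x + 1) = \<gamma>"
      using 2[of x 2] 2[of x 1] that by (simp add: \<gamma>_def)
    with f'[of x] that have "(f has_real_derivative \<gamma>) (at x)" by simp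
    from DERIV_diff[OF this DERIV_cmult[OF DERIV_ident, of \<gamma>]]
    have "((\<lambda>x. f x - \<gamma> * x) has_real_derivative \<gamma> - \<gamma> * 1) (at x)" .
    then show ?thesis by (simp add: has_field_derivative_at_within)
  qed
  then obtain \<alpha> where "\<And>x. x \<in> {0<..} \<Longrightarrow> f x - \<gamma> * x = \<alpha>"
    using has_field_derivative_zero_constant[of "{0<..}" "\<lambda>x. f x - \<gamma> * x"] by auto
  then have "0 < x \<Longrightarrow> f x = \<alpha> + \<gamma> * x" for x by (simp add: diff_eq_eq)
  with \<phi>_f show ?thesis by (intro exI[of _ \<alpha>] exI[of _ \<gamma>]) (auto elim: eventually_mono)
qed

section \<open>The collision measure on triples of energies\<close>

type_synonym triple = "real \<times> real \<times> real"

text \<open>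
  A triple holds \<open>\<omega>, \<omega>1, \<omega>2\<close>; the fourth energy \<open>\<omega>3\<close> is determined by resonance and may be
  negative.
\<close>

definition en0 :: "triple \<Rightarrow> real" where "en0 z = fst z"
definition en1 :: "triple \<Rightarrow> real" where "en1 z = fst (snd z)"
definition en2 :: "triple \<Rightarrow> real" where "en2 z = snd (snd z)"
definition en3 :: "triple \<Rightarrow> real" where "en3 z = fst (snd z) + snd (snd z) - fst z"

lemma borel_measurable_en [measurable]:
  "en0 \<in> borel_measurable borel" "en1 \<in> borel_measurable borel"
  "en2 \<in> borel_measurable borel" "en3 \<in> borel_measurable borel"
  unfolding en0_def[abs_def] en1_def[abs_def] en2_def[abs_def] en3_def[abs_def]
  by (intro borel_measurable_continuous_onI continuous_intros)+

text \<open>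
  Exchanging the pair \<open>\<omega>, \<omega>3\<close> with \<open>\<omega>1, \<omega>2\<close>, and exchanging \<open>\<omega>1\<close> with \<open>\<omega>2\<close>. Together they move
  \<open>\<omega>\<close> to each of the four places.
\<close>

definition swap_pairs :: "triple \<Rightarrow> triple" where
  "swap_pairs z = (en1 z, en0 z, en3 z)"

definition swap_out :: "triple \<Rightarrow> triple" where
  "swap_out z = (en0 z, en2 z, en1 z)"

lemma en_swap [simp]:
  "en0 (swap_pairs z) = en1 z" "en1 (swap_pairs z) = en0 z"
  "en2 (swap_pairs z) = en3 z" "en3 (swap_pairs z) = en2 z"
  "en0 (swap_out z) = en0 z" "en1 (swap_out z) = en2 z"
  "en2 (swap_out z) = en1 z" "en3 (swap_out z) = en3 z"
  by (simp_all add: swap_pairs_def swap_out_def en0_def en1_def en2_def en3_def)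

lemma measurable_swap [measurable]:
  "swap_pairs \<in> borel \<rightarrow>\<^sub>M borel" "swap_out \<in> borel \<rightarrow>\<^sub>M borel"
  unfolding swap_pairs_def[abs_def] swap_out_def[abs_def]
    en0_def[abs_def] en1_def[abs_def] en2_def[abs_def] en3_def[abs_def]
  by (intro borel_measurable_continuous_onI continuous_intros)+

lemma nn_integral_triple:
  fixes F :: "triple \<Rightarrow> ennreal"
  assumes F: "F \<in> borel_measurable borel"
  shows "(\<integral>\<^sup>+ z. F z \<partial>lborel) = (\<integral>\<^sup>+ a. \<integral>\<^sup>+ b. \<integral>\<^sup>+ c. F (a, b, c) \<partial>lborel \<partial>lborel \<partial>lborel)"
proof -
  have F1: "F \<in> borel_measurable (lborel \<Otimes>\<^sub>M lborel)" using F by (simp add: lborel_prod)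
  have F2: "(\<lambda>p. F (a, p)) \<in> borel_measurable (lborel \<Otimes>\<^sub>M lborel)" for a
    using measurable_compose[OF measurable_Pair1' F1, of a] unfolding lborel_prod by simp
  have "(\<integral>\<^sup>+ z. F z \<partial>lborel) = (\<integral>\<^sup>+ a. \<integral>\<^sup>+ p. F (a, p) \<partial>lborel \<partial>lborel)"
    using lborel.nn_integral_fst[OF F1] unfolding lborel_prod by (rule sym)
  also have "\<dots> = (\<integral>\<^sup>+ a. \<integral>\<^sup>+ b. \<integral>\<^sup>+ c. F (a, b, c) \<partial>lborel \<partial>lborel \<partial>lborel)"
  proof (rule nn_integral_cong)
    fix a
    show "(\<integral>\<^sup>+ p. F (a, p) \<partial>lborel) = (\<integral>\<^sup>+ b. \<integral>\<^sup>+ c. F (a, b, c) \<partial>lborel \<partial>lborel)"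
      using lborel.nn_integral_fst[OF F2[of a]] unfolding lborel_prod by (rule sym)
  qed
  finally show ?thesis .
qed

lemma nn_integral_swap_out:
  fixes F :: "triple \<Rightarrow> ennreal"
  assumes F: "F \<in> borel_measurable borel"
  shows "(\<integral>\<^sup>+ z. F (swap_out z) \<partial>lborel) = (\<integral>\<^sup>+ z. F z \<partial>lborel)"
proof -
  have FT: "(\<lambda>z. F (swap_out z)) \<in> borel_measurable borel"
    using measurable_swap(2) F by (rule measurable_compose)
  have F2: "(\<lambda>(b, c). F (a, b, c)) \<in> borel_measurable (lborel \<Otimes>\<^sub>M lborel)" for a
  proof -
    have "F \<in> borel_measurable (lborel \<Otimes>\<^sub>M lborel)" using F by (simp add: lborel_prod)
    from measurable_compose[OF measurable_Pair1' this, of a] show ?thesis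
      unfolding lborel_prod by (simp add: split_beta')
  qed
  have "(\<integral>\<^sup>+ z. F (swap_out z) \<partial>lborel) = (\<integral>\<^sup>+ a. \<integral>\<^sup>+ b. \<integral>\<^sup>+ c. F (a, c, b) \<partial>lborel \<partial>lborel \<partial>lborel)"
    unfolding nn_integral_triple[OF FT] by (simp add: swap_out_def en0_def en1_def en2_def)
  also have "\<dots> = (\<integral>\<^sup>+ a. \<integral>\<^sup>+ b. \<integral>\<^sup>+ c. F (a, b, c) \<partial>lborel \<partial>lborel \<partial>lborel)"
    by (intro nn_integral_cong lborel_pair.Fubini' F2)
  finally show ?thesis by (simp add: nn_integral_triple[OF F])
qed

text \<open>
  For fixed outer variables the last coordinate is merely translated, after which only an exchange of
  the outer variables remains.
\<close>

lemma nn_integral_swap_pairs: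
  fixes F :: "triple \<Rightarrow> ennreal"
  assumes F: "F \<in> borel_measurable borel"
  shows "(\<integral>\<^sup>+ z. F (swap_pairs z) \<partial>lborel) = (\<integral>\<^sup>+ z. F z \<partial>lborel)"
proof -
  have FT: "(\<lambda>z. F (swap_pairs z)) \<in> borel_measurable borel"
    using measurable_swap(1) F by (rule measurable_compose)
  have Fc: "(\<lambda>c. F (b, a, c)) \<in> borel_measurable borel" for a b
    by (rule measurable_compose[OF borel_measurable_continuous_onI F]) (intro continuous_intros)
  have inner: "(\<integral>\<^sup>+ c. F (b, a, b + c - a) \<partial>lborel) = (\<integral>\<^sup>+ c. F (b, a, c) \<partial>lborel)" for a b
    using nn_integral_real_affine[OF Fc[of b a], of 1 "b - a"] by (simp add: algebra_simps)
  have F3: "(\<lambda>(a, b). \<integral>\<^sup>+ c. F (a, b, c) \<partial>lborel) \<in> borel_measurable (lborel \<Otimes>\<^sub>M lborel)"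
  proof -
    have "(\<lambda>(p, c). F (fst p, snd p, c)) \<in> borel_measurable (borel :: ((real \<times> real) \<times> real) measure)"
      unfolding split_beta'
      by (rule measurable_compose[OF borel_measurable_continuous_onI F]) (intro continuous_intros)
    then have "(\<lambda>(p, c). F (fst p, snd p, c)) \<in> borel_measurable ((lborel \<Otimes>\<^sub>M lborel) \<Otimes>\<^sub>M lborel)"
      by (simp add: lborel_prod)
    from lborel.borel_measurable_nn_integral[OF this] show ?thesis by (simp add: split_beta')
  qed
  have "(\<integral>\<^sup>+ z. F (swap_pairs z) \<partial>lborel)
      = (\<integral>\<^sup>+ a. \<integral>\<^sup>+ b. \<integral>\<^sup>+ c. F (b, a, b + c - a) \<partial>lborel \<partial>lborel \<partial>lborel)"
    unfolding nn_integral_triple[OF FT] by (simp add: swap_pairs_def en0_def en1_def en3_def)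
  also have "\<dots> = (\<integral>\<^sup>+ a. \<integral>\<^sup>+ b. \<integral>\<^sup>+ c. F (b, a, c) \<partial>lborel \<partial>lborel \<partial>lborel)"
    by (simp only: inner)
  also have "\<dots> = (\<integral>\<^sup>+ b. \<integral>\<^sup>+ a. \<integral>\<^sup>+ c. F (b, a, c) \<partial>lborel \<partial>lborel \<partial>lborel)"
    by (rule lborel_pair.Fubini'[OF F3])
  finally show ?thesis by (simp add: nn_integral_triple[OF F])
qed

lemma distr_eq_lborelI:
  fixes T :: "'a::euclidean_space \<Rightarrow> 'a"
  assumes T: "T \<in> borel \<rightarrow>\<^sub>M borel"
    and nn: "\<And>F. F \<in> borel_measurable borel \<Longrightarrow> (\<integral>\<^sup>+ z. F (T z) \<partial>lborel) = (\<integral>\<^sup>+ z. F z \<partial>lborel)"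
  shows "distr lborel borel T = lborel"
proof (rule measure_eqI)
  fix A assume "A \<in> sets (distr lborel borel T)"
  then have A: "A \<in> sets borel" by simp
  have "emeasure (distr lborel borel T) A = (\<integral>\<^sup>+ z. indicator A z \<partial>distr lborel borel T)"
    using A by simp
  also have "\<dots> = (\<integral>\<^sup>+ z. indicator A (T z) \<partial>lborel)"
    using T A by (subst nn_integral_distr) auto
  also have "\<dots> = emeasure lborel A" using A by (simp add: nn)
  finally show "emeasure (distr lborel borel T) A = emeasure lborel A" .
qed simp

lemma distr_swap: "distr lborel borel swap_pairs = lborel" "distr lborel borel swap_out = lborel"
  by (rule distr_eq_lborelI, measurable, erule nn_integral_swap_pairs)
     (rule distr_eq_lborelI, measurable, erule nn_integral_swap_out)

lemma integral_preserving:
  fixes T :: "'a::euclidean_space \<Rightarrow> 'a" and F :: "'a \<Rightarrow> real"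
  assumes d: "distr lborel borel T = lborel" and T: "T \<in> borel \<rightarrow>\<^sub>M borel" and F: "F \<in> borel_measurable borel"
  shows "integrable lborel (\<lambda>z. F (T z)) \<longleftrightarrow> integrable lborel F"
    and "(LINT z|lborel. F (T z)) = (LINT z|lborel. F z)"
proof -
  have T': "T \<in> lborel \<rightarrow>\<^sub>M borel" using T by simp
  show "integrable lborel (\<lambda>z. F (T z)) \<longleftrightarrow> integrable lborel F"
    using integrable_distr_eq[OF T' F] by (simp add: d)
  show "(LINT z|lborel. F (T z)) = (LINT z|lborel. F z)"
    using integral_distr[OF T' F] by (simp add: d)
qed

lemmas swap_pairs_integral = integral_preserving[OF distr_swap(1) measurable_swap(1)]
lemmas swap_out_integral = integral_preserving[OF distr_swap(2) measurable_swap(2)]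

lemma AE_energies:
  assumes P: "AE x in lborel. P x"
  shows "AE z in lborel. P (en0 z) \<and> P (en1 z) \<and> P (en2 z) \<and> P (en3 z)"
proof -
  obtain N where N: "N \<in> null_sets lborel" "{x. \<not> P x} \<subseteq> N"
    using P by (auto simp: eventually_ae_filter)
  have "AE z in lborel \<Otimes>\<^sub>M lborel. fst z \<notin> N"
  proof (rule lborel_pair.AE_pair_measure)
    show "{x \<in> space (lborel \<Otimes>\<^sub>M lborel). fst x \<notin> N} \<in> sets (lborel \<Otimes>\<^sub>M lborel)"
    proof -
      have [measurable]: "N \<in> sets borel" using N(1) by auto
      show ?thesis by measurable
    qed
    show "AE x in lborel. AE y in lborel. fst (x, y) \<notin> N"
      using AE_not_in[OF N(1)] by eventually_elim simp
  qed
  then have 0: "AE z in lborel. P (en0 z)"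
    unfolding lborel_prod en0_def by eventually_elim (use N(2) in blast)
  have tr: "AE z in lborel. Q (T z)" if "distr lborel borel T = lborel" "T \<in> borel \<rightarrow>\<^sub>M borel" "AE z in lborel. Q z"
    for T :: "triple \<Rightarrow> triple" and Q
  proof -
    have "AE z in distr lborel borel T. Q z" unfolding that(1) by (rule that(3))
    then show ?thesis by (rule AE_distrD[rotated]) (use that(2) in simp)
  qed
  have 1: "AE z in lborel. P (en1 z)" using tr[OF distr_swap(1) measurable_swap(1) 0] by simp
  have 2: "AE z in lborel. P (en2 z)" using tr[OF distr_swap(2) measurable_swap(2) 1] by simp
  have 3: "AE z in lborel. P (en3 z)" using tr[OF distr_swap(1) measurable_swap(1) 2] by simp
  from 0 1 2 3 show ?thesis by eventually_elim simp
qed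

text \<open>
  The square root of a negative number is negative here, so the maximum with \<open>0\<close> makes the weight
  vanish unless all four energies are positive, that is off the interior of the domain of
  integration.
\<close>

definition collision_weight :: "real \<Rightarrow> triple \<Rightarrow> real" where
  "collision_weight \<mu> z =
    max 0 (min (min (sqrt (en0 z)) (sqrt (en1 z))) (min (sqrt (en2 z)) (sqrt (en3 z)))) *
    (n_energy \<mu> (en0 z) * n_energy \<mu> (en1 z) * n_energy \<mu> (en2 z) * n_energy \<mu> (en3 z))"

definition collision_bracket :: "(real \<Rightarrow> real) \<Rightarrow> triple \<Rightarrow> real" where
  "collision_bracket \<phi> z = \<phi> (en1 z) + \<phi> (en2 z) - \<phi> (en0 z) - \<phi> (en3 z)"

lemma borel_measurable_n_energy [measurable]: "n_energy \<mu> \<in> borel_measurable borel"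
  unfolding n_energy_def[abs_def] by measurable

lemma borel_measurable_collision_weight [measurable]: "collision_weight \<mu> \<in> borel_measurable borel"
  unfolding collision_weight_def[abs_def] by measurable

lemma borel_measurable_collision_bracket [measurable]:
  assumes [measurable]: "\<phi> \<in> borel_measurable borel"
  shows "collision_bracket \<phi> \<in> borel_measurable borel"
  unfolding collision_bracket_def[abs_def] by measurable

lemma collision_weight_swap [simp]:
  "collision_weight \<mu> (swap_pairs z) = collision_weight \<mu> z"
  "collision_weight \<mu> (swap_out z) = collision_weight \<mu> z"
  by (simp_all add: collision_weight_def ac_simps)

lemma collision_bracket_swap [simp]:
  "collision_bracket \<phi> (swap_pairs z) = - collision_bracket \<phi> z"
  "collision_bracket \<phi> (swap_out z) = collision_bracket \<phi> z"
  by (simp_all add: collision_bracket_def)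

lemma n_energy_pos: "\<mu> > 0 \<Longrightarrow> 0 \<le> x \<Longrightarrow> n_energy \<mu> x > 0"
  by (simp add: n_energy_def)

lemma collision_weight_eq_0:
  assumes "\<not> (0 < en0 z \<and> 0 < en1 z \<and> 0 < en2 z \<and> 0 < en3 z)"
  shows "collision_weight \<mu> z = 0"
proof -
  have "max 0 (min (min (sqrt (en0 z)) (sqrt (en1 z))) (min (sqrt (en2 z)) (sqrt (en3 z)))) = 0"
    using assms by (auto simp: max_def min_def not_less intro: order_antisym order_trans)
  then show ?thesis by (simp add: collision_weight_def)
qed

lemma collision_weight_pos:
  assumes \<mu>: "\<mu> > 0" and z: "0 < en0 z" "0 < en1 z" "0 < en2 z" "0 < en3 z"
  shows "0 < collision_weight \<mu> z"
  unfolding collision_weight_def using z n_energy_pos[OF \<mu>] by (intro mult_pos_pos) auto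

lemma collision_weight_nonneg: "\<mu> > 0 \<Longrightarrow> 0 \<le> collision_weight \<mu> z"
  by (cases "0 < en0 z \<and> 0 < en1 z \<and> 0 < en2 z \<and> 0 < en3 z")
     (auto simp: collision_weight_eq_0 intro: less_imp_le collision_weight_pos)

text \<open>
  The integrable function \<open>(x + \<mu>)\<^sup>-\<^sup>3\<^sup>/\<^sup>2\<close> on the half-line, which bounds the weight in each of the two
  free energies.
\<close>

definition tail :: "real \<Rightarrow> real \<Rightarrow> real" where
  "tail \<mu> x = indicator {0..} x / ((x + \<mu>) * sqrt (x + \<mu>))"

lemma borel_measurable_tail [measurable]: "tail \<mu> \<in> borel_measurable borel"
  unfolding tail_def[abs_def] by measurable

lemma tail_nonneg: "\<mu> > 0 \<Longrightarrow> 0 \<le> tail \<mu> x"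
  by (simp add: tail_def indicator_def)

lemma integrable_tail:
  assumes \<mu>: "\<mu> > 0"
  shows "integrable lborel (tail \<mu>)"
proof (rule integrableI_nonneg)
  let ?f = "\<lambda>x. 1 / ((x + \<mu>) * sqrt (x + \<mu>))" and ?F = "\<lambda>x. - 2 / sqrt (x + \<mu>)"
  have "(\<integral>\<^sup>+ x. ennreal (?f x) * indicator {0..} x \<partial>lborel) = ennreal (0 - ?F 0)"
  proof (rule nn_integral_FTC_atLeast)
    show "?f \<in> borel_measurable borel" by measurable
    show "DERIV ?F x :> ?f x" if "0 \<le> x" for x
    proof -
      have "0 < x + \<mu>" using that \<mu> by simp
      then show ?thesis
        by (auto intro!: derivative_eq_intros simp: divide_simps power2_eq_square)
    qed
    show "0 \<le> ?f x" if "0 \<le> x" for x using that \<mu> by simp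
    have "filterlim (\<lambda>x. sqrt (x + \<mu>)) at_top at_top"
    proof (rule filterlim_at_top_mono[OF sqrt_at_top])
      show "\<forall>\<^sub>F x in at_top. sqrt x \<le> sqrt (x + \<mu>)" using \<mu> by simp
    qed
    then show "(?F \<longlongrightarrow> 0) at_top"
      by (intro tendsto_divide_0[OF tendsto_const] filterlim_at_top_imp_at_infinity)
  qed
  also have "(\<lambda>x. ennreal (?f x) * indicator {0..} x) = (\<lambda>x. ennreal (tail \<mu> x))"
    by (auto simp: fun_eq_iff tail_def indicator_def)
  finally show "(\<integral>\<^sup>+ x. ennreal (tail \<mu> x) \<partial>lborel) < \<infinity>" by simp
qed (use tail_nonneg[OF \<mu>] in auto)

lemma integrable_product:
  fixes f :: "'a::euclidean_space \<Rightarrow> real" and g :: "'b::euclidean_space \<Rightarrow> real"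
  assumes f: "integrable lborel f" and g: "integrable lborel g"
  shows "integrable lborel (\<lambda>z. f (fst z) * g (snd z))"
proof -
  note [measurable] = borel_measurable_integrable[OF f] borel_measurable_integrable[OF g]
  have "integrable (lborel \<Otimes>\<^sub>M lborel) (\<lambda>z. f (fst z) * g (snd z))"
  proof (rule lborel_pair.Fubini_integrable)
    show "(\<lambda>z. f (fst z) * g (snd z)) \<in> borel_measurable (lborel \<Otimes>\<^sub>M lborel)" by measurable
    show "integrable lborel (\<lambda>x. LINT y|lborel. norm (f (fst (x, y)) * g (snd (x, y))))"
      using f by (simp add: abs_mult)
    show "AE x in lborel. integrable lborel (\<lambda>y. f (fst (x, y)) * g (snd (x, y)))"
      using g by simp
  qed
  then show ?thesis by (simp add: lborel_prod)
qed

text \<open>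
  When \<open>\<omega> \<le> R\<close>, the factor \<open>n3\<close> is at most a constant times \<open>1 / (\<omega>1 + \<omega>2 + \<mu>)\<close>, which in turn is at
  most the product of \<open>(\<omega>1 + \<mu>)\<^sup>-\<^sup>1\<^sup>/\<^sup>2\<close> and \<open>(\<omega>2 + \<mu>)\<^sup>-\<^sup>1\<^sup>/\<^sup>2\<close>. Each of the factors \<open>n1\<close> and \<open>n2\<close> thereby
  gains the missing decay.
\<close>

lemma collision_weight_le:
  assumes \<mu>: "\<mu> > 0" and z: "0 < en0 z" "0 < en1 z" "0 < en2 z" "0 < en3 z" and R: "en0 z \<le> R"
  shows "collision_weight \<mu> z \<le> sqrt R * (1 / \<mu>) * ((R + \<mu>) / \<mu>) * (tail \<mu> (en1 z) * tail \<mu> (en2 z))"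
proof -
  let ?a = "en1 z + \<mu>" and ?b = "en2 z + \<mu>" and ?s = "en1 z + en2 z + \<mu>"
  have pos: "0 < ?a" "0 < ?b" "0 < ?s" "0 < R + \<mu>" "0 < en3 z + \<mu>" using z \<mu> R by auto
  have e3: "en3 z = en1 z + en2 z - en0 z" by (simp add: en0_def en1_def en2_def en3_def)
  have "sqrt (?a * ?b) \<le> sqrt (?s\<^sup>2)"
    using z \<mu> by (intro real_sqrt_le_mono) (simp add: power2_eq_square algebra_simps)
  then have s: "sqrt ?a * sqrt ?b \<le> ?s" using pos by (simp add: real_sqrt_mult)
  have "\<mu> * ?s \<le> (R + \<mu>) * (en3 z + \<mu>)"
  proof -
    have "0 \<le> R * en3 z + \<mu> * (R - en0 z)" using z \<mu> R by simp
    then show ?thesis unfolding e3 by (simp add: algebra_simps)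
  qed
  then have "\<mu> * (sqrt ?a * sqrt ?b) \<le> (R + \<mu>) * (en3 z + \<mu>)"
    using s \<mu> by (meson less_imp_le mult_left_mono order_trans)
  then have n3: "n_energy \<mu> (en3 z) \<le> (R + \<mu>) / \<mu> * (1 / (sqrt ?a * sqrt ?b))"
    using pos \<mu> by (simp add: n_energy_def divide_simps mult.commute)
  have n0: "n_energy \<mu> (en0 z) \<le> 1 / \<mu>"
    unfolding n_energy_def using z \<mu> by (intro divide_left_mono) auto
  have n: "0 \<le> n_energy \<mu> (en0 z)" "0 \<le> n_energy \<mu> (en1 z)" "0 \<le> n_energy \<mu> (en2 z)" "0 \<le> n_energy \<mu> (en3 z)"
    using z n_energy_pos[OF \<mu>] by (auto intro: less_imp_le)
  have m: "max 0 (min (min (sqrt (en0 z)) (sqrt (en1 z))) (min (sqrt (en2 z)) (sqrt (en3 z)))) \<le> sqrt R"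
  proof -
    have "sqrt (en0 z) \<le> sqrt R" "0 \<le> sqrt R" using z R by auto
    from max.boundedI[OF this(2) order_trans[OF min.cobounded1 order_trans[OF min.cobounded1 this(1)]]]
    show ?thesis .
  qed
  have "collision_weight \<mu> z \<le> sqrt R * (1 / \<mu> * n_energy \<mu> (en1 z) * n_energy \<mu> (en2 z)
      * ((R + \<mu>) / \<mu> * (1 / (sqrt ?a * sqrt ?b))))"
    unfolding collision_weight_def
    using m n n0 n3 z R \<mu> by (intro mult_mono mult_nonneg_nonneg order_refl) auto
  also have "\<dots> = sqrt R * (1 / \<mu>) * ((R + \<mu>) / \<mu>) * (tail \<mu> (en1 z) * tail \<mu> (en2 z))"
    using z by (simp add: tail_def n_energy_def)
  finally show ?thesis .
qed

lemma integrable_weight: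
  assumes \<mu>: "\<mu> > 0" and \<psi>[measurable]: "\<psi> \<in> borel_measurable borel"
    and B: "\<And>x. \<bar>\<psi> x\<bar> \<le> B" and R: "\<And>x. R < x \<Longrightarrow> \<psi> x = 0"
  shows "integrable lborel (\<lambda>z. \<psi> (en0 z) * collision_weight \<mu> z)"
    "integrable lborel (\<lambda>z. \<psi> (en1 z) * collision_weight \<mu> z)"
    "integrable lborel (\<lambda>z. \<psi> (en2 z) * collision_weight \<mu> z)"
    "integrable lborel (\<lambda>z. \<psi> (en3 z) * collision_weight \<mu> z)"
proof -
  have B0: "0 \<le> B" using B[of 0] by linarith
  let ?K = "B * (sqrt R * (1 / \<mu>) * ((R + \<mu>) / \<mu>))"
  have "integrable lborel (\<lambda>z. indicator {0..R} (en0 z) * (tail \<mu> (en1 z) * tail \<mu> (en2 z)))"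
    unfolding en0_def en1_def en2_def
    using integrable_product[OF _ integrable_product[OF integrable_tail[OF \<mu>] integrable_tail[OF \<mu>]],
        of "indicator {0..R}"]
    by (simp add: emeasure_lborel_Icc_eq)
  then have int: "integrable lborel (\<lambda>z. ?K * (indicator {0..R} (en0 z) * (tail \<mu> (en1 z) * tail \<mu> (en2 z))))"
    by (rule integrable_mult_right)
  show 0: "integrable lborel (\<lambda>z. \<psi> (en0 z) * collision_weight \<mu> z)"
  proof (rule Bochner_Integration.integrable_bound[OF int])
    show "AE z in lborel. norm (\<psi> (en0 z) * collision_weight \<mu> z)
        \<le> norm (?K * (indicator {0..R} (en0 z) * (tail \<mu> (en1 z) * tail \<mu> (en2 z))))"
    proof (rule AE_I2)
      fix z
      show "norm (\<psi> (en0 z) * collision_weight \<mu> z)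
          \<le> norm (?K * (indicator {0..R} (en0 z) * (tail \<mu> (en1 z) * tail \<mu> (en2 z))))"
      proof (cases "0 < en0 z \<and> 0 < en1 z \<and> 0 < en2 z \<and> 0 < en3 z \<and> en0 z \<le> R")
        case True
        have "norm (\<psi> (en0 z) * collision_weight \<mu> z) = \<bar>\<psi> (en0 z)\<bar> * collision_weight \<mu> z"
          using collision_weight_nonneg[OF \<mu>] by (simp add: abs_mult)
        also have "\<dots> \<le> B * (sqrt R * (1 / \<mu>) * ((R + \<mu>) / \<mu>) * (tail \<mu> (en1 z) * tail \<mu> (en2 z)))"
          using True by (intro mult_mono B collision_weight_le \<mu> collision_weight_nonneg B0) auto
        also have "\<dots> = ?K * (indicator {0..R} (en0 z) * (tail \<mu> (en1 z) * tail \<mu> (en2 z)))"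
          using True by simp
        also have "\<dots> \<le> norm \<dots>" unfolding real_norm_def by (rule abs_ge_self)
        finally show ?thesis .
      next
        case False
        then have "\<psi> (en0 z) * collision_weight \<mu> z = 0"
          using R[of "en0 z"] collision_weight_eq_0[of z \<mu>] by (cases "en0 z \<le> R") auto
        then show ?thesis by (metis norm_ge_zero norm_zero)
      qed
    qed
  qed measurable
  show 1: "integrable lborel (\<lambda>z. \<psi> (en1 z) * collision_weight \<mu> z)"
    using 0 swap_pairs_integral(1)[of "\<lambda>z. \<psi> (en0 z) * collision_weight \<mu> z"] by simp
  show 2: "integrable lborel (\<lambda>z. \<psi> (en2 z) * collision_weight \<mu> z)"
    using 1 swap_out_integral(1)[of "\<lambda>z. \<psi> (en1 z) * collision_weight \<mu> z"] by simp
  show 3: "integrable lborel (\<lambda>z. \<psi> (en3 z) * collision_weight \<mu> z)"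
    using 2 swap_pairs_integral(1)[of "\<lambda>z. \<psi> (en2 z) * collision_weight \<mu> z"] by simp
qed

text \<open>
  By symmetry the four terms of the bracket have the same integral, and two of them carry each
  sign.
\<close>

lemma integral_weight_bracket_eq_0:
  assumes \<mu>: "\<mu> > 0" and \<psi>[measurable]: "\<psi> \<in> borel_measurable borel"
    and B: "\<And>x. \<bar>\<psi> x\<bar> \<le> B" and R: "\<And>x. R < x \<Longrightarrow> \<psi> x = 0"
  shows "(LINT z|lborel. collision_weight \<mu> z * collision_bracket \<psi> z) = 0"
proof -
  let ?J = "\<lambda>e. LINT z|lborel. \<psi> (e z) * collision_weight \<mu> z"
  have "?J en1 = ?J en0" using swap_pairs_integral(2)[of "\<lambda>z. \<psi> (en0 z) * collision_weight \<mu> z"] by simp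
  moreover have "?J en2 = ?J en1" using swap_out_integral(2)[of "\<lambda>z. \<psi> (en1 z) * collision_weight \<mu> z"] by simp
  moreover have "?J en3 = ?J en2" using swap_pairs_integral(2)[of "\<lambda>z. \<psi> (en2 z) * collision_weight \<mu> z"] by simp
  moreover have "(LINT z|lborel. collision_weight \<mu> z * collision_bracket \<psi> z)
      = ?J en1 + ?J en2 - ?J en0 - ?J en3"
    using integrable_weight[OF \<mu> \<psi> B R]
    by (simp add: collision_bracket_def algebra_simps)
  ultimately show ?thesis by simp
qed

lemma integrable_weight_bracket:
  assumes \<mu>: "\<mu> > 0" and \<psi>[measurable]: "\<psi> \<in> borel_measurable borel"
    and B: "\<And>x. \<bar>\<psi> x\<bar> \<le> B" and R: "\<And>x. R < x \<Longrightarrow> \<psi> x = 0"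
    and v[measurable]: "v \<in> borel_measurable borel" and C: "\<And>z. \<bar>v z\<bar> \<le> C"
  shows "integrable lborel (\<lambda>z. v z * (collision_weight \<mu> z * collision_bracket \<psi> z))"
proof (rule Bochner_Integration.integrable_bound)
  show "integrable lborel (\<lambda>z. C * (\<psi> (en1 z) * collision_weight \<mu> z + \<psi> (en2 z) * collision_weight \<mu> z
      - \<psi> (en0 z) * collision_weight \<mu> z - \<psi> (en3 z) * collision_weight \<mu> z))"
    using integrable_weight[OF \<mu> \<psi> B R] by simp
  show "AE z in lborel. norm (v z * (collision_weight \<mu> z * collision_bracket \<psi> z))
    \<le> norm (C * (\<psi> (en1 z) * collision_weight \<mu> z + \<psi> (en2 z) * collision_weight \<mu> z
      - \<psi> (en0 z) * collision_weight \<mu> z - \<psi> (en3 z) * collision_weight \<mu> z))"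
  proof (rule AE_I2)
    fix z
    have "\<bar>v z\<bar> * \<bar>collision_weight \<mu> z * collision_bracket \<psi> z\<bar>
        \<le> \<bar>C\<bar> * \<bar>collision_weight \<mu> z * collision_bracket \<psi> z\<bar>"
      using C[of z] by (intro mult_right_mono) auto
    moreover have "C * (\<psi> (en1 z) * collision_weight \<mu> z + \<psi> (en2 z) * collision_weight \<mu> z
        - \<psi> (en0 z) * collision_weight \<mu> z - \<psi> (en3 z) * collision_weight \<mu> z)
        = C * (collision_weight \<mu> z * collision_bracket \<psi> z)"
      by (simp add: collision_bracket_def algebra_simps)
    ultimately show "norm (v z * (collision_weight \<mu> z * collision_bracket \<psi> z))
      \<le> norm (C * (\<psi> (en1 z) * collision_weight \<mu> z + \<psi> (en2 z) * collision_weight \<mu> z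
        - \<psi> (en0 z) * collision_weight \<mu> z - \<psi> (en3 z) * collision_weight \<mu> z))"
      by (simp only: real_norm_def abs_mult)
  qed
qed measurable

text \<open>
  The exchanges carry \<open>v(\<omega>)\<close> to \<open>v(\<omega>1)\<close>, \<open>v(\<omega>2)\<close> and \<open>v(\<omega>3)\<close>, and the bracket changes sign with
  the pairs. Averaging the four expressions gives the symmetric form.
\<close>

lemma weak_form_symmetrised:
  assumes \<mu>: "\<mu> > 0" and \<psi>[measurable]: "\<psi> \<in> borel_measurable borel"
    and B: "\<And>x. \<bar>\<psi> x\<bar> \<le> B" and R: "\<And>x. R < x \<Longrightarrow> \<psi> x = 0"
    and v[measurable]: "v \<in> borel_measurable borel" and C: "\<And>x. \<bar>v x\<bar> \<le> C"
  shows "(LINT z|lborel. v (en0 z) * (collision_weight \<mu> z * collision_bracket \<psi> z))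
    = - (1 / 4) * (LINT z|lborel. collision_weight \<mu> z * (collision_bracket v z * collision_bracket \<psi> z))"
proof -
  let ?W = "\<lambda>z. collision_weight \<mu> z * collision_bracket \<psi> z"
  let ?J = "\<lambda>e. LINT z|lborel. v (e z) * ?W z"
  have int: "integrable lborel (\<lambda>z. v (en0 z) * ?W z)" "integrable lborel (\<lambda>z. v (en1 z) * ?W z)"
     "integrable lborel (\<lambda>z. v (en2 z) * ?W z)" "integrable lborel (\<lambda>z. v (en3 z) * ?W z)"
    by (rule integrable_weight_bracket[OF \<mu> \<psi> B R _ C], assumption, measurable)+
  have "?J en0 = - ?J en1" using swap_pairs_integral(2)[of "\<lambda>z. v (en1 z) * ?W z"] by simp
  moreover have "?J en2 = ?J en1" using swap_out_integral(2)[of "\<lambda>z. v (en1 z) * ?W z"] by simp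
  moreover have "?J en3 = - ?J en2" using swap_pairs_integral(2)[of "\<lambda>z. v (en2 z) * ?W z"] by simp
  moreover have "(LINT z|lborel. collision_weight \<mu> z * (collision_bracket v z * collision_bracket \<psi> z))
      = ?J en1 + ?J en2 - ?J en0 - ?J en3"
  proof -
    have "collision_weight \<mu> z * (collision_bracket v z * collision_bracket \<psi> z)
        = v (en1 z) * ?W z + v (en2 z) * ?W z - v (en0 z) * ?W z - v (en3 z) * ?W z" for z
      by (simp add: collision_bracket_def[of v] algebra_simps)
    then show ?thesis using int by simp
  qed
  ultimately show ?thesis by simp
qed

section \<open>The weak form of the radial operator\<close>

lemma test_function_over_n_energy:
  assumes \<mu>: "\<mu> > 0" and h: "test_function h"
  obtains B R where "(\<lambda>x. h x / n_energy \<mu> x) \<in> borel_measurable borel"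
    "\<And>x. \<bar>h x / n_energy \<mu> x\<bar> \<le> B" "\<And>x. R < x \<Longrightarrow> h x / n_energy \<mu> x = 0"
proof -
  obtain B r R where b: "0 < r" "0 \<le> B" "0 < R" "\<And>x. \<bar>h x\<bar> \<le> B" "\<And>x. x \<notin> {r..R} \<Longrightarrow> h x = 0"
    by (rule test_function_bounds[OF h]) blast
  have [measurable]: "h \<in> borel_measurable borel"
    by (rule borel_measurable_continuous_onI[OF test_function_continuous[OF h]])
  show ?thesis
  proof (rule that[of "B * (R + \<mu>)" R])
    show "(\<lambda>x. h x / n_energy \<mu> x) \<in> borel_measurable borel" by measurable
    show "\<bar>h x / n_energy \<mu> x\<bar> \<le> B * (R + \<mu>)" for x
    proof (cases "x \<in> {r..R}")
      case True
      then have x: "0 < x + \<mu>" "x + \<mu> \<le> R + \<mu>" using b(1) \<mu> by auto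
      then have "\<bar>h x / n_energy \<mu> x\<bar> = \<bar>h x\<bar> * (x + \<mu>)" by (simp add: n_energy_def abs_mult)
      also have "\<dots> \<le> B * (R + \<mu>)" using x b by (intro mult_mono) auto
      finally show ?thesis .
    next
      case False
      then show ?thesis using b \<mu> by simp
    qed
    show "h x / n_energy \<mu> x = 0" if "R < x" for x using that b(5)[of x] by simp
  qed
qed

text \<open>
  The factor \<open>\<surd>\<omega>\<close> of the measure cancels the denominator of \<open>\<Omega>\<close>, and \<open>u = v n\<close> supplies the fourth
  density, which makes the kernel symmetric in the four energies.
\<close>

lemma radial_formula_pointwise:
  assumes \<mu>: "\<mu> > 0" and w: "0 < w" and z: "z = (w, p)" and v: "v = u w / n_energy \<mu> w"
  shows "sqrt w * u w * (indicator {(w1, w2). 0 \<le> w1 \<and> 0 \<le> w2 \<and> w \<le> w1 + w2} p *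
      (case p of (w1, w2) \<Rightarrow> let w3 = w1 + w2 - w;
            \<Omega> = min (min (sqrt w) (sqrt w1)) (min (sqrt w2) (sqrt w3)) / sqrt w;
            n = n_energy \<mu>
        in \<Omega> * n w1 * n w2 * n w3 *
             (- (g w / n w) - g w3 / n w3 + g w1 / n w1 + g w2 / n w2)))
    = v * (collision_weight \<mu> z * collision_bracket (\<lambda>x. g x / n_energy \<mu> x) z)"
proof -
  obtain w1 w2 where p: "p = (w1, w2)" by (cases p)
  have en: "en0 z = w" "en1 z = w1" "en2 z = w2" "en3 z = w1 + w2 - w"
    by (simp_all add: z p en0_def en1_def en2_def en3_def)
  let ?m = "min (min (sqrt w) (sqrt w1)) (min (sqrt w2) (sqrt (w1 + w2 - w)))"
  show ?thesis
  proof (cases "0 \<le> w1 \<and> 0 \<le> w2 \<and> w \<le> w1 + w2")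
    case True
    then have m: "max 0 ?m = ?m" using w by (intro max_absorb2) auto
    have n0: "n_energy \<mu> w \<noteq> 0" "sqrt w \<noteq> 0" using n_energy_pos[OF \<mu>, of w] w by auto
    then have uv: "u w = v * n_energy \<mu> w" by (simp add: v)
    have lhs: "sqrt w * u w * (?m / sqrt w * a * b * c * d) = v * ((?m * (n_energy \<mu> w * a * b * c)) * d)" for a b c d
      using n0 by (simp add: uv)
    have ind: "indicator {(w1, w2). 0 \<le> w1 \<and> 0 \<le> w2 \<and> w \<le> w1 + w2} (w1, w2) = (1::real)"
      using True by simp
    have br: "- x0 - x3 + x1 + x2 = x1 + x2 - x0 - x3" for x0 x1 x2 x3 :: real by simp
    show ?thesis
      unfolding collision_weight_def collision_bracket_def en m ind mult_1_left p prod.case Let_def br lhs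
      by (rule refl)
  next
    case False
    then have "\<not> (0 < en0 z \<and> 0 < en1 z \<and> 0 < en2 z \<and> 0 < en3 z)" by (auto simp: en)
    from collision_weight_eq_0[OF this] False show ?thesis by (auto simp: p)
  qed
qed

text \<open>
  The function \<open>u\<close> ranges over more than test functions so as to include \<open>u = n\<close>. Boundedness of
  \<open>u / n\<close> makes the integrand absolutely integrable over the triples, and Fubini applies.
\<close>

lemma radial_weak_form:
  assumes \<mu>: "\<mu> > 0" and T: "is_radial_collision_operator \<mu> T"
    and h: "test_function h" and u[measurable]: "u \<in> borel_measurable borel"
    and uL: "u \<in> L2 energy_measure"
    and C: "\<And>x. \<bar>u x / n_energy \<mu> x\<bar> \<le> C"
  shows "L2_inner energy_measure (T h) u =
    (LINT z|lborel. u (en0 z) / n_energy \<mu> (en0 z) *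
      (collision_weight \<mu> z * collision_bracket (\<lambda>x. h x / n_energy \<mu> x) z))"
proof -
  let ?\<psi> = "\<lambda>x. h x / n_energy \<mu> x" and ?v = "\<lambda>x. u x / n_energy \<mu> x"
  obtain B R where \<psi>[measurable]: "?\<psi> \<in> borel_measurable borel" and B: "\<And>x. \<bar>?\<psi> x\<bar> \<le> B"
    and R: "\<And>x. R < x \<Longrightarrow> ?\<psi> x = 0"
    by (rule test_function_over_n_energy[OF \<mu> h]) blast
  define K where "K = (\<lambda>z. ?v (en0 z) * (collision_weight \<mu> z * collision_bracket ?\<psi> z))"
  have Kint: "integrable lborel K"
    unfolding K_def by (rule integrable_weight_bracket[OF \<mu> \<psi> B R _ C]) auto
  have Kint': "integrable (lborel \<Otimes>\<^sub>M lborel) K" using Kint by (simp add: lborel_prod)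
  have K[measurable]: "K \<in> borel_measurable (lborel \<Otimes>\<^sub>M lborel)" using Kint' by (rule borel_measurable_integrable)
  define I where "I = (\<lambda>w. LINT p|lborel. K (w, p))"
  have I[measurable]: "I \<in> borel_measurable borel"
  proof -
    have "I \<in> borel_measurable lborel"
      unfolding I_def by (rule lborel.borel_measurable_lebesgue_integral) (simp add: K)
    then show ?thesis by simp
  qed
  \<comment> \<open>The energy measure lives on the half-line; the weight already vanishes
    outside it.\<close>
  have I0: "I w = 0" if "\<not> 0 < w" for w
  proof -
    have "K (w, p) = 0" for p
      using that collision_weight_eq_0[of "(w, p)" \<mu>] by (simp add: K_def en0_def)
    then show ?thesis by (simp add: I_def)
  qed
  have key: "sqrt w * u w * radial_collision_formula \<mu> h w = I w" if w: "0 < w" for w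
    unfolding radial_collision_formula_def set_lebesgue_integral_def I_def integral_mult_right_zero[symmetric]
    unfolding real_scaleR_def
    by (intro Bochner_Integration.integral_cong refl)
       (simp only: radial_formula_pointwise[OF \<mu> w refl refl] K_def en0_def fst_conv)
  have bd: "L2_bounded_operator energy_measure T"
    and Th: "AE w in energy_measure. T h w = radial_collision_formula \<mu> h w"
    using T h unfolding is_radial_collision_operator_def by blast+
  have ThL: "T h \<in> L2 energy_measure" by (rule L2_bounded_operatorD(1)[OF bd test_function_L2[OF h]])
  have "L2_inner energy_measure (T h) u = (LINT w|energy_measure. I w / sqrt w)"
    unfolding L2_inner_def
  proof (rule integral_cong_AE)
    show "(\<lambda>w. T h w * u w) \<in> borel_measurable energy_measure"
      by (intro borel_measurable_times L2_measurable[OF ThL] L2_measurable[OF uL])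
    show "(\<lambda>w. I w / sqrt w) \<in> borel_measurable energy_measure"
      by (rule borel_imp_energy_measurable) measurable
    show "AE w in energy_measure. T h w * u w = I w / sqrt w"
      using Th AE_space[of energy_measure]
    proof eventually_elim
      case (elim w)
      then have w: "0 < w" by simp
      have "sqrt w * (T h w * u w) = I w" using key[OF w] elim(1) by (simp add: mult_ac)
      then show ?case using w by (simp add: field_simps)
    qed
  qed
  also have "\<dots> = (LINT w|lborel. indicator {0<..} w * (sqrt w * (I w / sqrt w)))"
    by (rule energy_integral) measurable
  also have "\<dots> = (LINT w|lborel. I w)"
    by (intro Bochner_Integration.integral_cong refl) (auto simp: indicator_def I0)
  also have "\<dots> = integral\<^sup>L (lborel \<Otimes>\<^sub>M lborel) K"
    unfolding I_def by (rule lborel_pair.integral_fst'[OF Kint'])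
  finally show ?thesis by (simp add: lborel_prod K_def)
qed

lemma n_energy_L2:
  assumes \<mu>: "\<mu> > 0"
  shows "n_energy \<mu> \<in> L2 energy_measure"
proof -
  have "integrable lborel (\<lambda>x. indicator {0<..} x * (sqrt x * (n_energy \<mu> x)\<^sup>2))"
  proof (rule Bochner_Integration.integrable_bound[OF integrable_tail[OF \<mu>]])
    show "AE x in lborel. norm (indicator {0<..} x * (sqrt x * (n_energy \<mu> x)\<^sup>2)) \<le> norm (tail \<mu> x)"
    proof (rule AE_I2)
      fix x
      show "norm (indicator {0<..} x * (sqrt x * (n_energy \<mu> x)\<^sup>2)) \<le> norm (tail \<mu> x)"
      proof (cases "0 < x")
        case True
        let ?s = "sqrt (x + \<mu>)"
        have s: "?s > 0" "?s * ?s = x + \<mu>" using True \<mu> by auto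
        have "sqrt x * (n_energy \<mu> x)\<^sup>2 \<le> ?s * (n_energy \<mu> x)\<^sup>2"
          using \<mu> by (intro mult_right_mono real_sqrt_le_mono) auto
        also have "\<dots> = tail \<mu> x"
        proof -
          have "t * (1 / y)\<^sup>2 = 1 / (y * t)" if "t > 0" "y = t * t" for t y :: real
            using that(1) unfolding that(2) by (simp add: power2_eq_square divide_simps)
          from this[OF s(1) s(2)[symmetric]] show ?thesis
            using True by (simp add: tail_def n_energy_def)
        qed
        finally show ?thesis using True tail_nonneg[OF \<mu>, of x] by simp
      qed simp
    qed
  qed measurable
  then have "integrable energy_measure (\<lambda>x. (n_energy \<mu> x)\<^sup>2)"
    by (subst energy_integrable_iff) auto
  then show ?thesis
    using borel_imp_energy_measurable[OF borel_measurable_n_energy, of \<mu>] by (simp add: L2_def)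
qed

lemma radial_form_test:
  assumes \<mu>: "\<mu> > 0" and T: "is_radial_collision_operator \<mu> T"
    and h: "test_function h" and k: "test_function k"
  shows "L2_inner energy_measure (T h) k = - (1 / 4) * (LINT z|lborel. collision_weight \<mu> z *
    (collision_bracket (\<lambda>x. k x / n_energy \<mu> x) z * collision_bracket (\<lambda>x. h x / n_energy \<mu> x) z))"
proof -
  obtain B R where \<psi>: "(\<lambda>x. h x / n_energy \<mu> x) \<in> borel_measurable borel" "\<And>x. \<bar>h x / n_energy \<mu> x\<bar> \<le> B"
    "\<And>x. R < x \<Longrightarrow> h x / n_energy \<mu> x = 0"
    by (rule test_function_over_n_energy[OF \<mu> h]) blast
  obtain C where v: "(\<lambda>x. k x / n_energy \<mu> x) \<in> borel_measurable borel" "\<And>x. \<bar>k x / n_energy \<mu> x\<bar> \<le> C"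
    by (rule test_function_over_n_energy[OF \<mu> k]) blast
  have "k \<in> borel_measurable borel"
    by (rule borel_measurable_continuous_onI[OF test_function_continuous[OF k]])
  from radial_weak_form[OF \<mu> T h this test_function_L2[OF k] v(2)] weak_form_symmetrised[OF \<mu> \<psi> v]
  show ?thesis by simp
qed

lemma radial_symmetric_test:
  assumes "\<mu> > 0" "is_radial_collision_operator \<mu> T" "test_function h" "test_function k"
  shows "L2_inner energy_measure (T h) k = L2_inner energy_measure h (T k)"
  unfolding L2_inner_commute[of _ h]
  unfolding radial_form_test[OF assms] radial_form_test[OF assms(1,2,4,3)]
  by (rule arg_cong[where f = "\<lambda>x. - (1 / 4) * x"], rule Bochner_Integration.integral_cong[OF refl])
     (simp only: mult.commute)

text \<open>
  Pairing with \<open>n\<close> is the weak form with the constant function \<open>1\<close>, for which the integral of the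
  bracket vanishes by symmetry.
\<close>

lemma radial_orthogonal_n_energy:
  assumes \<mu>: "\<mu> > 0" and T: "is_radial_collision_operator \<mu> T" and h: "test_function h"
  shows "L2_inner energy_measure (T h) (n_energy \<mu>) = 0"
proof -
  let ?\<psi> = "\<lambda>x. h x / n_energy \<mu> x"
  obtain B R where \<psi>: "?\<psi> \<in> borel_measurable borel" "\<And>x. \<bar>?\<psi> x\<bar> \<le> B" "\<And>x. R < x \<Longrightarrow> ?\<psi> x = 0"
    by (rule test_function_over_n_energy[OF \<mu> h]) blast
  have "\<bar>n_energy \<mu> x / n_energy \<mu> x\<bar> \<le> 1" for x by simp
  from radial_weak_form[OF \<mu> T h borel_measurable_n_energy n_energy_L2[OF \<mu>] this]
  have "L2_inner energy_measure (T h) (n_energy \<mu>)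
      = (LINT z|lborel. n_energy \<mu> (en0 z) / n_energy \<mu> (en0 z) * (collision_weight \<mu> z * collision_bracket ?\<psi> z))" .
  also have "\<dots> = (LINT z|lborel. collision_weight \<mu> z * collision_bracket ?\<psi> z)"
  proof (intro Bochner_Integration.integral_cong refl)
    fix z
    show "n_energy \<mu> (en0 z) / n_energy \<mu> (en0 z) * (collision_weight \<mu> z * collision_bracket ?\<psi> z)
        = collision_weight \<mu> z * collision_bracket ?\<psi> z"
      using collision_weight_eq_0[of z \<mu>] n_energy_pos[OF \<mu>, of "en0 z"]
      by (cases "0 < en0 z") auto
  qed
  also have "\<dots> = 0" by (rule integral_weight_bracket_eq_0[OF \<mu> \<psi>])
  finally show ?thesis .
qed

lemma test_function_sequence:
  assumes g: "g \<in> L2 energy_measure"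
  obtains h where "\<And>n. test_function (h n)"
    "(\<lambda>n. LINT x|energy_measure. (g x - h n x)\<^sup>2) \<longlonglongrightarrow> 0"
proof -
  have "\<forall>n. \<exists>h. test_function h \<and> (LINT x|energy_measure. (g x - h x)\<^sup>2) < inverse (real (Suc n))"
    using test_functions_dense[OF g] by (simp add: test_approx_def)
  then obtain h where h: "\<And>n. test_function (h n)"
    "\<And>n. (LINT x|energy_measure. (g x - h n x)\<^sup>2) < inverse (real (Suc n))"
    unfolding choice_iff by blast
  have "(\<lambda>n. LINT x|energy_measure. (g x - h n x)\<^sup>2) \<longlonglongrightarrow> 0"
  proof (rule tendsto_sandwich[OF _ _ tendsto_const LIMSEQ_inverse_real_of_nat])
    show "\<forall>\<^sub>F n in sequentially. 0 \<le> (LINT x|energy_measure. (g x - h n x)\<^sup>2)" by simp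
    show "\<forall>\<^sub>F n in sequentially. (LINT x|energy_measure. (g x - h n x)\<^sup>2) \<le> inverse (real (Suc n))"
      using h(2) by (intro always_eventually allI less_imp_le)
  qed
  with h(1) show ?thesis by (rule that)
qed

lemma L2_norm_diff_tendsto:
  assumes "(\<lambda>n. LINT x|M. (g x - h n x)\<^sup>2) \<longlonglongrightarrow> 0"
  shows "(\<lambda>n. L2_norm M (\<lambda>x. h n x - g x)) \<longlonglongrightarrow> 0"
proof -
  have "L2_norm M (\<lambda>x. h n x - g x) = sqrt (LINT x|M. (g x - h n x)\<^sup>2)" for n
  proof -
    have "(h n x - g x) * (h n x - g x) = (g x - h n x)\<^sup>2" for x
      by (simp add: power2_eq_square algebra_simps)
    then show ?thesis by (simp only: L2_norm_def L2_inner_def)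
  qed
  then show ?thesis using tendsto_real_sqrt[OF assms] by simp
qed

lemma L2_inner_tendsto:
  assumes f: "\<And>n. f n \<in> L2 M" "F \<in> L2 M" and g: "\<And>n. g n \<in> L2 M" "G \<in> L2 M"
    and lf: "(\<lambda>n. L2_norm M (\<lambda>x. f n x - F x)) \<longlonglongrightarrow> 0"
    and lg: "(\<lambda>n. L2_norm M (\<lambda>x. g n x - G x)) \<longlonglongrightarrow> 0"
  shows "(\<lambda>n. L2_inner M (f n) (g n)) \<longlonglongrightarrow> L2_inner M F G"
proof -
  let ?f = "\<lambda>n x. f n x - F x" and ?g = "\<lambda>n x. g n x - G x"
  have d: "?f n \<in> L2 M" "?g n \<in> L2 M" for n using f g by (auto intro: L2_diff)
  have split: "L2_inner M (f n) (g n) - L2_inner M F G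
      = L2_inner M (?f n) (?g n) + L2_inner M (?f n) G + L2_inner M F (?g n)" for n
    using f g d L2_inner_diff_left[OF f(1)[of n] f(2) d(2)[of n]] L2_inner_diff_left[OF f(1)[of n] f(2) g(2)]
      L2_inner_diff_left[OF g(1)[of n] g(2) f(1)[of n]] L2_inner_diff_left[OF g(1)[of n] g(2) f(2)]
    by (simp add: L2_inner_commute)
  have "(\<lambda>n. L2_inner M (f n) (g n) - L2_inner M F G) \<longlonglongrightarrow> 0"
  proof (rule Lim_null_comparison)
    show "(\<lambda>n. L2_norm M (?f n) * L2_norm M (?g n) + L2_norm M (?f n) * L2_norm M G + L2_norm M F * L2_norm M (?g n)) \<longlonglongrightarrow> 0"
      using tendsto_add[OF tendsto_add[OF tendsto_mult[OF lf lg] tendsto_mult[OF lf tendsto_const]] tendsto_mult[OF tendsto_const lg]]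
      by simp
    show "\<forall>\<^sub>F n in sequentially. norm (L2_inner M (f n) (g n) - L2_inner M F G)
        \<le> L2_norm M (?f n) * L2_norm M (?g n) + L2_norm M (?f n) * L2_norm M G + L2_norm M F * L2_norm M (?g n)"
    proof (intro always_eventually allI)
      fix n
      show "norm (L2_inner M (f n) (g n) - L2_inner M F G)
        \<le> L2_norm M (?f n) * L2_norm M (?g n) + L2_norm M (?f n) * L2_norm M G + L2_norm M F * L2_norm M (?g n)"
        unfolding split
        using L2_Cauchy_Schwarz[OF d(1)[of n] d(2)[of n]] L2_Cauchy_Schwarz[OF d(1)[of n] g(2)]
          L2_Cauchy_Schwarz[OF f(2) d(2)[of n]]
        unfolding real_norm_def by linarith
    qed
  qed
  then show ?thesis by (simp add: LIM_zero_iff)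
qed

lemma L2_operator_tendsto:
  assumes T: "L2_bounded_operator M T" and f: "\<And>n. f n \<in> L2 M" "F \<in> L2 M"
    and lf: "(\<lambda>n. L2_norm M (\<lambda>x. f n x - F x)) \<longlonglongrightarrow> 0"
  shows "(\<lambda>n. L2_norm M (\<lambda>x. T (f n) x - T F x)) \<longlonglongrightarrow> 0"
proof -
  obtain C where C: "\<forall>f\<in>L2 M. L2_norm M (T f) \<le> C * L2_norm M f"
    using L2_bounded_operatorD(4)[OF T] by blast
  let ?f = "\<lambda>n x. f n x - F x"
  have d: "?f n \<in> L2 M" for n by (rule L2_diff[OF f])
  note TL = L2_bounded_operatorD(1)[OF T]
  have eq: "L2_norm M (\<lambda>x. T (f n) x - T F x) = L2_norm M (T (?f n))" for n
  proof -
    have ae: "AE x in M. T (f n) x - T F x = T (?f n) x"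
      using L2_operator_diff[OF T f(1)[of n] f(2)] by eventually_elim simp
    have D: "(\<lambda>x. T (f n) x - T F x) \<in> L2 M" by (intro L2_diff TL f)
    have "L2_inner M (\<lambda>x. T (f n) x - T F x) (\<lambda>x. T (f n) x - T F x) = L2_inner M (T (?f n)) (\<lambda>x. T (f n) x - T F x)"
      by (rule L2_inner_AE_cong[OF D TL[OF d] D ae])
    also have "\<dots> = L2_inner M (T (?f n)) (T (?f n))"
      unfolding L2_inner_commute[of M "T (?f n)" "\<lambda>x. T (f n) x - T F x"]
      by (rule L2_inner_AE_cong[OF D TL[OF d] TL[OF d] ae])
    finally show ?thesis by (simp add: L2_norm_def)
  qed
  show ?thesis
  proof (rule tendsto_sandwich[OF _ _ tendsto_const])
    show "\<forall>\<^sub>F n in sequentially. 0 \<le> L2_norm M (\<lambda>x. T (f n) x - T F x)"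
      by (intro always_eventually allI L2_norm_nonneg)
    show "\<forall>\<^sub>F n in sequentially. L2_norm M (\<lambda>x. T (f n) x - T F x) \<le> C * L2_norm M (?f n)"
      unfolding eq using C d by (intro always_eventually allI) blast
    show "(\<lambda>n. C * L2_norm M (?f n)) \<longlonglongrightarrow> 0" using tendsto_mult[OF tendsto_const lf, of C] by simp
  qed
qed

text \<open>
  Since \<open>n\<close> is a limit of test functions, symmetry passes to the limit, and \<open>T n\<close> is orthogonal to
  every test function. By density it is orthogonal to itself.
\<close>

lemma radial_operator_n_energy:
  assumes \<mu>: "\<mu> > 0" and T: "is_radial_collision_operator \<mu> T"
  shows "AE x in energy_measure. T (n_energy \<mu>) x = 0"
proof -
  let ?n = "n_energy \<mu>"
  have bd: "L2_bounded_operator energy_measure T" using T by (simp add: is_radial_collision_operator_def)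
  note TL = L2_bounded_operatorD(1)[OF bd] and tL = test_function_L2 and nL = n_energy_L2[OF \<mu>]
  have const: "(\<lambda>n::nat. L2_norm energy_measure (\<lambda>x. u x - u x)) \<longlonglongrightarrow> 0" for u
    by (simp add: L2_norm_def L2_inner_def)
  have orth: "L2_inner energy_measure (T ?n) h = 0" if h: "test_function h" for h
  proof -
    obtain g where g: "\<And>n. test_function (g n)" "(\<lambda>n. LINT x|energy_measure. (?n x - g n x)\<^sup>2) \<longlonglongrightarrow> 0"
      using test_function_sequence[OF nL] by blast
    note lg = L2_norm_diff_tendsto[OF g(2)]
    have "(\<lambda>n. L2_inner energy_measure (T (g n)) h) \<longlonglongrightarrow> L2_inner energy_measure (T ?n) h"
      by (intro L2_inner_tendsto TL tL g(1) nL h L2_operator_tendsto[OF bd] lg const)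
    moreover have "(\<lambda>n. L2_inner energy_measure (g n) (T h)) \<longlonglongrightarrow> L2_inner energy_measure ?n (T h)"
      by (intro L2_inner_tendsto TL tL g(1) nL h lg const)
    moreover have "L2_inner energy_measure (T (g n)) h = L2_inner energy_measure (g n) (T h)" for n
      by (rule radial_symmetric_test[OF \<mu> T g(1) h])
    ultimately have "L2_inner energy_measure (T ?n) h = L2_inner energy_measure ?n (T h)"
      by (simp add: LIMSEQ_unique)
    then show ?thesis
      using radial_orthogonal_n_energy[OF \<mu> T h] by (simp add: L2_inner_commute)
  qed
  have Tn: "T ?n \<in> L2 energy_measure" by (rule TL[OF nL])
  obtain h where h: "\<And>n. test_function (h n)" "(\<lambda>n. LINT x|energy_measure. (T ?n x - h n x)\<^sup>2) \<longlonglongrightarrow> 0"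
    using test_function_sequence[OF Tn] by blast
  have "(\<lambda>n. L2_inner energy_measure (T ?n) (h n)) \<longlonglongrightarrow> L2_inner energy_measure (T ?n) (T ?n)"
    by (intro L2_inner_tendsto Tn tL h(1) const L2_norm_diff_tendsto[OF h(2)])
  then have "L2_inner energy_measure (T ?n) (T ?n) = 0"
    using orth[OF h(1)] by (simp add: LIMSEQ_const_iff)
  then show ?thesis by (rule L2_inner_self_eq_0[OF Tn])
qed

section \<open>The kernel of the radial operator\<close>

text \<open>
  On test functions the form is the integral of the weight times the square of the bracket. Along
  test functions approximating \<open>g\<close> it tends to the form at \<open>g\<close>, which is zero. The lemma of Fatou along
  an almost everywhere convergent subsequence bounds the integral for \<open>g\<close> itself.
\<close>

lemma radial_kernel_imp_bracket_zero:
  assumes \<mu>: "\<mu> > 0" and T: "is_radial_collision_operator \<mu> T"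
    and g: "g \<in> L2_Ker energy_measure T"
  defines "\<phi> \<equiv> \<lambda>x. indicator {0<..} x * g x / n_energy \<mu> x"
  shows "AE z in lborel. 0 < en0 z \<and> 0 < en1 z \<and> 0 < en2 z \<and> 0 < en3 z \<longrightarrow> collision_bracket \<phi> z = 0"
proof -
  have bd: "L2_bounded_operator energy_measure T" using T by (simp add: is_radial_collision_operator_def)
  have gL: "g \<in> L2 energy_measure" and Tg: "AE x in energy_measure. T g x = 0"
    using g by (auto simp: L2_Ker_def)
  have [measurable]: "(\<lambda>x. indicator {0<..} x * g x) \<in> borel_measurable borel"
    using L2_measurable[OF gL] unfolding energy_measurable_iff .
  have \<phi>[measurable]: "\<phi> \<in> borel_measurable borel"
    unfolding \<phi>_def by measurable
  obtain h where h: "\<And>n. test_function (h n)" and lim: "(\<lambda>n. LINT x|energy_measure. (g x - h n x)\<^sup>2) \<longlonglongrightarrow> 0"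
    using test_function_sequence[OF gL] by blast
  note hL = test_function_L2[OF h]
  define \<psi> where "\<psi> = (\<lambda>n x. h n x / n_energy \<mu> x)"
  have \<psi>: "\<exists>B R. \<psi> n \<in> borel_measurable borel \<and> (\<forall>x. \<bar>\<psi> n x\<bar> \<le> B) \<and> (\<forall>x>R. \<psi> n x = 0)" for n
    unfolding \<psi>_def by (rule test_function_over_n_energy[OF \<mu> h[of n]]) blast
  have m[measurable]: "\<psi> n \<in> borel_measurable borel" for n using \<psi>[of n] by blast
  define Q where "Q = (\<lambda>\<phi> z. collision_weight \<mu> z * (collision_bracket \<phi> z * collision_bracket \<phi> z))"
  have Q0: "0 \<le> Q f z" for f z
    unfolding Q_def by (rule mult_nonneg_nonneg[OF collision_weight_nonneg[OF \<mu>] zero_le_square])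
  have Qm[measurable]: "Q f \<in> borel_measurable borel" if [measurable]: "f \<in> borel_measurable borel" for f
    unfolding Q_def by measurable
  have Qint: "integrable lborel (Q (\<psi> n))" for n
  proof -
    obtain B R where B: "\<And>x. \<bar>\<psi> n x\<bar> \<le> B" and R: "\<And>x. R < x \<Longrightarrow> \<psi> n x = 0" using \<psi>[of n] by blast
    have "\<bar>collision_bracket (\<psi> n) z\<bar> \<le> 4 * B" for z
      unfolding collision_bracket_def
      using B[of "en0 z"] B[of "en1 z"] B[of "en2 z"] B[of "en3 z"] by linarith
    from integrable_weight_bracket[OF \<mu> m B R borel_measurable_collision_bracket[OF m] this]
    show ?thesis by (simp add: Q_def mult_ac)
  qed
  have form: "(LINT z|lborel. Q (\<psi> n) z) = - 4 * L2_inner energy_measure (T (h n)) (h n)" for n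
    using radial_form_test[OF \<mu> T h[of n] h[of n]] by (simp add: Q_def \<psi>_def)
  have "(\<lambda>n. L2_inner energy_measure (T (h n)) (h n)) \<longlonglongrightarrow> L2_inner energy_measure (T g) g"
    by (intro L2_inner_tendsto L2_operator_tendsto[OF bd] L2_bounded_operatorD(1)[OF bd] hL gL
        L2_norm_diff_tendsto[OF lim])
  moreover have "L2_inner energy_measure (T g) g = 0"
    unfolding L2_inner_def by (rule integral_eq_zero_AE) (use Tg in eventually_elim, simp)
  ultimately have Qlim: "(\<lambda>n. LINT z|lborel. Q (\<psi> n) z) \<longlonglongrightarrow> 0"
    unfolding form using tendsto_mult[OF tendsto_const, of _ 0 sequentially "-4"] by fastforce
  have "\<exists>r. strict_mono r \<and> (AE x in energy_measure. (\<lambda>n. (g x - h (r n) x)\<^sup>2) \<longlonglongrightarrow> 0)"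
  proof (rule tendsto_L1_AE_subseq)
    show "integrable energy_measure (\<lambda>x. (g x - h n x)\<^sup>2)" for n
      by (intro L2_integrable_square L2_diff gL hL)
    show "(\<lambda>n. LINT x|energy_measure. norm ((g x - h n x)\<^sup>2)) \<longlonglongrightarrow> 0" using lim by simp
  qed
  then obtain r where r: "strict_mono r" "AE x in energy_measure. (\<lambda>n. (g x - h (r n) x)\<^sup>2) \<longlonglongrightarrow> 0"
    by blast
  have "AE x in lborel. 0 < x \<longrightarrow> (\<lambda>n. \<psi> (r n) x) \<longlonglongrightarrow> \<phi> x"
    using r(2) unfolding AE_energy_measure_iff
  proof eventually_elim
    case (elim x)
    show ?case
    proof
      assume x: "0 < x"
      with elim have "(\<lambda>n. sqrt ((g x - h (r n) x)\<^sup>2)) \<longlonglongrightarrow> sqrt 0" by (intro tendsto_real_sqrt) blast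
      then have "(\<lambda>n. g x - h (r n) x) \<longlonglongrightarrow> 0" by (simp add: tendsto_rabs_zero_iff)
      from tendsto_diff[OF tendsto_const[of "g x"] this] have "(\<lambda>n. h (r n) x) \<longlonglongrightarrow> g x" by simp
      then have "(\<lambda>n. h (r n) x / n_energy \<mu> x) \<longlonglongrightarrow> g x / n_energy \<mu> x"
        using n_energy_pos[OF \<mu>, of x] x by (intro tendsto_divide tendsto_const) auto
      then show "(\<lambda>n. \<psi> (r n) x) \<longlonglongrightarrow> \<phi> x" using x by (simp add: \<psi>_def \<phi>_def)
    qed
  qed
  from AE_energies[OF this]
  have conv: "AE z in lborel. (\<lambda>n. ennreal (Q (\<psi> (r n)) z)) \<longlonglongrightarrow> ennreal (Q \<phi> z)"
  proof eventually_elim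
    case (elim z)
    show ?case
    proof (cases "0 < en0 z \<and> 0 < en1 z \<and> 0 < en2 z \<and> 0 < en3 z")
      case True
      with elim show ?thesis
        unfolding Q_def collision_bracket_def by (intro tendsto_ennrealI tendsto_intros) blast+
    next
      case False
      then show ?thesis by (simp add: Q_def collision_weight_eq_0)
    qed
  qed
  have "(\<integral>\<^sup>+ z. ennreal (Q \<phi> z) \<partial>lborel) = (\<integral>\<^sup>+ z. liminf (\<lambda>n. ennreal (Q (\<psi> (r n)) z)) \<partial>lborel)"
    using conv by (intro nn_integral_cong_AE) (auto elim!: eventually_mono dest: lim_imp_Liminf[rotated])
  also have "\<dots> \<le> liminf (\<lambda>n. \<integral>\<^sup>+ z. ennreal (Q (\<psi> (r n)) z) \<partial>lborel)"
    by (rule nn_integral_liminf) measurable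
  also have "(\<lambda>n. \<integral>\<^sup>+ z. ennreal (Q (\<psi> (r n)) z) \<partial>lborel) = (\<lambda>n. ennreal (LINT z|lborel. Q (\<psi> (r n)) z))"
    using Q0 Qint by (intro ext nn_integral_eq_integral) auto
  also have "liminf \<dots> = 0"
  proof -
    have "(\<lambda>n. ennreal (LINT z|lborel. Q (\<psi> (r n)) z)) \<longlonglongrightarrow> ennreal 0"
      using LIMSEQ_subseq_LIMSEQ[OF Qlim r(1)] by (intro tendsto_ennrealI) (simp add: o_def)
    then show ?thesis by (simp add: lim_imp_Liminf)
  qed
  finally have "(\<integral>\<^sup>+ z. ennreal (Q \<phi> z) \<partial>lborel) = 0" by simp
  then have "AE z in lborel. ennreal (Q \<phi> z) = 0"
    by (subst (asm) nn_integral_0_iff_AE) auto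
  then show ?thesis
  proof eventually_elim
    case (elim z)
    then have "Q \<phi> z = 0" using Q0[of \<phi> z] by (simp add: ennreal_eq_0_iff)
    then show ?case using collision_weight_pos[OF \<mu>, of z] by (auto simp: Q_def)
  qed
qed

lemma integrable_inverse_sqrt:
  "integrable lborel (\<lambda>x. indicator {0..s} x * (1 / sqrt x))"
proof (cases "0 \<le> s")
  case True
  have "((\<lambda>x. x powr (- 1 / 2)) has_integral (s powr (- 1 / 2 + 1) / (- 1 / 2 + 1))) {0..s}"
    using True by (intro has_integral_powr_from_0) auto
  then have "(\<lambda>x. x powr (- 1 / 2)) absolutely_integrable_on {0..s}"
    by (intro nonnegative_absolutely_integrable_1) (auto simp: integrable_on_def)
  then have "integrable lebesgue (\<lambda>x. indicator {0..s} x * x powr (- 1 / 2))"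
    by (simp add: set_integrable_def)
  then have "integrable lborel (\<lambda>x. indicator {0..s} x * x powr (- 1 / 2))"
    by (subst (asm) integrable_completion) auto
  moreover have "indicator {0..s} x * x powr (- 1 / 2) = indicator {0..s} x * (1 / sqrt x)" for x
    by (auto simp: indicator_def powr_half_sqrt powr_minus_divide)
  ultimately show ?thesis by simp
qed (simp add: not_le)

text \<open>
  The weight \<open>\<surd>x\<close> of the energy measure degenerates at \<open>0\<close>. The inequality
  \<open>a \<le> a\<^sup>2 \<surd>x + 1 / \<surd>x\<close> compensates for it, as \<open>1 / \<surd>x\<close> is integrable at \<open>0\<close>.
\<close>

lemma set_integrable_L2_energy:
  assumes \<mu>: "\<mu> > 0" and gL: "g \<in> L2 energy_measure"
  shows "set_integrable lborel {0..s} (\<lambda>x. indicator {0<..} x * g x / n_energy \<mu> x)"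
  unfolding set_integrable_def
proof (rule Bochner_Integration.integrable_bound)
  let ?g = "\<lambda>x. indicator {0<..} x * g x"
  have gm[measurable]: "?g \<in> borel_measurable borel"
    using L2_measurable[OF gL] unfolding energy_measurable_iff .
  have "integrable energy_measure (\<lambda>x. (?g x)\<^sup>2)"
    using L2_integrable_square[OF gL] by (rule Bochner_Integration.integrable_cong[THEN iffD1, rotated 2]) auto
  then have "integrable lborel (\<lambda>x. indicator {0<..} x * (sqrt x * (?g x)\<^sup>2))"
    by (subst (asm) energy_integrable_iff) measurable
  then show "integrable lborel (\<lambda>x. (s + \<mu>)\<^sup>2 * (indicator {0<..} x * (sqrt x * (?g x)\<^sup>2)) + indicator {0..s} x * (1 / sqrt x))"
    by (intro Bochner_Integration.integrable_add integrable_mult_right integrable_inverse_sqrt)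
  show "(\<lambda>x. indicator {0..s} x *\<^sub>R (?g x / n_energy \<mu> x)) \<in> borel_measurable lborel" by measurable
  show "AE x in lborel. norm (indicator {0..s} x *\<^sub>R (?g x / n_energy \<mu> x))
      \<le> norm ((s + \<mu>)\<^sup>2 * (indicator {0<..} x * (sqrt x * (?g x)\<^sup>2)) + indicator {0..s} x * (1 / sqrt x))"
  proof (rule AE_I2)
    fix x
    show "norm (indicator {0..s} x *\<^sub>R (?g x / n_energy \<mu> x))
      \<le> norm ((s + \<mu>)\<^sup>2 * (indicator {0<..} x * (sqrt x * (?g x)\<^sup>2)) + indicator {0..s} x * (1 / sqrt x))"
    proof (cases "0 < x \<and> x \<le> s")
      case True
      define t where "t = sqrt x"
      define a where "a = \<bar>g x\<bar> * (x + \<mu>)"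
      have t: "t > 0" using True by (simp add: t_def)
      have a: "0 \<le> a" using True \<mu> by (simp add: a_def)
      have "a \<le> a\<^sup>2 * t + 1 / t"
      proof (cases "a * t \<le> 1")
        case True
        then have "a \<le> 1 / t" using t by (simp add: field_simps)
        then show ?thesis using t by (simp add: add_increasing)
      next
        case False
        then have "a * 1 \<le> a * (a * t)" using a by (intro mult_left_mono) auto
        then have "a \<le> a\<^sup>2 * t" by (simp add: power2_eq_square mult.assoc)
        then show ?thesis using t by (simp add: add_increasing2)
      qed
      also have "a\<^sup>2 * t \<le> (s + \<mu>)\<^sup>2 * (t * (g x)\<^sup>2)"
      proof -
        have "a\<^sup>2 = (x + \<mu>)\<^sup>2 * (g x)\<^sup>2" by (simp add: a_def power_mult_distrib mult.commute)
        also have "\<dots> \<le> (s + \<mu>)\<^sup>2 * (g x)\<^sup>2" using True \<mu> by (intro mult_right_mono power_mono) auto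
        finally have "a\<^sup>2 * t \<le> (s + \<mu>)\<^sup>2 * (g x)\<^sup>2 * t" using t by (intro mult_right_mono) auto
        then show ?thesis by (simp add: mult_ac)
      qed
      finally have "a \<le> \<bar>(s + \<mu>)\<^sup>2 * (t * (g x)\<^sup>2) + 1 / t\<bar>" by simp
      moreover have "norm (indicator {0..s} x *\<^sub>R (?g x / n_energy \<mu> x)) = a"
        using True \<mu> by (simp add: a_def n_energy_def abs_mult)
      ultimately show ?thesis using True by (simp add: t_def)
    next
      case False
      have "indicator {0..s} x *\<^sub>R (?g x / n_energy \<mu> x) = 0" using False by (auto simp: indicator_def)
      then show ?thesis by (metis norm_ge_zero norm_zero)
    qed
  qed
qed

text \<open>
  With \<open>\<gamma> \<noteq> 0\<close> the integrand stays above a positive constant on \<open>[R, 2 R]\<close> for all large \<open>R\<close>.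
\<close>

lemma L2_energy_affine_imp_const:
  fixes \<alpha> \<gamma> :: real
  assumes \<mu>: "\<mu> > 0" and L2: "(\<lambda>x. n_energy \<mu> x * (\<alpha> + \<gamma> * x)) \<in> L2 energy_measure"
  shows "\<gamma> = 0"
proof (rule ccontr)
  assume \<gamma>: "\<gamma> \<noteq> 0"
  let ?h = "\<lambda>x. indicator {0<..} x * (sqrt x * (n_energy \<mu> x * (\<alpha> + \<gamma> * x))\<^sup>2)"
  define J where "J = (LINT x|lborel. ?h x)"
  have int: "integrable lborel ?h"
    using L2_integrable_square[OF L2] by (subst (asm) energy_integrable_iff) measurable
  define d where "d = (\<bar>\<gamma>\<bar> / 6)\<^sup>2"
  have d: "d > 0" using \<gamma> by (simp add: d_def)
  have bound: "d * R \<le> J" if R: "1 \<le> R" "\<mu> \<le> R" "2 * \<bar>\<alpha>\<bar> / \<bar>\<gamma>\<bar> \<le> R" for R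
  proof -
    have lower: "d \<le> ?h x" if x: "x \<in> {R..2 * R}" for x
    proof -
      have x0: "1 \<le> x" "0 < x" "x \<le> 2 * R" "R \<le> x" using x R by auto
      have "\<bar>\<alpha>\<bar> \<le> \<bar>\<gamma>\<bar> * R / 2" using R(3) \<gamma> by (simp add: field_simps)
      moreover have "\<bar>\<gamma>\<bar> * R \<le> \<bar>\<gamma> * x\<bar>" using x0 R by (simp add: abs_mult mult_left_mono)
      ultimately have P: "\<bar>\<gamma>\<bar> * R / 2 \<le> \<bar>\<alpha> + \<gamma> * x\<bar>" by linarith
      have n: "1 / (3 * R) \<le> n_energy \<mu> x"
        unfolding n_energy_def using x0 R \<mu> by (intro divide_left_mono) auto
      have "\<bar>\<gamma>\<bar> / 6 = 1 / (3 * R) * (\<bar>\<gamma>\<bar> * R / 2)" using R by simp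
      also have "\<dots> \<le> n_energy \<mu> x * \<bar>\<alpha> + \<gamma> * x\<bar>"
        using n P R n_energy_pos[OF \<mu>, of x] x0 by (intro mult_mono) auto
      finally have "d \<le> (n_energy \<mu> x * \<bar>\<alpha> + \<gamma> * x\<bar>)\<^sup>2"
        unfolding d_def by (intro power_mono) auto
      also have "\<dots> = 1 * (n_energy \<mu> x * (\<alpha> + \<gamma> * x))\<^sup>2" by (simp add: power_mult_distrib)
      also have "\<dots> \<le> sqrt x * (n_energy \<mu> x * (\<alpha> + \<gamma> * x))\<^sup>2"
        using x0 by (intro mult_right_mono) auto
      finally show ?thesis using x0 by simp
    qed
    have "d * R = (LINT x|lborel. d * indicator {R..2 * R} x)" using R by simp
    also have "\<dots> \<le> J"
      unfolding J_def
    proof (rule integral_mono[OF _ int])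
      show "integrable lborel (\<lambda>x. d * indicator {R..2 * R} x)"
        using R by (intro integrable_mult_right integrable_real_indicator) (auto simp: emeasure_lborel_Icc_eq)
      show "d * indicator {R..2 * R} x \<le> ?h x" for x
      proof (cases "x \<in> {R..2 * R}")
        case True
        then show ?thesis using lower[OF True] by simp
      next
        case False
        have "0 \<le> ?h x" by (cases "0 < x") auto
        with False show ?thesis by simp
      qed
    qed
    finally show ?thesis .
  qed
  define R where "R = 1 + \<mu> + 2 * \<bar>\<alpha>\<bar> / \<bar>\<gamma>\<bar> + (\<bar>J\<bar> + 1) / d"
  have pos: "0 \<le> 2 * \<bar>\<alpha>\<bar> / \<bar>\<gamma>\<bar>" "0 \<le> (\<bar>J\<bar> + 1) / d" using d by auto
  have "d * R \<le> J" using pos \<mu> by (intro bound) (auto simp: R_def)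
  moreover have "d * ((\<bar>J\<bar> + 1) / d) \<le> d * R" using pos d \<mu> by (intro mult_left_mono) (auto simp: R_def)
  moreover have "d * ((\<bar>J\<bar> + 1) / d) = \<bar>J\<bar> + 1" using d by simp
  ultimately show False by linarith
qed

text \<open>
  A kernel element satisfies the Pexider equation for almost every pair \<open>\<omega>1, \<omega>2\<close> after exchanging
  the order of the variables. It is thus \<open>n\<close> times an affine function, and only the constant one
  leaves it square integrable. The converse is that the operator annihilates \<open>n\<close>.
\<close>

lemma radial_kernel_iff:
  assumes \<mu>: "\<mu> > 0" and T: "is_radial_collision_operator \<mu> T" and gL: "g \<in> L2 energy_measure"
  shows "g \<in> L2_Ker energy_measure T \<longleftrightarrow> (\<exists>a. AE w in energy_measure. g w = a * n_energy \<mu> w)"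
proof
  have bd: "L2_bounded_operator energy_measure T" using T by (simp add: is_radial_collision_operator_def)
  assume "\<exists>a. AE w in energy_measure. g w = a * n_energy \<mu> w"
  then obtain a where a: "AE w in energy_measure. g w = a * n_energy \<mu> w" by blast
  have "AE w in energy_measure. T g w = 0"
    using L2_operator_AE_cong[OF bd gL L2_cmult[OF n_energy_L2[OF \<mu>]] a]
      L2_bounded_operatorD(3)[OF bd n_energy_L2[OF \<mu>], of a] radial_operator_n_energy[OF \<mu> T]
    by eventually_elim simp
  with gL show "g \<in> L2_Ker energy_measure T" by (simp add: L2_Ker_def)
next
  assume g: "g \<in> L2_Ker energy_measure T"
  define \<phi> where "\<phi> = (\<lambda>x. indicator {0<..} x * g x / n_energy \<mu> x)"
  have gm[measurable]: "(\<lambda>x. indicator {0<..} x * g x) \<in> borel_measurable borel"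
    using L2_measurable[OF gL] unfolding energy_measurable_iff .
  have \<phi>[measurable]: "\<phi> \<in> borel_measurable borel" unfolding \<phi>_def by measurable
  let ?P = "\<lambda>z. 0 < en0 z \<and> 0 < en1 z \<and> 0 < en2 z \<and> 0 < en3 z \<longrightarrow> collision_bracket \<phi> z = 0"
  have ae: "AE z in lborel \<Otimes>\<^sub>M lborel. ?P z"
    using radial_kernel_imp_bracket_zero[OF \<mu> T g] unfolding \<phi>_def lborel_prod .
  have "AE w in lborel. AE p in lborel. ?P (w, p)"
    by (rule lborel_pair.AE_pair[OF ae])
  then have "AE p in lborel. AE w in lborel. ?P (w, p)"
  proof (subst (asm) lborel_pair.AE_commute)
    have "{z \<in> space borel. ?P z} \<in> sets borel" by measurable
    then show "{x \<in> space (lborel \<Otimes>\<^sub>M lborel). ?P (fst x, snd x)} \<in> sets (lborel \<Otimes>\<^sub>M lborel)"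
      unfolding lborel_prod by simp
  qed
  then have eq: "AE p in lborel \<Otimes>\<^sub>M lborel. 0 < fst p \<and> 0 < snd p \<longrightarrow>
      (AE w in lborel. 0 < w \<and> w < fst p + snd p \<longrightarrow> \<phi> (fst p) + \<phi> (snd p) = \<phi> w + \<phi> (fst p + snd p - w))"
    unfolding lborel_prod
  proof eventually_elim
    case (elim p)
    show ?case
    proof
      assume p: "0 < fst p \<and> 0 < snd p"
      show "AE w in lborel. 0 < w \<and> w < fst p + snd p \<longrightarrow> \<phi> (fst p) + \<phi> (snd p) = \<phi> w + \<phi> (fst p + snd p - w)"
        using elim
      proof eventually_elim
        case (elim w)
        then show ?case using p
          by (simp add: en0_def en1_def en2_def en3_def collision_bracket_def diff_eq_eq add.commute)
      qed
    qed
  qed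
  obtain \<alpha> \<gamma> where aff: "AE x in lborel. 0 < x \<longrightarrow> \<phi> x = \<alpha> + \<gamma> * x"
    using AE_affine_if_pexider[OF \<phi> set_integrable_L2_energy[OF \<mu> gL, folded \<phi>_def] eq] by blast
  have g_eq: "AE x in energy_measure. g x = n_energy \<mu> x * (\<alpha> + \<gamma> * x)"
    unfolding AE_energy_measure_iff using aff
  proof eventually_elim
    case (elim x)
    show ?case
    proof
      assume x: "0 < x"
      then have "g x / n_energy \<mu> x = \<alpha> + \<gamma> * x" using elim by (simp add: \<phi>_def)
      then show "g x = n_energy \<mu> x * (\<alpha> + \<gamma> * x)"
        using n_energy_pos[OF \<mu>, of x] x by (simp add: field_simps)
    qed
  qed
  have "(\<lambda>x. n_energy \<mu> x * (\<alpha> + \<gamma> * x)) \<in> borel_measurable energy_measure"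
    by (rule borel_imp_energy_measurable) measurable
  from L2_energy_affine_imp_const[OF \<mu> L2_AE_cong[OF gL this g_eq]] have "\<gamma> = 0" .
  with g_eq show "\<exists>a. AE w in energy_measure. g w = a * n_energy \<mu> w"
    by (intro exI[of _ \<alpha>]) (auto elim: eventually_mono simp: mult.commute)
qed

section \<open>The kernels\<close>

lemma collisional_invariant_iff_quadratic:
  fixes g :: "R3 \<Rightarrow> real"
  assumes \<mu>: "\<mu> > 0" and g: "g \<in> L2 lborel"
  shows "collisional_invariant (\<lambda>k. g k / n_tilde \<mu> k) \<longleftrightarrow>
    (\<exists>\<alpha> \<gamma> \<beta>. AE k in lborel. g k = n_tilde \<mu> k * (\<alpha> + \<beta> \<bullet> k + \<gamma> * (norm k)\<^sup>2))"
proof -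
  have [measurable]: "g \<in> borel_measurable borel" using L2_measurable[OF g] by simp
  have n: "n_tilde \<mu> k \<noteq> 0" for k using n_tilde_pos[OF \<mu>, of k] by simp
  have div: "g k / n_tilde \<mu> k = p \<longleftrightarrow> g k = n_tilde \<mu> k * p" for k p
    using n[of k] by (simp add: field_simps)
  show ?thesis
  proof
    assume "collisional_invariant (\<lambda>k. g k / n_tilde \<mu> k)"
    from AE_quadratic_if_collisional_invariant[OF locally_integrable_L2_over_n_tilde[OF \<mu> g] this]
    show "\<exists>\<alpha> \<gamma> \<beta>. AE k in lborel. g k = n_tilde \<mu> k * (\<alpha> + \<beta> \<bullet> k + \<gamma> * (norm k)\<^sup>2)"
      unfolding div by blast
  next
    assume "\<exists>\<alpha> \<gamma> \<beta>. AE k in lborel. g k = n_tilde \<mu> k * (\<alpha> + \<beta> \<bullet> k + \<gamma> * (norm k)\<^sup>2)"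
    then obtain \<alpha> \<gamma> \<beta> where "AE k in lborel. g k / n_tilde \<mu> k = \<alpha> + \<beta> \<bullet> k + \<gamma> * (norm k)\<^sup>2"
      unfolding div by blast
    moreover have "(\<lambda>k. g k / n_tilde \<mu> k) \<in> borel_measurable borel" by measurable
    ultimately show "collisional_invariant (\<lambda>k. g k / n_tilde \<mu> k)"
      by (rule collisional_invariant_if_AE_quadratic[rotated])
  qed
qed

theorem proposition1p1:
  fixes \<mu> :: real
    and Lk :: "(R3 \<Rightarrow> real) \<Rightarrow> (R3 \<Rightarrow> real)"
    and Lw :: "(real \<Rightarrow> real) \<Rightarrow> (real \<Rightarrow> real)"
  assumes "\<mu> > 0"
    and "is_collision_operator \<mu> Lk"
    and "is_radial_collision_operator \<mu> Lw"
  shows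
    "(\<forall>g \<in> L2 lborel.
        (g \<in> L2_Ker lborel Lk \<longleftrightarrow> collisional_invariant (\<lambda>k. g k / n_tilde \<mu> k)) \<and>
        (collisional_invariant (\<lambda>k. g k / n_tilde \<mu> k) \<longleftrightarrow>
           (\<exists>\<alpha> \<gamma> \<beta>.
              (AE k in lborel. g k = n_tilde \<mu> k * (\<alpha> + \<beta> \<bullet> k + \<gamma> * (norm k)\<^sup>2)) \<and>
              (\<lambda>k. n_tilde \<mu> k * (\<alpha> + \<beta> \<bullet> k + \<gamma> * (norm k)\<^sup>2)) \<in> L2 lborel))) \<and>
     (\<forall>\<alpha> \<gamma> \<beta>.
        (\<lambda>k. n_tilde \<mu> k * (\<alpha> + \<beta> \<bullet> k + \<gamma> * (norm k)\<^sup>2)) \<in> L2 lborel \<longleftrightarrow>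
        (\<exists>c. \<forall>k. n_tilde \<mu> k * (\<alpha> + \<beta> \<bullet> k + \<gamma> * (norm k)\<^sup>2) = c * n_tilde \<mu> k)) \<and>
     n_tilde \<mu> \<in> L2 lborel \<and>
     L2_Ker lborel Lk = L2_Span1 lborel (n_tilde \<mu>) \<and>
     (\<forall>g \<in> L2 energy_measure.
        g \<in> L2_Ker energy_measure Lw \<longleftrightarrow>
        (\<exists>a. AE \<omega> in energy_measure. g \<omega> = a * n_energy \<mu> \<omega>))"
proof -
  note \<mu> = assms(1) and Lk = assms(2) and Lw = assms(3)
  let ?P = "\<lambda>\<alpha> \<gamma> \<beta> k. n_tilde \<mu> k * (\<alpha> + \<beta> \<bullet> k + \<gamma> * (norm k)\<^sup>2)"
  have P_L2: "?P \<alpha> \<gamma> \<beta> \<in> L2 lborel" if "g \<in> L2 lborel" "AE k in lborel. g k = ?P \<alpha> \<gamma> \<beta> k" for g \<alpha> \<gamma> \<beta>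
  proof (rule L2_AE_cong[OF that(1) _ that(2)])
    have "?P \<alpha> \<gamma> \<beta> \<in> borel_measurable borel" by measurable
    then show "?P \<alpha> \<gamma> \<beta> \<in> borel_measurable lborel" by simp
  qed
  have equiv: "(g \<in> L2_Ker lborel Lk \<longleftrightarrow> collisional_invariant (\<lambda>k. g k / n_tilde \<mu> k)) \<and>
      (collisional_invariant (\<lambda>k. g k / n_tilde \<mu> k) \<longleftrightarrow>
        (\<exists>\<alpha> \<gamma> \<beta>. (AE k in lborel. g k = ?P \<alpha> \<gamma> \<beta> k) \<and> ?P \<alpha> \<gamma> \<beta> \<in> L2 lborel))"
    if g: "g \<in> L2 lborel" for g
    using kernel_iff_collisional_invariant[OF \<mu> Lk g] collisional_invariant_iff_quadratic[OF \<mu> g] P_L2[OF g]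
    by blast
  have const: "?P \<alpha> \<gamma> \<beta> \<in> L2 lborel \<longleftrightarrow> (\<exists>c. \<forall>k. ?P \<alpha> \<gamma> \<beta> k = c * n_tilde \<mu> k)" for \<alpha> \<gamma> \<beta>
  proof
    assume "?P \<alpha> \<gamma> \<beta> \<in> L2 lborel"
    from L2_quadratic_imp_const[OF \<mu> this] show "\<exists>c. \<forall>k. ?P \<alpha> \<gamma> \<beta> k = c * n_tilde \<mu> k"
      by (intro exI[of _ \<alpha>]) simp
  next
    assume "\<exists>c. \<forall>k. ?P \<alpha> \<gamma> \<beta> k = c * n_tilde \<mu> k"
    then obtain c where "?P \<alpha> \<gamma> \<beta> = (\<lambda>k. c * n_tilde \<mu> k)" by blast
    then show "?P \<alpha> \<gamma> \<beta> \<in> L2 lborel" using L2_cmult[OF n_tilde_L2[OF \<mu>]] by simp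
  qed
  have span: "g \<in> L2_Ker lborel Lk \<longleftrightarrow> g \<in> L2_Span1 lborel (n_tilde \<mu>)" for g
  proof
    assume ker: "g \<in> L2_Ker lborel Lk"
    then have g: "g \<in> L2 lborel" by (simp add: L2_Ker_def)
    with ker equiv obtain \<alpha> \<gamma> \<beta> where P: "AE k in lborel. g k = ?P \<alpha> \<gamma> \<beta> k" "?P \<alpha> \<gamma> \<beta> \<in> L2 lborel"
      by blast
    from const P(2) obtain c where "\<forall>k. ?P \<alpha> \<gamma> \<beta> k = c * n_tilde \<mu> k" by blast
    with P(1) have "AE k in lborel. g k = c * n_tilde \<mu> k" by simp
    with g show "g \<in> L2_Span1 lborel (n_tilde \<mu>)" by (auto simp: L2_Span1_def)
  next
    assume "g \<in> L2_Span1 lborel (n_tilde \<mu>)"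
    then obtain c where g: "g \<in> L2 lborel" and "AE k in lborel. g k = c * n_tilde \<mu> k"
      by (auto simp: L2_Span1_def)
    then have "AE k in lborel. g k = ?P c 0 0 k" by (simp add: mult.commute)
    with P_L2[OF g this] equiv[OF g] show "g \<in> L2_Ker lborel Lk" by blast
  qed
  show ?thesis
  proof (intro conjI ballI allI)
    fix g :: "R3 \<Rightarrow> real" assume g: "g \<in> L2 lborel"
    show "g \<in> L2_Ker lborel Lk \<longleftrightarrow> collisional_invariant (\<lambda>k. g k / n_tilde \<mu> k)"
      using equiv[OF g] by blast
    show "collisional_invariant (\<lambda>k. g k / n_tilde \<mu> k) \<longleftrightarrow>
        (\<exists>\<alpha> \<gamma> \<beta>. (AE k in lborel. g k = ?P \<alpha> \<gamma> \<beta> k) \<and> ?P \<alpha> \<gamma> \<beta> \<in> L2 lborel)"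
      using equiv[OF g] by blast
  next
    show "?P \<alpha> \<gamma> \<beta> \<in> L2 lborel \<longleftrightarrow> (\<exists>c. \<forall>k. ?P \<alpha> \<gamma> \<beta> k = c * n_tilde \<mu> k)" for \<alpha> \<gamma> \<beta>
      by (rule const)
  next
    show "n_tilde \<mu> \<in> L2 lborel" by (rule n_tilde_L2[OF \<mu>])
    show "L2_Ker lborel Lk = L2_Span1 lborel (n_tilde \<mu>)" using span by blast
  next
    fix g :: "real \<Rightarrow> real" assume "g \<in> L2 energy_measure"
    then show "g \<in> L2_Ker energy_measure Lw \<longleftrightarrow> (\<exists>a. AE \<omega> in energy_measure. g \<omega> = a * n_energy \<mu> \<omega>)"
      by (rule radial_kernel_iff[OF \<mu> Lw])
  qed
qed

end
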